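(* Let $\mathcal R$ be a tolerance relation on $X=\{1,\ldots,n\}$, $n\ge 1$. The inclusion map $E(\mathcal R)\to C^*_{\mathrm{env}}(E(\mathcal R))\cong\bigoplus_{K\in\mathcal K}M_{|K|}(\mathbb C)$ induces isomorphisms (bijections) $\mathcal V_0(E(\mathcal R),m)\cong\mathcal V_0\big(\bigoplus_{K\in\mathcal K}M_{|K|}(\mathbb C),m\big)$ for every $m\ge1$, intertwining the connecting maps $\imath_{mm'}$ ($m'\geq m$) for $E(\mathcal R)$ with those for $\bigoplus_{K\in\mathcal K}M_{|K|}(\mathbb C)$. It follows that $K_0(E(\mathcal R))\cong K_0\big(\bigoplus_{K\in\mathcal K}M_{|K|}(\mathbb C)\big)\cong\mathbb Z^{|\mathcal K|}$.
   Context: A tolerance relation on $X$ is a reflexive and symmetric relation $\mathcal R\subseteq X\times X$. The associated graph operator system is $E(\mathcal R)=\{(x_{ij})\in M_n(\mathbb C)\mid x_{ij}=0\text{ if }(i,j)\notin\mathcal R\}$. $\mathcal K$ is the set of equivalence classes in $X$ of the equivalence relation generated by $\mathcal R$ (the connected components of the graph with vertex set $X$ and edge set $\mathcal R$); the $C^*$-envelope of $E(\mathcal R)$ is $\bigoplus_{K\in\mathcal K}M_{|K|}(\mathbb C)$, embedded block-diagonally in $M_n(\mathbb C)$. For a unital operator system $E$ with unit $e$, realized inside its $C^*$-envelope $A=C^*_{\mathrm{env}}(E)$ (with $A=E$ if $E$ is a $C^*$-algebra), let $H(E,m)$ be the space of self-adjoint elements of $M_m(E)$ that are invertible in $M_m(A)$,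 and $\mathcal V_0(E,m)=\pi_0(H(E,m))$ the set of its path components. The inclusion $E\subseteq A$ gives $H(E,m)\subseteq H(A,m)$ and hence a map $\mathcal V_0(E,m)\to\mathcal V_0(A,m)$. For $m'\ge m$ the connecting map $\imath_{mm'}:\mathcal V_0(E,m)\to\mathcal V_0(E,m')$ is $[x]\mapsto[x\oplus e_{m'-m}]$, where $e_k$ is the unit of $M_k(E)$. $\mathcal V_0(E)=\varinjlim_m\mathcal V_0(E,m)$ is a commutative semigroup under $[x]+[x']=[x\oplus x']$ with identity element $[e]$, and $K_0(E)$ is its Grothendieck group. For a unital $C^*$-algebra this is isomorphic to the usual $K_0$-group. *)

theory Defs
  imports "HOL-Analysis.Analysis" "HOL-Algebra.Product_Groups" "HOL-Algebra.Elementary_Groups"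
begin

section \<open>Complex matrices over a finite index set\<close>

text \<open>A matrix with index set \<open>I\<close> is a function that vanishes off \<open>I \<times> I\<close>; so \<open>mats {1..n}\<close> is
  the algebra of complex \<open>n\<times>n\<close> matrices.  The function type carries the product topology, which for
  finite \<open>I\<close> restricts to the usual (norm) topology on the finite-dimensional space \<open>mats I\<close>.\<close>

type_synonym 'i cmatrix = "'i \<Rightarrow> 'i \<Rightarrow> complex"

definition mats :: "'i set \<Rightarrow> 'i cmatrix set" where
  "mats I = {x. \<forall>i j. (i, j) \<notin> I \<times> I \<longrightarrow> x i j = 0}"

definition mzero :: "'i cmatrix" where
  "mzero = (\<lambda>i j. 0)"

definition mone :: "'i set \<Rightarrow> 'i cmatrix" where
  "mone I = (\<lambda>i j. if i = j \<and> i \<in> I then 1 else 0)"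

definition madd :: "'i cmatrix \<Rightarrow> 'i cmatrix \<Rightarrow> 'i cmatrix" where
  "madd x y = (\<lambda>i j. x i j + y i j)"

definition mscale :: "complex \<Rightarrow> 'i cmatrix \<Rightarrow> 'i cmatrix" where
  "mscale c x = (\<lambda>i j. c * x i j)"

definition mmul :: "'i set \<Rightarrow> 'i cmatrix \<Rightarrow> 'i cmatrix \<Rightarrow> 'i cmatrix" where
  "mmul I x y = (\<lambda>i j. \<Sum>k\<in>I. x i k * y k j)"

definition madj :: "'i cmatrix \<Rightarrow> 'i cmatrix" where
  "madj x = (\<lambda>i j. cnj (x j i))"

definition mnorm :: "'i set \<Rightarrow> 'i cmatrix \<Rightarrow> real" where
  "mnorm I x = Sup {L2_set (\<lambda>i. cmod (\<Sum>j\<in>I. x i j * v j)) I | v. L2_set (\<lambda>j. cmod (v j)) I \<le> 1}"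

text \<open>\<open>amp m X E\<close> is \<open>M\<^sub>m(E)\<close> for \<open>E \<subseteq> mats X\<close>.  Here \<open>M\<^sub>m(M\<^sub>X(\<complex>))\<close> is identified with the matrices
  over \<open>{1..m} \<times> X\<close>: the \<open>X \<times> X\<close> matrix in position \<open>(a, b)\<close> is \<open>\<lambda>i j. x (a, i) (b, j)\<close>.\<close>

definition amp :: "nat \<Rightarrow> 'i set \<Rightarrow> 'i cmatrix set \<Rightarrow> (nat \<times> 'i) cmatrix set" where
  "amp m X E = {x \<in> mats ({1..m} \<times> X).
     \<forall>a\<in>{1..m}. \<forall>b\<in>{1..m}. (\<lambda>i j. x (a, i) (b, j)) \<in> E}"

text \<open>The direct sum \<open>x \<oplus> x'\<close> of \<open>x \<in> M\<^sub>m(E)\<close> and \<open>x' \<in> M\<^sub>m\<^sub>'(E)\<close>; only the size \<open>m\<close> of the first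
  summand is needed.\<close>

definition dsum :: "nat \<Rightarrow> (nat \<times> 'i) cmatrix \<Rightarrow> (nat \<times> 'i) cmatrix \<Rightarrow> (nat \<times> 'i) cmatrix" where
  "dsum m x x' = (\<lambda>(a, i) (b, j).
     if a \<le> m \<and> b \<le> m then x (a, i) (b, j)
     else if m < a \<and> m < b then x' (a - m, i) (b - m, j)
     else 0)"

section \<open>The C*-envelope of a concrete operator system\<close>

definition cstar_subalgebra :: "'i set \<Rightarrow> 'i cmatrix set \<Rightarrow> bool" where
  "cstar_subalgebra X B \<longleftrightarrow> B \<subseteq> mats X \<and> closed B \<and> mzero \<in> B \<and>
     (\<forall>x\<in>B. \<forall>y\<in>B. madd x y \<in> B \<and> mmul X x y \<in> B) \<and>
     (\<forall>x\<in>B. madj x \<in> B \<and> (\<forall>c. mscale c x \<in> B))"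

definition cstar_generated :: "'i set \<Rightarrow> 'i cmatrix set \<Rightarrow> 'i cmatrix set" where
  "cstar_generated X E = \<Inter>{B. cstar_subalgebra X B \<and> E \<subseteq> B}"

definition closed_ideal :: "'i set \<Rightarrow> 'i cmatrix set \<Rightarrow> 'i cmatrix set \<Rightarrow> bool" where
  "closed_ideal X A J \<longleftrightarrow> J \<subseteq> A \<and> closed J \<and> mzero \<in> J \<and>
     (\<forall>x\<in>J. \<forall>y\<in>J. madd x y \<in> J) \<and> (\<forall>x\<in>J. \<forall>c. mscale c x \<in> J) \<and>
     (\<forall>x\<in>J. \<forall>a\<in>A. mmul X a x \<in> J \<and> mmul X x a \<in> J)"

text \<open>\<open>J\<close> is a boundary ideal for \<open>E\<close> in \<open>A\<close> if the quotient map \<open>A \<rightarrow> A/J\<close> is completely isometric on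
  \<open>E\<close>; the infimum is the norm of the class of \<open>x\<close> in \<open>M\<^sub>m(A/J) = M\<^sub>m(A)/M\<^sub>m(J)\<close>.\<close>

definition boundary_ideal :: "'i set \<Rightarrow> 'i cmatrix set \<Rightarrow> 'i cmatrix set \<Rightarrow> 'i cmatrix set \<Rightarrow> bool" where
  "boundary_ideal X E A J \<longleftrightarrow> closed_ideal X A J \<and>
     (\<forall>m\<ge>1. \<forall>x\<in>amp m X E.
        Inf {mnorm ({1..m} \<times> X) (madd x y) | y. y \<in> amp m X J} = mnorm ({1..m} \<times> X) x)"

text \<open>The C*-envelope of \<open>E\<close> is \<open>C*(E)/S\<close>, where \<open>S\<close> is the Shilov ideal, i.e. the largest boundary
  ideal for \<open>E\<close> in \<open>C*(E)\<close> (Arveson, Hamana).  So \<open>A\<close>, with the inclusion \<open>E \<subseteq> A\<close>, is the C*-envelope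
  iff \<open>A = C*(E)\<close> and the Shilov ideal vanishes.\<close>

definition is_cstar_envelope :: "'i set \<Rightarrow> 'i cmatrix set \<Rightarrow> 'i cmatrix set \<Rightarrow> bool" where
  "is_cstar_envelope X E A \<longleftrightarrow> A = cstar_generated X E \<and>
     (\<forall>J. boundary_ideal X E A J \<longrightarrow> J = {mzero})"

section \<open>The invariants \<open>V\<^sub>0\<close> and \<open>K\<^sub>0\<close>\<close>

text \<open>Throughout, \<open>E \<subseteq> A \<subseteq> mats X\<close> is an operator system containing \<open>mone X\<close>, and \<open>A\<close> is its
  C*-envelope; for a C*-algebra take \<open>E = A\<close>.  Operations on classes are unions over representatives,
  as usual for quotients.\<close>

definition Hinv :: "'i set \<Rightarrow> 'i cmatrix set \<Rightarrow> 'i cmatrix set \<Rightarrow> nat \<Rightarrow> (nat \<times> 'i) cmatrix set" where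
  "Hinv X E A m = {x \<in> amp m X E. madj x = x \<and>
     (\<exists>y\<in>amp m X A. mmul ({1..m} \<times> X) x y = mone ({1..m} \<times> X) \<and>
                    mmul ({1..m} \<times> X) y x = mone ({1..m} \<times> X))}"

definition V0 :: "'i set \<Rightarrow> 'i cmatrix set \<Rightarrow> 'i cmatrix set \<Rightarrow> nat \<Rightarrow> (nat \<times> 'i) cmatrix set set" where
  "V0 X E A m = path_component_set (Hinv X E A m) ` Hinv X E A m"

definition V0_incl ::
  "'i set \<Rightarrow> 'i cmatrix set \<Rightarrow> nat \<Rightarrow> (nat \<times> 'i) cmatrix set \<Rightarrow> (nat \<times> 'i) cmatrix set" where
  "V0_incl X A m c = (\<Union>x\<in>c. path_component_set (Hinv X A A m) x)"

definition V0_connect :: "'i set \<Rightarrow> 'i cmatrix set \<Rightarrow> 'i cmatrix set \<Rightarrow> nat \<Rightarrow> nat \<Rightarrow>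
    (nat \<times> 'i) cmatrix set \<Rightarrow> (nat \<times> 'i) cmatrix set" where
  "V0_connect X E A m m' c =
     (\<Union>x\<in>c. path_component_set (Hinv X E A m') (dsum m x (mone ({1..m' - m} \<times> X))))"

definition V0_dsum :: "'i set \<Rightarrow> 'i cmatrix set \<Rightarrow> 'i cmatrix set \<Rightarrow> nat \<Rightarrow> nat \<Rightarrow>
    (nat \<times> 'i) cmatrix set \<Rightarrow> (nat \<times> 'i) cmatrix set \<Rightarrow> (nat \<times> 'i) cmatrix set" where
  "V0_dsum X E A m m' c c' =
     (\<Union>x\<in>c. \<Union>x'\<in>c'. path_component_set (Hinv X E A (m + m')) (dsum m x x'))"

text \<open>The direct limit over \<open>m \<ge> 1\<close>: pairs \<open>(m, c)\<close> with \<open>c \<in> V0 X E A m\<close>, two of which are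
  identified iff they become equal at some later stage.\<close>

definition V0_pairs :: "'i set \<Rightarrow> 'i cmatrix set \<Rightarrow> 'i cmatrix set \<Rightarrow> (nat \<times> (nat \<times> 'i) cmatrix set) set" where
  "V0_pairs X E A = (SIGMA m:{1..}. V0 X E A m)"

definition V0_lim_rel :: "'i set \<Rightarrow> 'i cmatrix set \<Rightarrow> 'i cmatrix set \<Rightarrow>
    (nat \<times> (nat \<times> 'i) cmatrix set) rel" where
  "V0_lim_rel X E A = {((m, c), (m', c')).
     (m, c) \<in> V0_pairs X E A \<and> (m', c') \<in> V0_pairs X E A \<and>
     (\<exists>k\<ge>max m m'. V0_connect X E A m k c = V0_connect X E A m' k c')}"

definition V0_lim :: "'i set \<Rightarrow> 'i cmatrix set \<Rightarrow> 'i cmatrix set \<Rightarrow>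
    (nat \<times> (nat \<times> 'i) cmatrix set) set monoid" where
  "V0_lim X E A =
     \<lparr> carrier = V0_pairs X E A // V0_lim_rel X E A,
       mult = (\<lambda>s t. \<Union>(m, c)\<in>s. \<Union>(m', c')\<in>t.
                 V0_lim_rel X E A `` {(m + m', V0_dsum X E A m m' c c')}),
       one = V0_lim_rel X E A ``
               {(1, path_component_set (Hinv X E A 1) (mone ({1..1} \<times> X)))} \<rparr>"

text \<open>The Grothendieck group of a commutative monoid; the class of \<open>(a, b)\<close> is the formal difference
  of \<open>a\<close> and \<open>b\<close>.\<close>

definition grothendieck_rel :: "('a, 'b) monoid_scheme \<Rightarrow> ('a \<times> 'a) rel" where
  "grothendieck_rel G = {((a, b), (a', b')).
     a \<in> carrier G \<and> b \<in> carrier G \<and> a' \<in> carrier G \<and> b' \<in> carrier G \<and>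
     (\<exists>k\<in>carrier G. a \<otimes>\<^bsub>G\<^esub> b' \<otimes>\<^bsub>G\<^esub> k = a' \<otimes>\<^bsub>G\<^esub> b \<otimes>\<^bsub>G\<^esub> k)}"

definition grothendieck_group :: "('a, 'b) monoid_scheme \<Rightarrow> ('a \<times> 'a) set monoid" where
  "grothendieck_group G =
     \<lparr> carrier = (carrier G \<times> carrier G) // grothendieck_rel G,
       mult = (\<lambda>s t. \<Union>(a, b)\<in>s. \<Union>(a', b')\<in>t.
                 grothendieck_rel G `` {(a \<otimes>\<^bsub>G\<^esub> a', b \<otimes>\<^bsub>G\<^esub> b')}),
       one = grothendieck_rel G `` {(\<one>\<^bsub>G\<^esub>, \<one>\<^bsub>G\<^esub>)} \<rparr>"

definition K0 :: "'i set \<Rightarrow> 'i cmatrix set \<Rightarrow> 'i cmatrix set \<Rightarrow>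
    ((nat \<times> (nat \<times> 'i) cmatrix set) set \<times> (nat \<times> (nat \<times> 'i) cmatrix set) set) set monoid" where
  "K0 X E A = grothendieck_group (V0_lim X E A)"

section \<open>Tolerance relations\<close>

definition tolerance_relation :: "'i set \<Rightarrow> 'i rel \<Rightarrow> bool" where
  "tolerance_relation X R \<longleftrightarrow> R \<subseteq> X \<times> X \<and> refl_on X R \<and> sym R"

definition graph_operator_system :: "'i set \<Rightarrow> 'i rel \<Rightarrow> 'i cmatrix set" where
  "graph_operator_system X R = {x \<in> mats X. \<forall>i\<in>X. \<forall>j\<in>X. (i, j) \<notin> R \<longrightarrow> x i j = 0}"

definition generated_equiv :: "'i set \<Rightarrow> 'i rel \<Rightarrow> 'i rel" where
  "generated_equiv X R = \<Inter>{S. equiv X S \<and> R \<subseteq> S}"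

definition tolerance_components :: "'i set \<Rightarrow> 'i rel \<Rightarrow> 'i set set" where
  "tolerance_components X R = X // generated_equiv X R"

text \<open>The direct sum of the algebras \<open>mats K\<close> (of matrices of size \<open>card K\<close>) for the members \<open>K\<close> of a
  partition \<open>Ks\<close> of \<open>X\<close>, embedded block-diagonally in \<open>mats X\<close>.\<close>

definition block_sum :: "'i set set \<Rightarrow> 'i cmatrix set" where
  "block_sum Ks = {(\<lambda>i j. \<Sum>K\<in>Ks. x K i j) | x. \<forall>K\<in>Ks. x K \<in> mats K}"

end

theory Submission
  imports Defs
begin

text \<open>Both \<open>E(R)\<close> and its envelope consist of the matrices supported on a tolerance relation: the
  envelope belongs to the equivalence relation that \<open>R\<close> generates.  An amplification of such a system
  is again of this kind, over the index set \<open>{1..m} \<times> X\<close>, and its connected components are the sets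
  \<open>{1..m} \<times> K\<close>.  So everything rests on one statement about a finite graph (\<open>path_component_herm_inv_iff\<close>):
  the path components of the invertible Hermitian matrices supported on the graph are classified by
  the number of negative squares on each connected component of the graph.  This invariant sees only the
  components, hence it is the same for \<open>E(R)\<close> and for its envelope, and the comparison map is a bijection.

  To connect two matrices with the same invariants, each of them is first made diagonal
  (\<open>diagonalise_path\<close>).  In block form \<open>[[a, b*], [b, D]]\<close>, with one vertex split off and \<open>D\<close>
  invertible, the path \<open>[[a - (1 - t^2) b* D^-1 b, t b*], [t b, D]]\<close> has constant Schur complement and
  switches off \<open>b\<close>.  Elimination in this direction changes only one diagonal entry, so that, unlike the
  usual elimination, it creates no entries outside the pattern.  A small real shift of the diagonal
  makes \<open>D\<close> invertible beforehand.  Diagonal matrices deform to diagonal sign matrices, and a rotation in the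
  plane of an edge carries a minus sign from one end to the other (\<open>move_sign\<close>); within a connected
  component only the number of minus signs remains.

  That this number is an invariant is Sylvester's law of inertia together with its local constancy
  (\<open>neg_index_path\<close>): a positive and a negative definite subspace meet in zero, which bounds the sum
  of their dimensions, and both kinds of definiteness are open conditions.

  The invariants add up under direct sums and do not change under the connecting maps, so the
  limit semigroup is \<open>\<nat>\<close> to the power of the number of components, and its Grothendieck group is the
  corresponding power of \<open>\<int>\<close>.  Finally, the block algebra is generated by \<open>E(R)\<close> because
  matrix units multiply along paths of the graph, and its Shilov ideal vanishes because a nonzero ideal
  contains some diagonal matrix unit, which lies in \<open>E(R)\<close> and has norm one.\<close>


section \<open>Linear systems over a finite index set\<close>

text \<open>A homogeneous system with more unknowns than equations has a nonzero solution.  All dimension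
  arguments below are reduced to this count.\<close>

lemma underdetermined_system:
  fixes a :: "'e \<Rightarrow> 'u \<Rightarrow> 'k::field"
  assumes "finite I" "finite J" "card I < card J"
  shows "\<exists>c. (\<exists>j\<in>J. c j \<noteq> 0) \<and> (\<forall>i\<in>I. (\<Sum>j\<in>J. a i j * c j) = 0)"
  using assms
proof (induction I arbitrary: J a rule: finite_induct)
  case empty
  then obtain j where "j \<in> J" by fastforce
  then show ?case by (intro exI[of _ "\<lambda>_. 1"]) auto
next
  case (insert i I)
  show ?case
  proof (cases "\<forall>j\<in>J. a i j = 0")
    case True
    have "card I < card J" using insert by simp
    then obtain c where "\<exists>j\<in>J. c j \<noteq> 0" "\<forall>k\<in>I. (\<Sum>j\<in>J. a k j * c j) = 0"
      using insert.IH[OF insert.prems(1)] by blast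
    then show ?thesis using True by (intro exI[of _ c]) auto
  next
    case False
    then obtain p where p: "p \<in> J" "a i p \<noteq> 0" by blast
    define J' where "J' = J - {p}"
    have J': "finite J'" "card I < card J'" "J = insert p J'" "p \<notin> J'"
      using insert p unfolding J'_def by auto
    obtain c where c: "\<exists>j\<in>J'. c j \<noteq> 0"
      "\<forall>k\<in>I. (\<Sum>j\<in>J'. (a k j - a k p * a i j / a i p) * c j) = 0"
      using insert.IH[OF J'(1,2), of "\<lambda>k j. a k j - a k p * a i j / a i p"] by blast
    define s where "s = (\<Sum>j\<in>J'. a i j * c j)"
    define c' where "c' = c(p := - s / a i p)"
    have sum: "(\<Sum>j\<in>J. a k j * c' j) = - a k p * s / a i p + (\<Sum>j\<in>J'. a k j * c j)" for k
    proof -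
      have "(\<Sum>j\<in>J'. a k j * c' j) = (\<Sum>j\<in>J'. a k j * c j)"
        using J'(4) by (intro sum.cong) (auto simp: c'_def)
      then show ?thesis using J' by (simp add: c'_def)
    qed
    have "(\<Sum>j\<in>J. a k j * c' j) = 0" if "k \<in> I" for k
    proof -
      have "0 = (\<Sum>j\<in>J'. a k j * c j) - (\<Sum>j\<in>J'. a k p / a i p * (a i j * c j))"
        using c(2) that by (simp add: algebra_simps sum_subtractf)
      also have "(\<Sum>j\<in>J'. a k p / a i p * (a i j * c j)) = a k p / a i p * s"
        by (simp add: s_def sum_distrib_left)
      finally show ?thesis by (simp add: sum)
    qed
    moreover have "(\<Sum>j\<in>J. a i j * c' j) = 0"
      using p by (simp add: sum s_def)
    moreover have "\<exists>j\<in>J. c' j \<noteq> 0"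
      using c(1) J'(3,4) by (auto simp: c'_def)
    ultimately show ?thesis by (intro exI[of _ c']) auto
  qed
qed

text \<open>Invertibility of the submatrix on \<open>J \<times> J\<close>, as triviality of its kernel.\<close>

definition nondeg :: "'i set \<Rightarrow> 'i cmatrix \<Rightarrow> bool" where
  "nondeg J x \<longleftrightarrow> (\<forall>u. (\<forall>i\<in>J. (\<Sum>j\<in>J. x i j * u j) = 0) \<longrightarrow> (\<forall>j\<in>J. u j = 0))"

lemma nondegD:
  "nondeg J x \<Longrightarrow> (\<And>i. i \<in> J \<Longrightarrow> (\<Sum>j\<in>J. x i j * u j) = 0) \<Longrightarrow> j \<in> J \<Longrightarrow> u j = 0"
  unfolding nondeg_def by blast

lemma nondegI:
  "(\<And>u j. (\<And>i. i \<in> J \<Longrightarrow> (\<Sum>j\<in>J. x i j * u j) = 0) \<Longrightarrow> j \<in> J \<Longrightarrow> u j = 0) \<Longrightarrow> nondeg J x"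
  unfolding nondeg_def by blast

lemma nondeg_cong:
  assumes "\<And>i j. i \<in> J \<Longrightarrow> j \<in> J \<Longrightarrow> x i j = y i j"
  shows "nondeg J x \<longleftrightarrow> nondeg J y"
proof -
  have "(\<Sum>j\<in>J. x i j * u j) = (\<Sum>j\<in>J. y i j * u j)" if "i \<in> J" for i u
    using assms that by (intro sum.cong) auto
  then show ?thesis unfolding nondeg_def by auto
qed

text \<open>Adjoin the right-hand side as an extra column: the enlarged system has a nonzero
  solution, and the coefficient of the extra column cannot vanish in it.\<close>

lemma nondeg_solve:
  assumes "finite J" "nondeg J x"
  shows "\<exists>w. \<forall>i\<in>J. (\<Sum>j\<in>J. x i j * w j) = b i"
proof -
  define a where "a = (\<lambda>i k. case k of None \<Rightarrow> b i | Some j \<Rightarrow> x i j)"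
  let ?K = "insert None (Some ` J)"
  have "card J < card ?K"
    using assms(1) by (subst card_insert_disjoint) (auto simp: card_image)
  then obtain c where c: "\<exists>k\<in>?K. c k \<noteq> 0" "\<forall>i\<in>J. (\<Sum>k\<in>?K. a i k * c k) = 0"
    using underdetermined_system[OF assms(1), of ?K a] assms(1) by blast
  have sum: "(\<Sum>k\<in>?K. a i k * c k) = b i * c None + (\<Sum>j\<in>J. x i j * c (Some j))" for i
    using assms(1) by (subst sum.insert) (auto simp: a_def sum.reindex)
  have "c None \<noteq> 0"
  proof
    assume 0: "c None = 0"
    then have "c (Some j) = 0" if "j \<in> J" for j
      using c(2) sum that by (intro nondegD[OF assms(2), of "\<lambda>j. c (Some j)"]) auto
    then show False using c(1) 0 by auto
  qed
  moreover have "(\<Sum>j\<in>J. x i j * (- c (Some j) / c None)) =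
      - (\<Sum>j\<in>J. x i j * c (Some j)) / c None" for i
    by (simp add: sum_divide_distrib sum_negf)
  moreover have "(\<Sum>j\<in>J. x i j * c (Some j)) = - (b i * c None)" if "i \<in> J" for i
    using c(2) sum that by (metis add_eq_0_iff)
  ultimately have "\<forall>i\<in>J. (\<Sum>j\<in>J. x i j * (- c (Some j) / c None)) = b i"
    by simp
  then show ?thesis by (intro exI[of _ "\<lambda>j. - c (Some j) / c None"])
qed

definition diag_shift :: "'i set \<Rightarrow> real \<Rightarrow> 'i cmatrix \<Rightarrow> 'i cmatrix" where
  "diag_shift L t x = (\<lambda>i j. x i j + (if i = j \<and> i \<in> L then of_real t else 0))"

lemma madj_entry:
  assumes "madj x = x"
  shows "cnj (x i j) = x j i"
proof -
  have "madj x j i = x j i" using assms by (rule arg_cong)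
  then show ?thesis by (simp add: madj_def)
qed

lemma madj_eqI:
  assumes "\<And>i j. cnj (x i j) = x j i"
  shows "madj x = x"
  by (intro ext) (simp only: madj_def assms)

lemma madj_diag_Reals: "madj x = x \<Longrightarrow> x i i \<in> \<real>"
  by (simp add: Reals_cnj_iff madj_entry)

lemma sum_diag_shift:
  assumes "finite J" "J \<subseteq> L" "i \<in> J"
  shows "(\<Sum>j\<in>J. diag_shift L t x i j * u j) = (\<Sum>j\<in>J. x i j * u j) + of_real t * u i"
proof -
  have "(\<Sum>j\<in>J. diag_shift L t x i j * u j) =
      (\<Sum>j\<in>J. x i j * u j + (if j = i then of_real t * u j else 0))"
    using assms by (intro sum.cong) (auto simp: diag_shift_def algebra_simps)
  then show ?thesis using assms by (simp add: sum.distrib)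
qed

text \<open>A degenerate shift is the negative of an eigenvalue, and eigenvectors of a Hermitian matrix
  for distinct real eigenvalues are orthogonal, hence independent; so there are at most \<open>card J\<close> of them.\<close>

lemma finite_degenerate_shifts:
  assumes "finite J" "J \<subseteq> L" "madj x = x"
  shows "finite {t. \<not> nondeg J (diag_shift L t x)}" (is "finite ?F")
proof -
  have "card G \<le> card J" if G: "G \<subseteq> ?F" "finite G" for G
  proof (rule ccontr)
    assume "\<not> card G \<le> card J"
    have "\<forall>t\<in>G. \<exists>u. (\<forall>i\<in>J. (\<Sum>j\<in>J. diag_shift L t x i j * u j) = 0) \<and> (\<exists>j\<in>J. u j \<noteq> 0)"
      using G unfolding nondeg_def by blast
    then obtain u where u: "\<And>t i. t \<in> G \<Longrightarrow> i \<in> J \<Longrightarrow> (\<Sum>j\<in>J. diag_shift L t x i j * u t j) = 0"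
      "\<And>t. t \<in> G \<Longrightarrow> \<exists>j\<in>J. u t j \<noteq> 0"
      unfolding bchoice_iff by blast
    have eig: "(\<Sum>j\<in>J. x i j * u t j) = - of_real t * u t i" if "t \<in> G" "i \<in> J" for t i
      using u(1)[OF that] sum_diag_shift[OF assms(1,2) that(2), of t x "u t"]
      by (simp add: add_eq_0_iff)
    have orth: "(\<Sum>i\<in>J. cnj (u t i) * u s i) = 0" if "t \<in> G" "s \<in> G" "t \<noteq> s" for s t
    proof -
      have "(\<Sum>i\<in>J. cnj (u t i) * (- of_real s * u s i)) = (\<Sum>i\<in>J. \<Sum>j\<in>J. cnj (u t i) * (x i j * u s j))"
        using eig[OF that(2)] by (intro sum.cong) (auto simp: sum_distrib_left[symmetric])
      also have "\<dots> = (\<Sum>j\<in>J. \<Sum>i\<in>J. cnj (u t i) * (x i j * u s j))"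
        by (rule sum.swap)
      also have "\<dots> = (\<Sum>j\<in>J. cnj (\<Sum>i\<in>J. x j i * u t i) * u s j)"
        by (intro sum.cong refl)
          (simp add: sum_distrib_right sum_distrib_left madj_entry[OF assms(3)] mult_ac)
      also have "\<dots> = (\<Sum>j\<in>J. cnj (- of_real t * u t j) * u s j)"
        using that by (intro sum.cong) (auto simp: eig)
      finally have "- of_real s * (\<Sum>i\<in>J. cnj (u t i) * u s i) = - of_real t * (\<Sum>i\<in>J. cnj (u t i) * u s i)"
        unfolding sum_distrib_left by (simp add: mult.left_commute mult.assoc)
      then show ?thesis using that(3) by simp
    qed
    obtain c where c: "\<exists>t\<in>G. c t \<noteq> 0" "\<forall>i\<in>J. (\<Sum>t\<in>G. u t i * c t) = 0"
      using underdetermined_system[OF assms(1) G(2), of "\<lambda>i t. u t i"] \<open>\<not> card G \<le> card J\<close> by auto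
    then obtain s where s: "s \<in> G" "c s \<noteq> 0" by blast
    have "0 = (\<Sum>i\<in>J. cnj (u s i) * (\<Sum>t\<in>G. u t i * c t))"
      using c(2) by simp
    also have "\<dots> = (\<Sum>i\<in>J. \<Sum>t\<in>G. cnj (u s i) * u t i * c t)"
      by (simp only: sum_distrib_left mult.assoc)
    also have "\<dots> = (\<Sum>t\<in>G. \<Sum>i\<in>J. cnj (u s i) * u t i * c t)"
      by (rule sum.swap)
    also have "\<dots> = (\<Sum>t\<in>G. (\<Sum>i\<in>J. cnj (u s i) * u t i) * c t)"
      by (simp only: sum_distrib_right)
    also have "\<dots> = (\<Sum>t\<in>G. if t = s then (\<Sum>i\<in>J. cnj (u s i) * u s i) * c s else 0)"
    proof (rule sum.cong[OF refl])
      fix t assume "t \<in> G"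
      then show "(\<Sum>i\<in>J. cnj (u s i) * u t i) * c t =
          (if t = s then (\<Sum>i\<in>J. cnj (u s i) * u s i) * c s else 0)"
        using orth[OF s(1), of t] by (cases "t = s") simp_all
    qed
    also have "\<dots> = (\<Sum>i\<in>J. cnj (u s i) * u s i) * c s"
      by (simp only: sum.delta[OF G(2)] s(1) if_True)
    also have "(\<Sum>i\<in>J. cnj (u s i) * u s i) = (\<Sum>i\<in>J. of_real ((cmod (u s i))\<^sup>2))"
      by (intro sum.cong refl) (simp only: complex_norm_square mult.commute)
    also have "\<dots> = complex_of_real (\<Sum>i\<in>J. (cmod (u s i))\<^sup>2)"
      by (simp only: of_real_sum)
    finally have "complex_of_real (\<Sum>i\<in>J. (cmod (u s i))\<^sup>2) = 0"
      using s(2) by (metis mult_eq_0_iff)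
    then have "(\<Sum>i\<in>J. (cmod (u s i))\<^sup>2) = 0" by (simp only: of_real_eq_0_iff)
    then have "\<forall>i\<in>J. u s i = 0"
      using assms(1) by (subst (asm) sum_nonneg_eq_0_iff) auto
    then show False using u(2) s by blast
  qed
  then show ?thesis using finite_if_finite_subsets_card_bdd by blast
qed


section \<open>Deforming to a diagonal matrix inside the pattern\<close>

lemma continuous_on_const_if:
  assumes "b \<Longrightarrow> continuous_on S f" "\<not> b \<Longrightarrow> continuous_on S g"
  shows "continuous_on S (\<lambda>t. if b then f t else g t)"
  using assms by (cases b) auto

lemma path_component_entrywise:
  fixes g :: "real \<Rightarrow> 'i cmatrix"
  assumes "\<And>i j. continuous_on {0..1} (\<lambda>t. g t i j)"
    and "\<And>t. 0 \<le> t \<Longrightarrow> t \<le> 1 \<Longrightarrow> g t \<in> S" and "g 0 = x" and "g 1 = y"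
  shows "path_component S x y"
proof -
  have "continuous_on {0..1} g"
    by (intro continuous_on_coordinatewise_then_product assms(1))
  then show ?thesis using assms(2-4)
    unfolding path_component_def path_def path_image_def pathstart_def pathfinish_def
    by (intro exI[of _ g]) auto
qed

text \<open>Where a deformation of \<open>x\<close> that works on the vertices \<open>J\<close> alone may run: entries outside
  \<open>J \<times> J\<close> are untouched and off-diagonal zeros are kept.\<close>

definition pattern_deform :: "'i set \<Rightarrow> 'i cmatrix \<Rightarrow> 'i cmatrix set" where
  "pattern_deform J x = {y. madj y = y \<and> nondeg J y \<and>
     (\<forall>i j. (i, j) \<notin> J \<times> J \<longrightarrow> y i j = x i j) \<and> (\<forall>i j. i \<noteq> j \<longrightarrow> x i j = 0 \<longrightarrow> y i j = 0)}"

lemma pattern_deform_mono: "y \<in> pattern_deform J x \<Longrightarrow> pattern_deform J y \<subseteq> pattern_deform J x"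
  unfolding pattern_deform_def by auto

lemma pattern_deform_trans:
  assumes "path_component (pattern_deform J x) x y" "path_component (pattern_deform J y) y z"
  shows "path_component (pattern_deform J x) x z"
proof -
  have "pattern_deform J y \<subseteq> pattern_deform J x"
    using path_component_mem(2)[OF assms(1)] by (rule pattern_deform_mono)
  then show ?thesis
    by (rule path_component_trans[OF assms(1) path_component_of_subset[OF _ assms(2)]])
qed

lemma nondeg_insert_decoupled:
  assumes "finite J" "v \<notin> J" "\<And>j. j \<in> J \<Longrightarrow> x v j = 0" "\<And>j. j \<in> J \<Longrightarrow> x j v = 0"
    and "x v v \<noteq> 0" and "nondeg J x"
  shows "nondeg (insert v J) x"
proof (rule nondegI)
  fix u j assume row: "\<And>i. i \<in> insert v J \<Longrightarrow> (\<Sum>j\<in>insert v J. x i j * u j) = 0"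
    and j: "j \<in> insert v J"
  have "(\<Sum>j\<in>J. x i j * u j) = 0" if "i \<in> J" for i
    using row[of i] that assms(1,2,4) by simp
  then have J: "u j = 0" if "j \<in> J" for j
    using nondegD[OF assms(6)] that by blast
  have "u v = 0"
    using row[of v] assms(1,2,5) J by simp
  then show "u j = 0" using j J by auto
qed

text \<open>Only finitely many shifts make \<open>x\<close> degenerate on \<open>L\<close> or on \<open>J\<close>, and zero is not one of them for \<open>L\<close>;
  so all sufficiently small positive shifts are good for both.\<close>

lemma shift_path:
  assumes "finite L" "J \<subseteq> L" "madj x = x" "nondeg L x"
  shows "\<exists>y. path_component (pattern_deform L x) x y \<and> nondeg J y"
proof -
  let ?F = "{t. \<not> nondeg J (diag_shift L t x)} \<union> {t. \<not> nondeg L (diag_shift L t x)}"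
  have fin: "finite J" using assms(1,2) finite_subset by blast
  have "finite (?F - {0})"
    using finite_degenerate_shifts[OF fin assms(2,3)] finite_degenerate_shifts[OF assms(1) _ assms(3)] by auto
  then obtain e where e: "e > 0" "\<And>t. t \<in> ?F - {0} \<Longrightarrow> e \<le> dist 0 t"
    using finite_set_avoid[of "?F - {0}" 0] by auto
  define y where "y = diag_shift L (e / 2) x"
  have good: "t \<notin> ?F" if "0 < t" "t < e" for t
    using e(2)[of t] that by auto
  have sym: "madj (diag_shift L t x) = diag_shift L t x" for t
    using madj_entry[OF assms(3)] by (intro madj_eqI) (auto simp: diag_shift_def)
  have zero: "diag_shift L 0 x = x" by (intro ext) (simp add: diag_shift_def)
  have "path_component (pattern_deform L x) x y"
  proof (rule path_component_entrywise[where g = "\<lambda>t. diag_shift L (t * (e / 2)) x"])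
    show "continuous_on {0..1} (\<lambda>t. diag_shift L (t * (e / 2)) x i j)" for i j
      unfolding diag_shift_def by (intro continuous_on_const_if continuous_intros)
  next
    fix t :: real assume t: "0 \<le> t" "t \<le> 1"
    have "nondeg L (diag_shift L (t * (e / 2)) x)"
    proof (cases "t = 0")
      case True
      then show ?thesis using assms(4) zero by simp
    next
      case False
      have "t * (e / 2) \<le> 1 * (e / 2)" using t e by (intro mult_right_mono) auto
      then have "0 < t * (e / 2)" "t * (e / 2) < e" using t False e(1) by auto
      then show ?thesis using good by blast
    qed
    then show "diag_shift L (t * (e / 2)) x \<in> pattern_deform L x"
      using sym unfolding pattern_deform_def by (auto simp: diag_shift_def)
  qed (auto simp: zero y_def)
  moreover have "nondeg J y" using good[of "e / 2"] e(1) unfolding y_def by auto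
  ultimately show ?thesis by blast
qed

text \<open>The Schur complement of the block on \<open>J\<close> is kept constant while the entries that join \<open>v\<close> to \<open>J\<close>
  are scaled to zero.  The only other entry that changes is the diagonal one at \<open>v\<close>, so the
  pattern is respected.\<close>

lemma schur_path:
  assumes "finite J" "v \<notin> J" "madj x = x" "nondeg (insert v J) x" "nondeg J x"
  shows "\<exists>y. path_component (pattern_deform (insert v J) x) x y \<and>
    (\<forall>j\<in>J. y v j = 0 \<and> y j v = 0) \<and> y v v \<noteq> 0 \<and> nondeg J y"
proof -
  let ?L = "insert v J"
  note cnjx = madj_entry[OF assms(3)]
  obtain w where w: "\<And>i. i \<in> J \<Longrightarrow> (\<Sum>j\<in>J. x i j * w j) = x i v"
    using nondeg_solve[OF assms(1,5), of "\<lambda>i. x i v"] by blast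
  define q where "q = (\<Sum>j\<in>J. x v j * w j)"
  have xv: "x v i = (\<Sum>j\<in>J. x j i * cnj (w j))" if "i \<in> J" for i
  proof -
    have "x v i = cnj (\<Sum>j\<in>J. x i j * w j)" using that by (simp only: w cnjx)
    then show ?thesis by (simp add: cnjx)
  qed
  have q: "q = (\<Sum>i\<in>J. x i v * cnj (w i))"
  proof -
    have "q = (\<Sum>i\<in>J. \<Sum>j\<in>J. x j i * cnj (w j) * w i)"
      unfolding q_def by (intro sum.cong refl) (simp add: xv sum_distrib_right)
    also have "\<dots> = (\<Sum>j\<in>J. \<Sum>i\<in>J. x j i * cnj (w j) * w i)" by (rule sum.swap)
    also have "\<dots> = (\<Sum>j\<in>J. (\<Sum>i\<in>J. x j i * w i) * cnj (w j))"
      by (intro sum.cong refl, subst sum_distrib_right) (simp only: mult_ac)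
    also have "\<dots> = (\<Sum>j\<in>J. x j v * cnj (w j))"
      by (intro sum.cong refl) (simp add: w)
    finally show ?thesis .
  qed
  \<comment> \<open>\<open>q\<close> is the value \<open>b* D^-1 b\<close> of a Hermitian form, so the path stays Hermitian.\<close>
  have q_real: "cnj q = q"
    by (subst q) (simp add: q_def cnjx)
  have schur: "x v v - q \<noteq> 0"
  proof
    assume 0: "x v v - q = 0"
    define u where "u = (\<lambda>j. if j = v then 1 else - w j)"
    have sum: "(\<Sum>j\<in>?L. x i j * u j) = x i v - (\<Sum>j\<in>J. x i j * w j)" for i
    proof -
      have "(\<Sum>j\<in>J. x i j * u j) = (\<Sum>j\<in>J. - (x i j * w j))"
        using assms(2) by (intro sum.cong) (auto simp: u_def)
      then show ?thesis using assms(1,2) by (simp add: u_def sum_negf)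
    qed
    have "u v = 0"
    proof (rule nondegD[OF assms(4)])
      fix i assume "i \<in> ?L"
      then show "(\<Sum>j\<in>?L. x i j * u j) = 0"
        using 0 w by (auto simp: sum q_def)
    qed simp
    then show False by (simp add: u_def)
  qed
  \<comment> \<open>The Schur complement at time \<open>t\<close> is \<open>x v v - (1 - t^2) q - t^2 q = x v v - q\<close>.\<close>
  define g where "g = (\<lambda>(t::real) i j.
    if i = v \<and> j = v then x v v - (1 - of_real t ^ 2) * q
    else if (i = v \<and> j \<in> J) \<or> (j = v \<and> i \<in> J) then of_real t * x i j else x i j)"
  have gJ: "g t i j = x i j" if "i \<in> J" "j \<in> J" for t i j
    using that assms(2) by (auto simp: g_def)
  have "path_component (pattern_deform ?L x) x (g 0)"
  proof (rule path_component_sym, rule path_component_entrywise[where g = g])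
    show "continuous_on {0..1} (\<lambda>t. g t i j)" for i j
      unfolding g_def by (intro continuous_on_const_if continuous_intros)
  next
    fix t :: real assume t: "0 \<le> t" "t \<le> 1"
    have "madj (g t) = g t"
      by (intro madj_eqI) (auto simp: g_def cnjx q_real)
    moreover have "nondeg ?L (g t)"
    proof (rule nondegI)
      fix u j assume row: "\<And>i. i \<in> ?L \<Longrightarrow> (\<Sum>j\<in>?L. g t i j * u j) = 0" and j: "j \<in> ?L"
      define u' where "u' = (\<lambda>j. u j + of_real t * u v * w j)"
      have "(\<Sum>j\<in>J. x i j * u' j) = 0" if "i \<in> J" for i
      proof -
        have "(\<Sum>j\<in>J. x i j * u' j) = (\<Sum>j\<in>J. x i j * u j) + of_real t * u v * (\<Sum>j\<in>J. x i j * w j)"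
          unfolding u'_def by (simp add: algebra_simps sum.distrib sum_distrib_left)
        also have "\<dots> = (\<Sum>j\<in>J. x i j * u j) + of_real t * u v * x i v"
          using w that by simp
        also have "\<dots> = (\<Sum>j\<in>?L. g t i j * u j)"
        proof -
          have "g t i v = of_real t * x i v" using that assms(2) by (auto simp: g_def)
          then show ?thesis using assms(1,2) that by (simp add: gJ)
        qed
        finally show ?thesis using row that by simp
      qed
      then have uw: "u j = - (of_real t * u v * w j)" if "j \<in> J" for j
        using nondegD[OF assms(5), of u' j] that by (simp add: u'_def add_eq_0_iff2)
      have "0 = (\<Sum>j\<in>?L. g t v j * u j)" using row by simp
      also have "\<dots> = (x v v - (1 - of_real t ^ 2) * q) * u v + (\<Sum>j\<in>J. g t v j * u j)"
        using assms(1,2) by (simp add: g_def)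
      also have "(\<Sum>j\<in>J. g t v j * u j) = (\<Sum>j\<in>J. - (of_real t ^ 2 * u v) * (x v j * w j))"
        using assms(2) by (intro sum.cong refl) (auto simp: g_def uw power2_eq_square)
      also have "\<dots> = - (of_real t ^ 2 * u v) * q"
        by (simp only: q_def sum_distrib_left)
      also have "(x v v - (1 - of_real t ^ 2) * q) * u v + - (of_real t ^ 2 * u v) * q = (x v v - q) * u v"
        by (simp add: algebra_simps)
      finally have "u v = 0" using schur by simp
      then show "u j = 0" using j uw by auto
    qed
    ultimately show "g t \<in> pattern_deform ?L x"
      unfolding pattern_deform_def by (auto simp: g_def)
  next
    show "g 1 = x" by (intro ext) (simp add: g_def)
  qed simp
  moreover have "nondeg J (g 0)" using nondeg_cong[of J "g 0" x] gJ assms(5) by blast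
  moreover have "g 0 v v \<noteq> 0" using schur by (simp add: g_def)
  moreover have "\<forall>j\<in>J. g 0 v j = 0 \<and> g 0 j v = 0" using assms(2) by (auto simp: g_def)
  ultimately show ?thesis by blast
qed

text \<open>Vertices are split off one at a time.  The shift comes first because the remaining block may be
  singular although the whole matrix is not, as for the matrix with rows \<open>(0, 1)\<close> and \<open>(1, 0)\<close>.\<close>

lemma diagonalise_path:
  assumes "finite J" "madj x = x" "nondeg J x"
  shows "\<exists>y. path_component (pattern_deform J x) x y \<and> (\<forall>i\<in>J. \<forall>j\<in>J. i \<noteq> j \<longrightarrow> y i j = 0)"
  using assms
proof (induction J arbitrary: x rule: finite_induct)
  case empty
  have "x \<in> pattern_deform {} x" using empty by (auto simp: pattern_deform_def)
  then show ?case using path_component_refl by auto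
next
  case (insert v J)
  let ?L = "insert v J"
  obtain x1 where x1: "path_component (pattern_deform ?L x) x x1" "nondeg J x1"
    using shift_path[of ?L J x] insert by auto
  have "x1 \<in> pattern_deform ?L x" using x1(1) path_component_mem by blast
  then have "madj x1 = x1" "nondeg ?L x1" unfolding pattern_deform_def by auto
  then obtain x2 where x2: "path_component (pattern_deform ?L x1) x1 x2"
    "\<And>j. j \<in> J \<Longrightarrow> x2 v j = 0" "\<And>j. j \<in> J \<Longrightarrow> x2 j v = 0" "x2 v v \<noteq> 0" "nondeg J x2"
    using schur_path[OF insert(1,2), of x1] x1(2) by blast
  have "x2 \<in> pattern_deform ?L x1" using x2(1) path_component_mem by blast
  then have "madj x2 = x2" unfolding pattern_deform_def by auto
  then obtain x3 where x3: "path_component (pattern_deform J x2) x2 x3"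
    "\<forall>i\<in>J. \<forall>j\<in>J. i \<noteq> j \<longrightarrow> x3 i j = 0"
    using insert.IH[of x2] x2(5) by blast
  have sub: "pattern_deform J x2 \<subseteq> pattern_deform ?L x2"
  proof
    fix y assume y: "y \<in> pattern_deform J x2"
    have "nondeg ?L y"
    proof (rule nondeg_insert_decoupled[OF insert(1,2)])
      show "y v j = 0" "y j v = 0" if "j \<in> J" for j
        using y x2(2,3)[OF that] insert(2) unfolding pattern_deform_def by auto
      show "y v v \<noteq> 0" "nondeg J y"
        using y x2(4) insert(2) unfolding pattern_deform_def by auto
    qed
    then show "y \<in> pattern_deform ?L x2" using y unfolding pattern_deform_def by auto
  qed
  have "x3 \<in> pattern_deform J x2" using x3(1) path_component_mem by blast
  then have "x3 v j = 0" "x3 j v = 0" if "j \<in> J" for j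
    using x2(2,3)[OF that] insert(2) unfolding pattern_deform_def by auto
  then have "\<forall>i\<in>?L. \<forall>j\<in>?L. i \<noteq> j \<longrightarrow> x3 i j = 0" using x3(2) by auto
  moreover have "path_component (pattern_deform ?L x) x x3"
    by (rule pattern_deform_trans[OF pattern_deform_trans[OF x1(1) x2(1)]
        path_component_of_subset[OF sub x3(1)]])
  ultimately show ?case by blast
qed

section \<open>Sign matrices and moving their signs along edges\<close>

text \<open>For the amplified graph, this is the space \<open>H(E, m)\<close>; see \<open>Hinv_eq_herm_inv\<close>.\<close>

definition herm_inv :: "'i set \<Rightarrow> 'i rel \<Rightarrow> 'i cmatrix set" where
  "herm_inv I R = {x. madj x = x \<and> nondeg I x \<and> (\<forall>i j. (i, j) \<notin> R \<longrightarrow> x i j = 0)}"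

definition sign_matrix :: "'i set \<Rightarrow> 'i set \<Rightarrow> 'i cmatrix" where
  "sign_matrix I S = (\<lambda>i j. if i = j \<and> i \<in> I then (if i \<in> S then -1 else 1) else 0)"

lemma nondeg_diagonal:
  assumes "finite I" "\<And>i j. i \<in> I \<Longrightarrow> j \<in> I \<Longrightarrow> i \<noteq> j \<Longrightarrow> x i j = 0"
  shows "nondeg I x \<longleftrightarrow> (\<forall>i\<in>I. x i i \<noteq> 0)"
proof -
  have sum: "(\<Sum>j\<in>I. x i j * u j) = x i i * u i" if "i \<in> I" for i u
  proof -
    have "(\<Sum>j\<in>I. x i j * u j) = (\<Sum>j\<in>I. if j = i then x i i * u i else 0)"
      using assms(2)[OF that] by (intro sum.cong refl) auto
    then show ?thesis using assms(1) that by simp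
  qed
  show ?thesis
  proof
    assume nd: "nondeg I x"
    show "\<forall>i\<in>I. x i i \<noteq> 0"
    proof (intro ballI notI)
      fix i assume i: "i \<in> I" "x i i = 0"
      have "(\<lambda>k. if k = i then 1 else 0) i = (0::complex)"
        using i by (intro nondegD[OF nd, where u = "\<lambda>k. if k = i then 1 else 0"]) (auto simp: sum)
      then show False by simp
    qed
  next
    assume "\<forall>i\<in>I. x i i \<noteq> 0"
    then show "nondeg I x" by (auto intro!: nondegI simp: sum)
  qed
qed

lemma sign_matrix_mem:
  assumes "finite I" "\<And>i. i \<in> I \<Longrightarrow> (i, i) \<in> R"
  shows "sign_matrix I S \<in> herm_inv I R"
proof -
  have "nondeg I (sign_matrix I S)"
    by (subst nondeg_diagonal[OF assms(1)]) (auto simp: sign_matrix_def)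
  then show ?thesis
    using assms(2) by (auto simp: herm_inv_def sign_matrix_def intro!: madj_eqI)
qed

text \<open>Once the matrix is diagonal, its nonzero real entries can be moved to their signs along straight lines.\<close>

lemma path_to_sign_matrix:
  assumes "finite I" "R \<subseteq> I \<times> I" "\<And>i. i \<in> I \<Longrightarrow> (i, i) \<in> R" "x \<in> herm_inv I R"
  shows "\<exists>S\<subseteq>I. path_component (herm_inv I R) x (sign_matrix I S)"
proof -
  have x: "madj x = x" "nondeg I x" "\<And>i j. (i, j) \<notin> R \<Longrightarrow> x i j = 0"
    using assms(4) unfolding herm_inv_def by auto
  obtain y where y: "path_component (pattern_deform I x) x y" "\<And>i j. i \<in> I \<Longrightarrow> j \<in> I \<Longrightarrow> i \<noteq> j \<Longrightarrow> y i j = 0"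
    using diagonalise_path[OF assms(1) x(1,2)] by blast
  have sub: "pattern_deform I x \<subseteq> herm_inv I R"
  proof
    fix z assume z: "z \<in> pattern_deform I x"
    have "z i j = 0" if "(i, j) \<notin> R" for i j
    proof (cases "i = j")
      case True
      then have "i \<notin> I" using that assms(3) by blast
      then show ?thesis using z x(3)[OF that] unfolding pattern_deform_def by auto
    qed (use z x(3)[OF that] in \<open>auto simp: pattern_deform_def\<close>)
    then show "z \<in> herm_inv I R" using z unfolding pattern_deform_def herm_inv_def by auto
  qed
  have "y \<in> herm_inv I R" using y(1) path_component_mem(2) sub by blast
  then have yh: "madj y = y" "nondeg I y" "\<And>i j. (i, j) \<notin> R \<Longrightarrow> y i j = 0"
    unfolding herm_inv_def by auto
  have yoff: "y i j = 0" if "i \<noteq> j \<or> i \<notin> I" for i j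
    using that y(2)[of i j] yh(3)[of i j] assms(2) by blast
  have yreal: "y i i = of_real (Re (y i i))" for i
    using madj_diag_Reals[OF yh(1), of i] by (simp add: of_real_Re)
  have ynz: "Re (y i i) \<noteq> 0" if "i \<in> I" for i
    using nondeg_diagonal[OF assms(1) y(2)] yh(2) that yreal[of i] by auto
  define S where "S = {i \<in> I. Re (y i i) < 0}"
  define g where "g = (\<lambda>(t::real) i j. if i = j \<and> i \<in> I
      then complex_of_real ((1 - t) * Re (y i i) + t * sgn (Re (y i i))) else 0)"
  have "path_component (herm_inv I R) y (sign_matrix I S)"
  proof (rule path_component_entrywise[where g = g])
    show "continuous_on {0..1} (\<lambda>t. g t i j)" for i j
      unfolding g_def by (intro continuous_on_const_if continuous_intros)
  next
    fix t :: real assume t: "0 \<le> t" "t \<le> 1"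
    have "(1 - t) * a + t * sgn a \<noteq> 0" if "a \<noteq> 0" for a
    proof (cases "a > 0")
      case True
      show ?thesis
      proof (cases "t = 0")
        case False
        then have "0 < t" "0 \<le> (1 - t) * a" using t True by auto
        then show ?thesis using True by simp
      qed (use True in auto)
    next
      case False
      then have a: "a < 0" using that by simp
      show ?thesis
      proof (cases "t = 0")
        case False
        then have "0 < t" "(1 - t) * a \<le> 0" using t a by (auto simp: mult_nonneg_nonpos)
        then show ?thesis using a by simp
      qed (use a in auto)
    qed
    then have "nondeg I (g t)"
      by (subst nondeg_diagonal[OF assms(1)]) (use ynz in \<open>auto simp: g_def simp del: of_real_add of_real_mult\<close>)
    then show "g t \<in> herm_inv I R"
      using assms(3) unfolding herm_inv_def by (auto simp: g_def intro!: madj_eqI)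
  next
    show "g 0 = y"
    proof (intro ext)
      fix i j show "g 0 i j = y i j"
        using yreal[of i] yoff[of i j] by (auto simp: g_def)
    qed
    show "g 1 = sign_matrix I S"
      using ynz by (intro ext) (auto simp: g_def sign_matrix_def S_def sgn_if)
  qed
  then have "path_component (herm_inv I R) x (sign_matrix I S)"
    by (rule path_component_trans[OF path_component_of_subset[OF sub y(1)]])
  moreover have "S \<subseteq> I" unfolding S_def by blast
  ultimately show ?thesis by blast
qed

text \<open>The \<open>2 \<times> 2\<close> matrices with rows \<open>(- cos, sin)\<close> and \<open>(sin, cos)\<close> are reflections, hence
  invertible, and half a turn exchanges the two signs.  The off-diagonal entries are permitted since
  \<open>i\<close> and \<open>j\<close> are adjacent.\<close>

lemma move_sign_along_edge:
  assumes "finite I" "\<And>i. i \<in> I \<Longrightarrow> (i, i) \<in> R" "sym R"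
    and "(i, j) \<in> R" "i \<in> I" "j \<in> I" "i \<in> S" "j \<notin> S"
  shows "path_component (herm_inv I R) (sign_matrix I S) (sign_matrix I (insert j (S - {i})))"
proof -
  have ij: "i \<noteq> j" "(j, i) \<in> R" using assms by (auto dest: symD)
  define g where "g = (\<lambda>(t::real) k l.
    if k = i \<and> l = i then - complex_of_real (cos (pi * t))
    else if k = j \<and> l = j then complex_of_real (cos (pi * t))
    else if (k = i \<and> l = j) \<or> (k = j \<and> l = i) then complex_of_real (sin (pi * t))
    else sign_matrix I S k l)"
  show ?thesis
  proof (rule path_component_entrywise[where g = g])
    show "continuous_on {0..1} (\<lambda>t. g t k l)" for k l
      unfolding g_def by (intro continuous_on_const_if continuous_intros)
  next
    fix t :: real
    let ?c = "complex_of_real (cos (pi * t))" and ?s = "complex_of_real (sin (pi * t))"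
    have cs: "?c * ?c + ?s * ?s = 1"
      using sin_cos_squared_add3[of "pi * t"] by (metis of_real_add of_real_mult of_real_1)
    have "nondeg I (g t)"
    proof (rule nondegI)
      fix u k assume row: "\<And>k. k \<in> I \<Longrightarrow> (\<Sum>l\<in>I. g t k l * u l) = 0" and k: "k \<in> I"
      have two: "(\<Sum>l\<in>I. g t k l * u l) = g t k i * u i + g t k j * u j" if "k = i \<or> k = j" for k
      proof -
        have "(\<Sum>l\<in>I. g t k l * u l) = (\<Sum>l\<in>{i,j}. g t k l * u l)"
          using that assms(1,5,6) by (intro sum.mono_neutral_right) (auto simp: g_def sign_matrix_def)
        then show ?thesis using ij by simp
      qed
      have r1: "- ?c * u i + ?s * u j = 0" and r2: "?s * u i + ?c * u j = 0"
        using row[OF assms(5)] row[OF assms(6)] two[of i] two[of j] ij by (auto simp: g_def)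
      have "u i = (?c * ?c + ?s * ?s) * u i" using cs by simp
      also have "\<dots> = ?s * (?s * u i + ?c * u j) - ?c * (- ?c * u i + ?s * u j)"
        by (simp add: algebra_simps)
      finally have ui: "u i = 0" using r1 r2 by simp
      have "u j = (?c * ?c + ?s * ?s) * u j" using cs by simp
      also have "\<dots> = ?c * (?s * u i + ?c * u j) + ?s * (- ?c * u i + ?s * u j)"
        by (simp add: algebra_simps)
      finally have uj: "u j = 0" using r1 r2 by simp
      show "u k = 0"
      proof (cases "k = i \<or> k = j")
        case False
        have "(\<Sum>l\<in>I. g t k l * u l) = (\<Sum>l\<in>{k}. g t k l * u l)"
          using False assms(1) k by (intro sum.mono_neutral_right) (auto simp: g_def sign_matrix_def)
        then show ?thesis using row[OF k] False k
          by (auto simp: g_def sign_matrix_def split: if_splits)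
      qed (use ui uj in auto)
    qed
    moreover have "madj (g t) = g t"
    proof (rule madj_eqI)
      fix k l show "cnj (g t k l) = g t l k"
        by (cases "k = l"; cases "k = i"; cases "k = j"; cases "l = i"; cases "l = j")
          (simp_all add: g_def sign_matrix_def)
    qed
    moreover have "g t k l = 0" if "(k, l) \<notin> R" for k l
    proof -
      have "(i, i) \<in> R" "(j, j) \<in> R" using assms(2,5,6) by auto
      then have no: "(k = i \<and> l = i) = False" "(k = j \<and> l = j) = False"
        "(k = i \<and> l = j \<or> k = j \<and> l = i) = False" "(k = l \<and> k \<in> I) = False"
        using that assms(2,4) ij by auto
      show ?thesis by (simp only: g_def sign_matrix_def no if_False)
    qed
    ultimately show "g t \<in> herm_inv I R" unfolding herm_inv_def by simp
  next
    show "g 0 = sign_matrix I S"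
    proof (intro ext)
      fix k l show "g 0 k l = sign_matrix I S k l"
        by (cases "k = l"; cases "k = i"; cases "k = j"; cases "l = i"; cases "l = j")
          (use assms(5-8) ij(1) in \<open>simp_all add: g_def sign_matrix_def\<close>)
    qed
    show "g 1 = sign_matrix I (insert j (S - {i}))"
    proof (intro ext)
      fix k l show "g 1 k l = sign_matrix I (insert j (S - {i})) k l"
        by (cases "k = l"; cases "k = i"; cases "k = j"; cases "l = i"; cases "l = j")
          (use assms(5-8) ij(1) in \<open>simp_all add: g_def sign_matrix_def\<close>)
    qed
  qed
qed

text \<open>Along a path of the graph, a minus sign that is met at an intermediate vertex is moved
  forward first, and the travelling sign then takes its place.\<close>

lemma move_sign:
  assumes "finite I" "\<And>i. i \<in> I \<Longrightarrow> (i, i) \<in> R" "sym R" "R \<subseteq> I \<times> I"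
    and "(i, j) \<in> R\<^sup>*" "i \<in> S" "j \<notin> S" "S \<subseteq> I"
  shows "path_component (herm_inv I R) (sign_matrix I S) (sign_matrix I (insert j (S - {i})))"
  using assms(5-8)
proof (induction j arbitrary: S rule: rtrancl_induct)
  case base
  then show ?case by simp
next
  case (step k j)
  note edge = move_sign_along_edge[OF assms(1-3) step.hyps(2)]
  have kj: "k \<in> I" "j \<in> I" using step.hyps(2) assms(4) by auto
  consider "k = j" | "k = i" | "k \<noteq> i" "k \<noteq> j" "k \<in> S" | "k \<notin> S" "k \<noteq> j" by blast
  then show ?case
  proof cases
    case 1
    then show ?thesis using step by blast
  next
    case 2
    then show ?thesis using edge step kj by blast
  next
    case 3
    let ?S = "insert j (S - {k})"
    have "path_component (herm_inv I R) (sign_matrix I S) (sign_matrix I ?S)"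
      using edge step kj 3 by blast
    moreover have "path_component (herm_inv I R) (sign_matrix I ?S) (sign_matrix I (insert k (?S - {i})))"
      using 3 step.prems kj by (intro step.IH) auto
    moreover have "insert k (?S - {i}) = insert j (S - {i})" using 3 step.prems by auto
    ultimately show ?thesis using path_component_trans by metis
  next
    case 4
    let ?S = "insert k (S - {i})"
    have "path_component (herm_inv I R) (sign_matrix I S) (sign_matrix I ?S)"
      using 4 step.prems by (intro step.IH) auto
    moreover have "path_component (herm_inv I R) (sign_matrix I ?S) (sign_matrix I (insert j (?S - {k})))"
      using 4 step.prems kj by (intro edge) auto
    moreover have "insert j (?S - {k}) = insert j (S - {i})" using 4 by auto
    ultimately show ?thesis using path_component_trans by metis
  qed
qed

text \<open>Equal counts in a component mean that a sign in \<open>S - T\<close> can be moved to a vertex of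
  \<open>T - S\<close> in the same component, which makes \<open>S - T\<close> smaller.\<close>

lemma path_between_sign_matrices:
  assumes "finite I" "\<And>i. i \<in> I \<Longrightarrow> (i, i) \<in> R" "sym R" "R \<subseteq> I \<times> I" "\<Union>Ls = I"
    and "\<And>L i j. L \<in> Ls \<Longrightarrow> i \<in> L \<Longrightarrow> j \<in> L \<Longrightarrow> (i, j) \<in> R\<^sup>*"
    and disj: "\<And>L L' i. L \<in> Ls \<Longrightarrow> L' \<in> Ls \<Longrightarrow> i \<in> L \<Longrightarrow> i \<in> L' \<Longrightarrow> L = L'"
    and "S \<subseteq> I" "T \<subseteq> I" "\<And>L. L \<in> Ls \<Longrightarrow> card (S \<inter> L) = card (T \<inter> L)"
  shows "path_component (herm_inv I R) (sign_matrix I S) (sign_matrix I T)"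
  using assms(8-10)
proof (induction "card (S - T)" arbitrary: S rule: less_induct)
  case less
  have finS: "finite S" and finT: "finite T"
    using less.prems(1,2) assms(1) by (auto intro: finite_subset)
  have cond: "card (T \<inter> L - S) = card (S \<inter> L - T)" if "L \<in> Ls" for L
  proof -
    have fin: "finite (S \<inter> L)" "finite (T \<inter> L)" using finS finT by auto
    have "S \<inter> L \<inter> (T \<inter> L) = T \<inter> L \<inter> (S \<inter> L)" by blast
    moreover have "T \<inter> L - S = T \<inter> L - S \<inter> L" "S \<inter> L - T = S \<inter> L - T \<inter> L" by auto
    ultimately show ?thesis
      using card_Diff_subset_Int[of "T \<inter> L" "S \<inter> L"] card_Diff_subset_Int[of "S \<inter> L" "T \<inter> L"]
        fin less.prems(3)[OF that] by simp
  qed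
  show ?case
  proof (cases "S \<subseteq> T")
    case True
    have "T \<subseteq> S"
    proof
      fix i assume i: "i \<in> T"
      then obtain L where L: "L \<in> Ls" "i \<in> L" using less.prems(2) assms(5) by blast
      have empty: "S \<inter> L - T = {}" using True by blast
      have "card (T \<inter> L - S) = 0" unfolding cond[OF L(1)] empty by simp
      then have "T \<inter> L - S = {}" using finT by simp
      then show "i \<in> S" using i L by blast
    qed
    then have "S = T" using True by blast
    then show ?thesis
      using sign_matrix_mem[OF assms(1,2)] by (simp add: path_component_refl)
  next
    case False
    then obtain i where i: "i \<in> S" "i \<notin> T" by blast
    then obtain L where L: "L \<in> Ls" "i \<in> L" using less.prems(1) assms(5) by blast
    have "card (S \<inter> L - T) \<noteq> 0" using i L finS by auto
    then have "card (T \<inter> L - S) \<noteq> 0" by (simp only: cond[OF L(1)] not_False_eq_True)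
    then have "T \<inter> L - S \<noteq> {}" by (metis card.empty)
    then obtain j where j: "j \<in> T" "j \<in> L" "j \<notin> S" by blast
    let ?S = "insert j (S - {i})"
    have "path_component (herm_inv I R) (sign_matrix I S) (sign_matrix I ?S)"
      using i j L less.prems(1) assms(6) by (intro move_sign[OF assms(1-4)]) auto
    moreover have "path_component (herm_inv I R) (sign_matrix I ?S) (sign_matrix I T)"
    proof (rule less.hyps)
      have less: "?S - T = S - T - {i}" using j by auto
      show "card (?S - T) < card (S - T)"
        unfolding less by (rule card_Diff1_less) (use i finS in auto)
      show "?S \<subseteq> I" using less.prems j by auto
      show "T \<subseteq> I" by fact
      fix L' assume L': "L' \<in> Ls"
      show "card (?S \<inter> L') = card (T \<inter> L')"
      proof (cases "L' = L")
        case True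
        have "?S \<inter> L = insert j (S \<inter> L - {i})" using j by auto
        then have "card (?S \<inter> L) = Suc (card (S \<inter> L - {i}))" using finS j by simp
        also have "\<dots> = card (S \<inter> L)" using i L finS by (intro card_Suc_Diff1) auto
        finally show ?thesis using True less.prems(3) L by simp
      next
        case False
        then have "i \<notin> L'" "j \<notin> L'" using disj[OF L' L(1)] j L by blast+
        then have "?S \<inter> L' = S \<inter> L'" by auto
        then show ?thesis using less.prems(3) L' by simp
      qed
    qed
    ultimately show ?thesis by (rule path_component_trans)
  qed
qed


section \<open>The number of negative squares\<close>

definition hform :: "'i set \<Rightarrow> 'i cmatrix \<Rightarrow> ('i \<Rightarrow> complex) \<Rightarrow> ('i \<Rightarrow> complex) \<Rightarrow> complex" where
  "hform J x u v = (\<Sum>i\<in>J. \<Sum>j\<in>J. cnj (u i) * x i j * v j)"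

lemma hform_cong:
  assumes "\<And>i. i \<in> J \<Longrightarrow> u i = u' i" "\<And>i. i \<in> J \<Longrightarrow> v i = v' i"
  shows "hform J x u v = hform J x u' v'"
  unfolding hform_def using assms by (intro sum.cong refl) simp

lemma hform_cnj:
  assumes "madj x = x"
  shows "cnj (hform J x u v) = hform J x v u"
proof -
  have "cnj (hform J x u v) = (\<Sum>i\<in>J. \<Sum>j\<in>J. cnj (v j) * x j i * u i)"
    unfolding hform_def by (simp add: madj_entry[OF assms] mult_ac)
  also have "\<dots> = hform J x v u" unfolding hform_def by (rule sum.swap)
  finally show ?thesis .
qed

lemma hform_add_right: "hform J x u (\<lambda>i. v i + w i) = hform J x u v + hform J x u w"
  by (simp add: hform_def algebra_simps sum.distrib)

lemma hform_add_left: "hform J x (\<lambda>i. v i + w i) u = hform J x v u + hform J x w u"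
  by (simp add: hform_def algebra_simps sum.distrib)

lemma hform_scale_right: "hform J x u (\<lambda>i. c * v i) = c * hform J x u v"
  by (simp add: hform_def sum_distrib_left mult_ac)

lemma hform_scale_left: "hform J x (\<lambda>i. c * v i) u = cnj c * hform J x v u"
  by (simp add: hform_def sum_distrib_left mult_ac)

lemma hform_uminus: "hform J (\<lambda>i j. - x i j) u v = - hform J x u v"
  by (simp add: hform_def sum_negf)

lemma hform_sum_right: "hform J x u (\<lambda>i. \<Sum>t\<in>B. c t * f t i) = (\<Sum>t\<in>B. c t * hform J x u (f t))"
proof (cases "finite B")
  case True
  then show ?thesis
  proof (induction rule: finite_induct)
    case empty
    show ?case by (simp add: hform_def)
  next
    case (insert t B)
    then show ?case by (simp add: hform_add_right hform_scale_right)
  qed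
qed (simp add: hform_def)

lemma hform_sum_left: "hform J x (\<lambda>i. \<Sum>t\<in>B. c t * f t i) u = (\<Sum>t\<in>B. cnj (c t) * hform J x (f t) u)"
proof (cases "finite B")
  case True
  then show ?thesis
  proof (induction rule: finite_induct)
    case empty
    show ?case by (simp add: hform_def)
  next
    case (insert t B)
    then show ?case by (simp add: hform_add_left hform_scale_left)
  qed
qed (simp add: hform_def)

definition posdef_family :: "'i set \<Rightarrow> 'i cmatrix \<Rightarrow> ('s \<Rightarrow> 'i \<Rightarrow> complex) \<Rightarrow> 's set \<Rightarrow> bool" where
  "posdef_family J x f T \<longleftrightarrow> (\<forall>c. (\<exists>t\<in>T. c t \<noteq> 0) \<longrightarrow>
     0 < Re (hform J x (\<lambda>i. \<Sum>t\<in>T. c t * f t i) (\<lambda>i. \<Sum>t\<in>T. c t * f t i)))"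

text \<open>If there were more vectors than dimensions, some nonzero vector would be a combination of the first
  and of the second family, and the form would be both positive and negative on it.\<close>

lemma card_posdef_negdef_le:
  assumes "finite J" "finite P" "finite T"
    and pos: "posdef_family J x f P" and neg: "posdef_family J (\<lambda>i j. - x i j) g T"
  shows "card T + card P \<le> card J"
proof (rule ccontr)
  assume "\<not> card T + card P \<le> card J"
  then have lt: "card J < card (T <+> P)" using assms(2,3) by (simp add: card_Plus)
  define a where "a = (\<lambda>i k. case k of Inl t \<Rightarrow> g t i | Inr p \<Rightarrow> - f p i)"
  have "finite (T <+> P)" using assms(2,3) by simp
  then obtain c where c: "\<exists>k\<in>T <+> P. c k \<noteq> 0" "\<forall>i\<in>J. (\<Sum>k\<in>T <+> P. a i k * c k) = 0"
    using underdetermined_system[OF assms(1) _ lt, of a] by blast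
  define v where "v = (\<lambda>i. \<Sum>t\<in>T. c (Inl t) * g t i)"
  define w where "w = (\<lambda>i. \<Sum>p\<in>P. c (Inr p) * f p i)"
  have "(\<Sum>k\<in>T <+> P. a i k * c k) = v i - w i" for i
    using assms(2,3) by (simp add: sum.Plus a_def v_def w_def mult.commute sum_negf)
  then have vw: "v i = w i" if "i \<in> J" for i using c(2) that by simp
  then have eq: "hform J x v v = hform J x w w" by (intro hform_cong)
  have v: "Re (hform J x v v) < 0" if "\<exists>t\<in>T. c (Inl t) \<noteq> 0"
    using neg that unfolding posdef_family_def hform_uminus v_def by fastforce
  have w: "0 < Re (hform J x w w)" if "\<exists>p\<in>P. c (Inr p) \<noteq> 0"
    using pos that unfolding posdef_family_def w_def by fastforce
  have v0: "Re (hform J x v v) = 0" if "\<not> (\<exists>t\<in>T. c (Inl t) \<noteq> 0)"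
    using that by (simp add: v_def hform_def)
  have w0: "Re (hform J x w w) = 0" if "\<not> (\<exists>p\<in>P. c (Inr p) \<noteq> 0)"
    using that by (simp add: w_def hform_def)
  have "(\<exists>t\<in>T. c (Inl t) \<noteq> 0) \<or> (\<exists>p\<in>P. c (Inr p) \<noteq> 0)" using c(1) by auto
  then show False using v w v0 w0 eq by fastforce
qed

text \<open>The error term is at most \<open>(\<Sum>|c t|)^2 / (card T + 1)\<close>, which by Cauchy-Schwarz is less than
  the main term \<open>\<Sum>|c t|^2\<close>.\<close>

lemma posdef_familyI_gram:
  fixes f :: "'s \<Rightarrow> 'i \<Rightarrow> complex"
  assumes "finite T"
    and gram: "\<And>s t. s \<in> T \<Longrightarrow> t \<in> T \<Longrightarrow>
      cmod (hform J y (f s) (f t) - (if s = t then 1 else 0)) \<le> 1 / (real (card T) + 1)"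
  shows "posdef_family J y f T"
  unfolding posdef_family_def
proof (intro allI impI)
  fix c :: "'s \<Rightarrow> complex" assume "\<exists>t\<in>T. c t \<noteq> 0"
  then obtain t0 where t0: "t0 \<in> T" "c t0 \<noteq> 0" by blast
  define q where "q = (\<Sum>t\<in>T. (cmod (c t))\<^sup>2)"
  define n where "n = real (card T)"
  have q: "q > 0"
    unfolding q_def by (rule sum_pos2[OF assms(1) t0(1)]) (use t0 in auto)
  define d where "d = (\<lambda>s t. hform J y (f s) (f t) - (if s = t then 1 else 0))"
  define e where "e = (\<Sum>s\<in>T. \<Sum>t\<in>T. cnj (c s) * (c t * d s t))"
  let ?v = "\<lambda>i. \<Sum>t\<in>T. c t * f t i"
  have "hform J y ?v ?v = (\<Sum>s\<in>T. cnj (c s) * (\<Sum>t\<in>T. c t * hform J y (f s) (f t)))"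
    by (simp only: hform_sum_left hform_sum_right)
  also have "\<dots> = (\<Sum>s\<in>T. \<Sum>t\<in>T. cnj (c s) * (c t * d s t) + (if t = s then cnj (c s) * c s else 0))"
    unfolding sum_distrib_left d_def by (intro sum.cong refl) (auto simp: algebra_simps)
  also have "\<dots> = e + (\<Sum>s\<in>T. cnj (c s) * c s)"
    using assms(1) by (simp add: sum.distrib e_def)
  also have "(\<Sum>s\<in>T. cnj (c s) * c s) = of_real q"
    unfolding q_def of_real_sum by (intro sum.cong refl) (simp only: complex_norm_square mult.commute)
  finally have "Re (hform J y ?v ?v) = Re e + q" by simp
  moreover have "cmod e \<le> n / (n + 1) * q"
  proof -
    have "cmod e \<le> (\<Sum>s\<in>T. \<Sum>t\<in>T. cmod (c s) * (cmod (c t) * (1 / (n + 1))))"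
      unfolding e_def
    proof (rule order_trans[OF norm_sum], rule sum_mono, rule order_trans[OF norm_sum], rule sum_mono)
      fix s t assume "s \<in> T" "t \<in> T"
      then show "cmod (cnj (c s) * (c t * d s t)) \<le> cmod (c s) * (cmod (c t) * (1 / (n + 1)))"
        using gram unfolding norm_mult complex_mod_cnj d_def n_def
        by (intro mult_left_mono) auto
    qed
    also have "\<dots> = (\<Sum>s\<in>T. cmod (c s))\<^sup>2 * (1 / (n + 1))"
      by (simp only: power2_eq_square sum_distrib_left sum_distrib_right mult.assoc)
        (rule sum.swap)
    also have "\<dots> \<le> q * n * (1 / (n + 1))"
      unfolding q_def n_def by (intro mult_right_mono sum_squared_le_sum_of_squares) auto
    finally show ?thesis by (simp add: mult.commute)
  qed
  moreover have "n / (n + 1) * q < 1 * q"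
    using q by (intro mult_strict_right_mono) (auto simp: n_def)
  moreover have "\<bar>Re e\<bar> \<le> cmod e" by (rule abs_Re_le_cmod)
  ultimately show "0 < Re (hform J y ?v ?v)" by linarith
qed

definition sylvester_basis ::
  "'i set \<Rightarrow> 'i cmatrix \<Rightarrow> 's set \<Rightarrow> 's set \<Rightarrow> ('s \<Rightarrow> 'i \<Rightarrow> complex) \<Rightarrow> bool" where
  "sylvester_basis J x B T f \<longleftrightarrow> finite B \<and> card B = card J \<and> T \<subseteq> B \<and>
     (\<forall>s\<in>B. \<forall>t\<in>B. hform J x (f s) (f t) = (if s = t then if t \<in> T then -1 else 1 else 0))"

lemma sylvester_basis_near:
  fixes f :: "'s \<Rightarrow> 'i \<Rightarrow> complex"
  assumes "sylvester_basis J x B T f"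
    and "\<And>s t. s \<in> B \<Longrightarrow> t \<in> B \<Longrightarrow>
      cmod (hform J y (f s) (f t) - hform J x (f s) (f t)) \<le> 1 / (real (card J) + 1)"
  shows "posdef_family J y f (B - T)" "posdef_family J (\<lambda>i j. - y i j) f T"
proof -
  have B: "finite B" "card B = card J" "T \<subseteq> B"
    and gram: "\<And>s t. s \<in> B \<Longrightarrow> t \<in> B \<Longrightarrow>
      hform J x (f s) (f t) = (if s = t then if t \<in> T then -1 else 1 else 0)"
    using assms(1) unfolding sylvester_basis_def by auto
  have smaller: "1 / (real (card J) + 1) \<le> 1 / (real (card S) + 1)" if "S \<subseteq> B" for S
    using card_mono[OF B(1) that] B(2) by (simp add: frac_le)
  show "posdef_family J y f (B - T)"
  proof (rule posdef_familyI_gram)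
    fix s t assume st: "s \<in> B - T" "t \<in> B - T"
    then have "cmod (hform J y (f s) (f t) - (if s = t then 1 else 0)) \<le> 1 / (real (card J) + 1)"
      using assms(2)[of s t] gram[of s t] by auto
    then show "cmod (hform J y (f s) (f t) - (if s = t then 1 else 0)) \<le> 1 / (real (card (B - T)) + 1)"
      using smaller[of "B - T"] by force
  qed (use B in auto)
  show "posdef_family J (\<lambda>i j. - y i j) f T"
  proof (rule posdef_familyI_gram)
    fix s t assume st: "s \<in> T" "t \<in> T"
    then have B': "s \<in> B" "t \<in> B" using B(3) by auto
    then have "hform J x (f s) (f t) = - (if s = t then 1 else 0)"
      using gram[OF B'] st by simp
    then have "cmod (- (- hform J y (f s) (f t) - (if s = t then 1 else 0))) \<le> 1 / (real (card J) + 1)"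
      using assms(2)[OF B'] by (cases "s = t") (simp_all add: add.commute)
    then show "cmod (hform J (\<lambda>i j. - y i j) (f s) (f t) - (if s = t then 1 else 0)) \<le> 1 / (real (card T) + 1)"
      using smaller[OF B(3)] unfolding norm_minus_cancel hform_uminus by (rule order_trans)
  qed (use B in \<open>auto intro: finite_subset\<close>)
qed

text \<open>Sylvester's law of inertia when \<open>y = x\<close>; for \<open>y\<close> near \<open>x\<close> it gives local constancy of the
  number of negative squares.\<close>

lemma sylvester_basis_negatives_eq:
  fixes f :: "'s \<Rightarrow> 'i \<Rightarrow> complex" and f' :: "'t \<Rightarrow> 'i \<Rightarrow> complex"
  assumes "finite J" "sylvester_basis J x B T f" "sylvester_basis J y B' T' f'"
    and "\<And>s t. s \<in> B \<Longrightarrow> t \<in> B \<Longrightarrow>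
      cmod (hform J y (f s) (f t) - hform J x (f s) (f t)) \<le> 1 / (real (card J) + 1)"
  shows "card T = card T'"
proof -
  have B: "finite B" "card B = card J" "T \<subseteq> B" "finite B'" "card B' = card J" "T' \<subseteq> B'"
    using assms(2,3) unfolding sylvester_basis_def by auto
  then have fin: "finite T" "finite T'" using finite_subset by auto
  note near = sylvester_basis_near[OF assms(2,4)]
  have near': "posdef_family J y f' (B' - T')" "posdef_family J (\<lambda>i j. - y i j) f' T'"
    by (rule sylvester_basis_near[OF assms(3)], simp)+
  have "card T + card (B' - T') \<le> card J" "card T' + card (B - T) \<le> card J"
    using card_posdef_negdef_le[OF assms(1) _ _ near'(1) near(2)]
      card_posdef_negdef_le[OF assms(1) _ _ near(1) near'(2)] B fin by auto
  moreover have "card (B - T) = card J - card T" "card (B' - T') = card J - card T'"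
    using B fin by (auto simp: card_Diff_subset)
  moreover have "card T \<le> card J" "card T' \<le> card J"
    using B card_mono by metis+
  ultimately show ?thesis by linarith
qed

lemma hform_unit_right:
  assumes "finite J" "j \<in> J"
  shows "hform J x u (\<lambda>k. if k = j then 1 else 0) = (\<Sum>i\<in>J. cnj (u i) * x i j)"
  unfolding hform_def
proof (intro sum.cong refl)
  fix i
  have "(\<Sum>k\<in>J. cnj (u i) * x i k * (if k = j then 1 else 0)) = (\<Sum>k\<in>J. if k = j then cnj (u i) * x i j else 0)"
    by (intro sum.cong) auto
  then show "(\<Sum>k\<in>J. cnj (u i) * x i k * (if k = j then 1 else 0)) = cnj (u i) * x i j"
    using assms by simp
qed

text \<open>The orthogonal complement \<open>U\<close> of the vectors found so far is nonzero by a dimension count.  The form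
  does not vanish identically on \<open>U\<close>, as it is nondegenerate and every vector can be corrected to lie in \<open>U\<close>; by
  polarisation some vector of \<open>U\<close> is not isotropic.\<close>

lemma extend_orthonormal:
  fixes f :: "nat \<Rightarrow> 'i \<Rightarrow> complex"
  assumes "finite J" "madj x = x" "nondeg J x" "n < card J"
    and gram: "\<And>s t. s < n \<Longrightarrow> t < n \<Longrightarrow>
      hform J x (f s) (f t) = (if s = t then if t \<in> T then -1 else 1 else 0)"
  shows "\<exists>v. (\<forall>s<n. hform J x (f s) v = 0) \<and> (hform J x v v = 1 \<or> hform J x v v = -1)"
proof -
  let ?h = "hform J x"
  note cnjh = hform_cnj[OF assms(2)]
  define U where "U = {v. \<forall>s<n. ?h (f s) v = 0}"
  have Uadd: "(\<lambda>i. v i + w i) \<in> U" if "v \<in> U" "w \<in> U" for v w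
    using that unfolding U_def by (simp add: hform_add_right)
  have Uscale: "(\<lambda>i. c * v i) \<in> U" if "v \<in> U" for v c
    using that unfolding U_def by (simp add: hform_scale_right)
  obtain u where u: "\<exists>j\<in>J. u j \<noteq> 0" "u \<in> U"
  proof -
    obtain u where "\<exists>j\<in>J. u j \<noteq> 0" and
      u: "\<forall>s\<in>{..<n}. (\<Sum>j\<in>J. (\<Sum>i\<in>J. cnj (f s i) * x i j) * u j) = 0"
      using underdetermined_system[of "{..<n}" J "\<lambda>s j. \<Sum>i\<in>J. cnj (f s i) * x i j"] assms(1,4) by auto
    have "?h (f s) u = (\<Sum>j\<in>J. (\<Sum>i\<in>J. cnj (f s i) * x i j) * u j)" for s
      unfolding hform_def sum_distrib_right by (rule sum.swap)
    then have "u \<in> U" using u unfolding U_def by auto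
    then show ?thesis using that \<open>\<exists>j\<in>J. u j \<noteq> 0\<close> by blast
  qed
  obtain z where z: "?h u z \<noteq> 0"
  proof (rule ccontr)
    assume no: "\<not> thesis"
    have "(\<Sum>i\<in>J. x j i * u i) = 0" if "j \<in> J" for j
    proof -
      have "?h u (\<lambda>k. if k = j then 1 else 0) = 0" using that no \<open>\<And>z. ?h u z \<noteq> 0 \<Longrightarrow> thesis\<close> by blast
      then have "cnj (\<Sum>i\<in>J. cnj (u i) * x i j) = 0"
        by (simp only: hform_unit_right[OF assms(1) that] complex_cnj_zero)
      then show ?thesis by (simp add: madj_entry[OF assms(2)] mult.commute)
    qed
    then show False using u(1) nondegD[OF assms(3), of u] by blast
  qed
  \<comment> \<open>\<open>w\<close> is \<open>z\<close> minus its orthogonal projection to the span of the \<open>f s\<close>, so it lies in \<open>U\<close>.\<close>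
  define c where "c = (\<lambda>s. (if s \<in> T then 1 else -1) * ?h (f s) z)"
  define w where "w = (\<lambda>i. z i + (\<Sum>s<n. c s * f s i))"
  have "w \<in> U"
  proof -
    have "?h (f r) w = 0" if "r < n" for r
    proof -
      have "(\<Sum>s<n. c s * ?h (f r) (f s)) = (\<Sum>s<n. if s = r then - ?h (f r) z else 0)"
        using gram that by (intro sum.cong) (auto simp: c_def)
      then show ?thesis using that
        unfolding w_def hform_add_right hform_sum_right by simp
    qed
    then show ?thesis unfolding U_def by blast
  qed
  have "?h u (f s) = 0" if "s < n" for s
    using u(2) that cnjh[of J "f s" u] unfolding U_def by simp
  then have uw: "?h u w \<noteq> 0"
    using z unfolding w_def hform_add_right hform_sum_right by simp
  have "\<exists>v\<in>U. ?h v v \<noteq> 0"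
  proof (rule ccontr)
    assume "\<not> (\<exists>v\<in>U. ?h v v \<noteq> 0)"
    then have iso: "?h v v = 0" if "v \<in> U" for v using that by blast
    have expand: "?h u w * c + cnj (?h u w * c) = 0" for c
    proof -
      have "0 = ?h (\<lambda>i. u i + c * w i) (\<lambda>i. u i + c * w i)"
        using iso[OF Uadd[OF u(2) Uscale[OF \<open>w \<in> U\<close>]]] by simp
      also have "\<dots> = ?h u w * c + cnj (?h u w * c)"
        unfolding hform_add_left hform_add_right hform_scale_left hform_scale_right
        using iso[OF u(2)] iso[OF \<open>w \<in> U\<close>] cnjh[of J u w] by simp
      finally show ?thesis by simp
    qed
    \<comment> \<open>Polarisation: \<open>c = 1\<close> and \<open>c = \<i>\<close> give the real and the imaginary part.\<close>
    have "Re (?h u w) = 0" using expand[of 1] by (simp add: complex_eq_iff)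
    moreover have "Im (?h u w) = 0" using expand[of \<i>] by (simp add: complex_eq_iff)
    ultimately show False using uw by (simp add: complex_eq_iff)
  qed
  then obtain v where v: "v \<in> U" "?h v v \<noteq> 0" by blast
  define r where "r = Re (?h v v)"
  have r: "?h v v = of_real r"
    using cnjh[of J v v] Reals_cnj_iff[of "?h v v"] by (simp add: r_def of_real_Re)
  then have "r \<noteq> 0" using v(2) by auto
  define a where "a = complex_of_real (1 / sqrt \<bar>r\<bar>)"
  have "?h (\<lambda>i. a * v i) (\<lambda>i. a * v i) = of_real (1 / sqrt \<bar>r\<bar> * (1 / sqrt \<bar>r\<bar>) * r)"
    unfolding hform_scale_left hform_scale_right r a_def complex_cnj_complex_of_real of_real_mult
    by (simp only: mult.assoc)
  also have "1 / sqrt \<bar>r\<bar> * (1 / sqrt \<bar>r\<bar>) * r = sgn r"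
    using \<open>r \<noteq> 0\<close> by (simp add: sgn_real_def field_simps)
  finally have "?h (\<lambda>i. a * v i) (\<lambda>i. a * v i) = 1 \<or> ?h (\<lambda>i. a * v i) (\<lambda>i. a * v i) = -1"
    using \<open>r \<noteq> 0\<close> by (auto simp: sgn_real_def)
  then show ?thesis
    using Uscale[OF v(1), of a] unfolding U_def by blast
qed

lemma sylvester_basis_exists:
  assumes "finite J" "madj x = x" "nondeg J x"
  shows "\<exists>T f. sylvester_basis J x {..<card J} T (f :: nat \<Rightarrow> 'i \<Rightarrow> complex)"
proof -
  have "\<exists>T f. T \<subseteq> {..<n} \<and> (\<forall>s\<in>{..<n}. \<forall>t\<in>{..<n}.
      hform J x ((f :: nat \<Rightarrow> 'i \<Rightarrow> complex) s) (f t) = (if s = t then if t \<in> T then -1 else 1 else 0))"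
    if "n \<le> card J" for n
    using that
  proof (induction n)
    case 0
    then show ?case by auto
  next
    case (Suc n)
    then obtain T and f :: "nat \<Rightarrow> 'i \<Rightarrow> complex" where T: "T \<subseteq> {..<n}" and
      gram: "\<forall>s\<in>{..<n}. \<forall>t\<in>{..<n}. hform J x (f s) (f t) = (if s = t then if t \<in> T then -1 else 1 else 0)"
      by auto
    then obtain v where v: "\<And>s. s < n \<Longrightarrow> hform J x (f s) v = 0" "hform J x v v = 1 \<or> hform J x v v = -1"
      using extend_orthonormal[OF assms, of n f T] Suc.prems by auto
    have v': "hform J x v (f s) = 0" if "s < n" for s
      using v(1)[OF that] hform_cnj[OF assms(2), of J "f s" v] by simp
    let ?T = "if hform J x v v = 1 then T else insert n T"
    have "hform J x ((f(n := v)) s) ((f(n := v)) t) = (if s = t then if t \<in> ?T then -1 else 1 else 0)"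
      if "s < Suc n" "t < Suc n" for s t
    proof (cases "s = n"; cases "t = n")
      assume "s \<noteq> n" "t \<noteq> n"
      then show ?thesis using gram that by simp
    qed (use that v v' T in auto)
    moreover have "?T \<subseteq> {..<Suc n}" using T by auto
    ultimately show ?case by blast
  qed
  then show ?thesis unfolding sylvester_basis_def by auto
qed

text \<open>The number of negative squares; the choice is immaterial for a nondegenerate Hermitian form,
  see \<open>neg_index_eq\<close>.\<close>

definition neg_index :: "'i set \<Rightarrow> 'i cmatrix \<Rightarrow> nat" where
  "neg_index J x = (SOME k. \<exists>T f. sylvester_basis J x {..<card J} T (f :: nat \<Rightarrow> 'i \<Rightarrow> complex) \<and> card T = k)"

lemma neg_index_eq:
  assumes "finite J" "madj x = x" "nondeg J x" "sylvester_basis J x B T f"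
  shows "neg_index J x = card T"
proof -
  have "\<exists>k T f. sylvester_basis J x {..<card J} T (f :: nat \<Rightarrow> 'a \<Rightarrow> complex) \<and> card T = k"
    using sylvester_basis_exists[OF assms(1-3)] by blast
  then obtain T' and f' :: "nat \<Rightarrow> 'a \<Rightarrow> complex" where
    "sylvester_basis J x {..<card J} T' f'" "card T' = neg_index J x"
    unfolding neg_index_def using someI_ex[of "\<lambda>k. \<exists>T f. sylvester_basis J x {..<card J} T (f :: nat \<Rightarrow> 'a \<Rightarrow> complex) \<and> card T = k"] by blast
  moreover have "card T = card T'"
    by (rule sylvester_basis_negatives_eq[OF assms(1,4) \<open>sylvester_basis J x {..<card J} T' f'\<close>]) simp
  ultimately show ?thesis by simp
qed

lemma neg_index_sign_matrix:
  assumes "finite J" "J \<subseteq> I"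
  shows "neg_index J (sign_matrix I S) = card (S \<inter> J)"
proof (rule neg_index_eq[OF assms(1)])
  show "madj (sign_matrix I S) = sign_matrix I S"
    by (intro madj_eqI) (auto simp: sign_matrix_def)
  show "nondeg J (sign_matrix I S)"
    using assms by (subst nondeg_diagonal) (auto simp: sign_matrix_def)
  have "hform J (sign_matrix I S) (\<lambda>i. if i = s then 1 else 0) (\<lambda>i. if i = t then 1 else 0) =
     (if s = t then if t \<in> S \<inter> J then -1 else 1 else 0)" if "s \<in> J" "t \<in> J" for s t
  proof -
    have "hform J (sign_matrix I S) (\<lambda>i. if i = s then 1 else 0) (\<lambda>i. if i = t then 1 else 0) =
        (\<Sum>i\<in>J. if i = s then sign_matrix I S s t else 0)"
      unfolding hform_unit_right[OF assms(1) that(2)] by (intro sum.cong) auto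
    then show ?thesis using assms that by (auto simp: sign_matrix_def)
  qed
  then show "sylvester_basis J (sign_matrix I S) J (S \<inter> J) (\<lambda>s i. if i = s then 1 else 0)"
    unfolding sylvester_basis_def using assms(1) by simp
qed

lemma continuous_on_entry: "continuous_on S (\<lambda>x :: 'i cmatrix. x i j)"
proof -
  have "continuous_on UNIV (\<lambda>x :: 'i cmatrix. x i)" by simp
  then have "continuous_on UNIV (\<lambda>x :: 'i cmatrix. x i j)"
    by (rule continuous_on_product_then_coordinatewise)
  then show ?thesis by (rule continuous_on_subset) simp
qed

lemma continuous_on_hform: "continuous_on S (\<lambda>x. hform J x u v)"
  unfolding hform_def by (intro continuous_intros continuous_on_entry)

text \<open>Locally constant along the path by \<open>sylvester_basis_negatives_eq\<close>, hence constant, as the image of the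
  path is connected.\<close>

lemma neg_index_path:
  assumes "finite J" "\<And>x. x \<in> S \<Longrightarrow> madj x = x" "\<And>x. x \<in> S \<Longrightarrow> nondeg J x"
    and "path_component S a b"
  shows "neg_index J a = neg_index J b"
proof -
  obtain g where g: "path g" "path_image g \<subseteq> S" "pathstart g = a" "pathfinish g = b"
    using assms(4) unfolding path_component_def by blast
  show ?thesis
  proof (rule connected_local_const[where f = "neg_index J"])
    show "connected (path_image g)" using g(1) by (rule connected_path_image)
    show "a \<in> path_image g" "b \<in> path_image g" using g by auto
    show "\<forall>x\<in>path_image g. eventually (\<lambda>y. neg_index J x = neg_index J y) (at x within path_image g)"
    proof
      fix x assume x: "x \<in> path_image g"
      then have xS: "x \<in> S" using g by blast
      obtain T and f :: "nat \<Rightarrow> 'a \<Rightarrow> complex" where f: "sylvester_basis J x {..<card J} T f"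
        using sylvester_basis_exists[OF assms(1-3)] xS by blast
      have "eventually (\<lambda>y. dist (hform J y (f s) (f t)) (hform J x (f s) (f t)) < 1 / (real (card J) + 1))
          (at x within path_image g)" for s t
        using continuous_on_hform[of "path_image g" J "f s" "f t"] x
        unfolding continuous_on_def by (intro tendstoD) auto
      then have "eventually (\<lambda>y. \<forall>s\<in>{..<card J}. \<forall>t\<in>{..<card J}.
          dist (hform J y (f s) (f t)) (hform J x (f s) (f t)) < 1 / (real (card J) + 1))
          (at x within path_image g)"
        by (simp add: eventually_ball_finite)
      moreover have "eventually (\<lambda>y. y \<in> path_image g) (at x within path_image g)"
        by (simp add: eventually_at_filter)
      ultimately show "eventually (\<lambda>y. neg_index J x = neg_index J y) (at x within path_image g)"
      proof eventually_elim
        case (elim y)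
        then have yS: "y \<in> S" using g by blast
        obtain T' and f' :: "nat \<Rightarrow> 'a \<Rightarrow> complex" where f': "sylvester_basis J y {..<card J} T' f'"
          using sylvester_basis_exists[OF assms(1-3)] yS by blast
        have "card T = card T'"
          using elim(1) by (intro sylvester_basis_negatives_eq[OF assms(1) f f']) (auto simp: dist_norm less_imp_le)
        then show ?case
          using neg_index_eq[OF assms(1) assms(2,3)[OF xS] f] neg_index_eq[OF assms(1) assms(2,3)[OF yS] f'] by simp
      qed
    qed
  qed
qed

section \<open>Path components are classified by the negative squares on the blocks\<close>

text \<open>\<open>R\<close> is a tolerance relation on the finite set \<open>I\<close> and \<open>Ls\<close> consists of its connected components:
  the members are connected through \<open>R\<close>, and no edge leaves any of them.  An empty
  member is not excluded here.\<close>

definition block_pattern :: "'i set \<Rightarrow> 'i rel \<Rightarrow> 'i set set \<Rightarrow> bool" where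
  "block_pattern I R Ls \<longleftrightarrow> finite I \<and> R \<subseteq> I \<times> I \<and> (\<forall>i\<in>I. (i, i) \<in> R) \<and> sym R \<and> \<Union>Ls = I \<and>
     (\<forall>L\<in>Ls. \<forall>i\<in>L. \<forall>j\<in>L. (i, j) \<in> R\<^sup>*) \<and> (\<forall>L\<in>Ls. \<forall>i j. (i, j) \<in> R \<longrightarrow> i \<in> L \<longrightarrow> j \<in> L)"

lemma block_patternD:
  assumes "block_pattern I R Ls"
  shows "finite I" "R \<subseteq> I \<times> I" "\<And>i. i \<in> I \<Longrightarrow> (i, i) \<in> R" "sym R" "\<Union>Ls = I"
    "\<And>L i j. L \<in> Ls \<Longrightarrow> i \<in> L \<Longrightarrow> j \<in> L \<Longrightarrow> (i, j) \<in> R\<^sup>*"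
    "\<And>L i j. L \<in> Ls \<Longrightarrow> (i, j) \<in> R \<Longrightarrow> i \<in> L \<Longrightarrow> j \<in> L"
  using assms unfolding block_pattern_def by simp_all

lemma block_patternI:
  assumes "finite I" "R \<subseteq> I \<times> I" "\<And>i. i \<in> I \<Longrightarrow> (i, i) \<in> R" "sym R" "\<Union>Ls = I"
    "\<And>L i j. L \<in> Ls \<Longrightarrow> i \<in> L \<Longrightarrow> j \<in> L \<Longrightarrow> (i, j) \<in> R\<^sup>*"
    "\<And>L i j. L \<in> Ls \<Longrightarrow> (i, j) \<in> R \<Longrightarrow> i \<in> L \<Longrightarrow> j \<in> L"
  shows "block_pattern I R Ls"
  using assms unfolding block_pattern_def by simp

lemma block_pattern_rtrancl:
  assumes "block_pattern I R Ls" "L \<in> Ls" "(i, j) \<in> R\<^sup>*" "i \<in> L"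
  shows "j \<in> L"
  using assms(3,4,1,2) by (induction rule: rtrancl_induct) (auto simp: block_pattern_def)

lemma block_pattern_disjoint:
  assumes "block_pattern I R Ls" "L \<in> Ls" "L' \<in> Ls" "i \<in> L" "i \<in> L'"
  shows "L = L'"
proof -
  have sub: "M \<subseteq> M'" if "M \<in> Ls" "M' \<in> Ls" "i \<in> M" "i \<in> M'" for M M'
  proof
    fix j assume "j \<in> M"
    then have "(i, j) \<in> R\<^sup>*" using assms(1) that unfolding block_pattern_def by blast
    then show "j \<in> M'" using block_pattern_rtrancl[OF assms(1)] that by blast
  qed
  show ?thesis using sub[of L L'] sub[of L' L] assms by blast
qed

lemma nondeg_block:
  assumes "block_pattern I R Ls" "L \<in> Ls" "nondeg I x" "\<And>i j. (i, j) \<notin> R \<Longrightarrow> x i j = 0"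
  shows "nondeg L x"
proof (rule nondegI)
  fix u j assume u: "\<And>i. i \<in> L \<Longrightarrow> (\<Sum>j\<in>L. x i j * u j) = 0" and j: "j \<in> L"
  have I: "finite I" "L \<subseteq> I" using assms(1,2) unfolding block_pattern_def by auto
  define v where "v = (\<lambda>j. if j \<in> L then u j else 0)"
  have "(\<Sum>j\<in>I. x i j * v j) = 0" if "i \<in> I" for i
  proof -
    have eq: "(\<Sum>j\<in>I. x i j * v j) = (\<Sum>j\<in>L. x i j * u j)"
      using I by (intro sum.mono_neutral_cong_right) (auto simp: v_def)
    have "(\<Sum>j\<in>L. x i j * u j) = 0"
    proof (cases "i \<in> L")
      case False
      then have "(i, j) \<notin> R" if "j \<in> L" for j
        using assms(1,2) that unfolding block_pattern_def by (meson symD)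
      then show ?thesis using assms(4) by (intro sum.neutral) auto
    qed (rule u)
    then show ?thesis using eq by simp
  qed
  then have "v j = 0" using nondegD[OF assms(3), of v j] j I by blast
  then show "u j = 0" using j by (simp add: v_def)
qed

text \<open>Both matrices are connected to sign matrices.  The invariants count the minus signs in
  each block, and two sign matrices with equal counts are connected.\<close>

theorem path_component_herm_inv_iff:
  assumes "block_pattern I R Ls" "x \<in> herm_inv I R" "y \<in> herm_inv I R"
  shows "path_component (herm_inv I R) x y \<longleftrightarrow> (\<forall>L\<in>Ls. neg_index L x = neg_index L y)"
proof -
  have I: "finite I" "R \<subseteq> I \<times> I" "\<And>i. i \<in> I \<Longrightarrow> (i, i) \<in> R" "sym R" "\<Union>Ls = I"
    "\<And>L i j. L \<in> Ls \<Longrightarrow> i \<in> L \<Longrightarrow> j \<in> L \<Longrightarrow> (i, j) \<in> R\<^sup>*"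
    using assms(1) unfolding block_pattern_def by auto
  have L: "finite L" "L \<subseteq> I" if "L \<in> Ls" for L
    using that I(1,5) finite_subset[of L I] by auto
  have inv: "neg_index L a = neg_index L b" if "path_component (herm_inv I R) a b" "L \<in> Ls" for a b L
  proof (rule neg_index_path[OF L(1) _ _ that(1)])
    show "L \<in> Ls" by fact
    fix z assume "z \<in> herm_inv I R"
    then have z: "madj z = z" "nondeg I z" "\<And>i j. (i, j) \<notin> R \<Longrightarrow> z i j = 0"
      unfolding herm_inv_def by auto
    show "madj z = z" by (rule z(1))
    show "nondeg L z" by (rule nondeg_block[OF assms(1) that(2) z(2,3)])
  qed
  obtain S where S: "S \<subseteq> I" "path_component (herm_inv I R) x (sign_matrix I S)"
    using path_to_sign_matrix[OF I(1-3) assms(2)] by blast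
  obtain T where T: "T \<subseteq> I" "path_component (herm_inv I R) y (sign_matrix I T)"
    using path_to_sign_matrix[OF I(1-3) assms(3)] by blast
  show ?thesis
  proof
    assume "path_component (herm_inv I R) x y"
    then show "\<forall>L\<in>Ls. neg_index L x = neg_index L y" using inv by blast
  next
    assume eq: "\<forall>L\<in>Ls. neg_index L x = neg_index L y"
    have "card (S \<inter> L) = card (T \<inter> L)" if "L \<in> Ls" for L
      using eq inv[OF S(2) that] inv[OF T(2) that] neg_index_sign_matrix[OF L[OF that]] that by simp
    then have "path_component (herm_inv I R) (sign_matrix I S) (sign_matrix I T)"
      by (intro path_between_sign_matrices[OF I(1,3,4,2,5,6) block_pattern_disjoint[OF assms(1)] S(1) T(1)])
    then show "path_component (herm_inv I R) x y"
      by (intro path_component_trans[OF path_component_trans[OF S(2)] path_component_sym[OF T(2)]])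
  qed
qed


section \<open>Amplifications of a block pattern\<close>

text \<open>The equivalence relation with classes \<open>Ks\<close>; the matrices supported on it form the block algebra.\<close>

definition block_rel :: "'i set set \<Rightarrow> 'i rel" where
  "block_rel Ks = {(i, j). \<exists>K\<in>Ks. i \<in> K \<and> j \<in> K}"

lemma graph_operator_system_iff:
  assumes "R \<subseteq> X \<times> X"
  shows "x \<in> graph_operator_system X R \<longleftrightarrow> (\<forall>i j. (i, j) \<notin> R \<longrightarrow> x i j = 0)"
  using assms unfolding graph_operator_system_def mats_def by blast

lemma block_pattern_subset_block_rel:
  assumes "block_pattern X R Ks"
  shows "R \<subseteq> block_rel Ks"
proof (rule subrelI)
  fix i j assume ij: "(i, j) \<in> R"
  then have "i \<in> \<Union>Ks" using block_patternD(2,5)[OF assms] by blast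
  then obtain K where "K \<in> Ks" "i \<in> K" by blast
  then show "(i, j) \<in> block_rel Ks"
    using block_patternD(7)[OF assms _ ij] by (auto simp: block_rel_def)
qed

lemma block_pattern_block_rel:
  assumes "block_pattern X R Ks"
  shows "block_pattern X (block_rel Ks) Ks"
proof -
  have "j \<in> L" if "L \<in> Ks" "(i, j) \<in> block_rel Ks" "i \<in> L" for L i j
    using that block_pattern_disjoint[OF assms] unfolding block_rel_def by blast
  moreover have "sym (block_rel Ks)" unfolding block_rel_def sym_def by blast
  moreover have "\<forall>L\<in>Ks. \<forall>i\<in>L. \<forall>j\<in>L. (i, j) \<in> (block_rel Ks)\<^sup>*"
    by (auto simp: block_rel_def intro!: r_into_rtrancl)
  moreover have "block_rel Ks \<subseteq> X \<times> X" "\<forall>i\<in>X. (i, i) \<in> block_rel Ks"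
    using block_patternD(5)[OF assms] by (auto simp: block_rel_def)
  ultimately show ?thesis
    using block_patternD(1,5)[OF assms] unfolding block_pattern_def by simp
qed

definition amp_rel :: "nat \<Rightarrow> 'i rel \<Rightarrow> (nat \<times> 'i) rel" where
  "amp_rel m R = {((a, i), (b, j)). a \<in> {1..m} \<and> b \<in> {1..m} \<and> (i, j) \<in> R}"

lemma amp_graph_operator_system_iff:
  assumes "R \<subseteq> X \<times> X"
  shows "x \<in> amp m X (graph_operator_system X R) \<longleftrightarrow> (\<forall>p q. (p, q) \<notin> amp_rel m R \<longrightarrow> x p q = 0)"
    (is "?l \<longleftrightarrow> ?r")
proof
  assume l: ?l
  show ?r
  proof (intro allI impI)
    fix p q :: "nat \<times> 'a" assume no: "(p, q) \<notin> amp_rel m R"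
    obtain a i b j where pq: "p = (a, i)" "q = (b, j)" by fastforce
    show "x p q = 0"
    proof (cases "a \<in> {1..m} \<and> b \<in> {1..m}")
      case True
      then have "(\<lambda>i j. x (a, i) (b, j)) \<in> graph_operator_system X R" using l unfolding amp_def by blast
      then show ?thesis
        using True no unfolding graph_operator_system_iff[OF assms] pq amp_rel_def by blast
    next
      case False
      then show ?thesis using l unfolding amp_def mats_def pq by blast
    qed
  qed
next
  assume r: ?r
  have "x p q = 0" if "(p, q) \<notin> ({1..m} \<times> X) \<times> ({1..m} \<times> X)" for p q
  proof -
    have "(p, q) \<notin> amp_rel m R" using that assms unfolding amp_rel_def by auto
    then show ?thesis using r by blast
  qed
  then have "x \<in> mats ({1..m} \<times> X)" unfolding mats_def by blast
  moreover have "(\<lambda>i j. x (a, i) (b, j)) \<in> graph_operator_system X R" for a b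
    unfolding graph_operator_system_iff[OF assms] using r by (simp add: amp_rel_def)
  ultimately show ?l unfolding amp_def by blast
qed

text \<open>A path of the graph is followed in one copy of \<open>X\<close>; a loop \<open>(j, j)\<close> provides the edge to any
  other copy.\<close>

lemma block_pattern_amp:
  assumes "block_pattern X R Ks"
  shows "block_pattern ({1..m} \<times> X) (amp_rel m R) ((\<lambda>K. {1..m} \<times> K) ` Ks)"
proof -
  note R = block_patternD[OF assms]
  have connected: "(p, q) \<in> (amp_rel m R)\<^sup>*" if "L \<in> Ks" "p \<in> {1..m} \<times> L" "q \<in> {1..m} \<times> L" for L p q
  proof -
    obtain a i b j where pq: "p = (a, i)" "q = (b, j)" by fastforce
    have "((a, i), (a, j)) \<in> (amp_rel m R)\<^sup>*"
      if "(i, j) \<in> R\<^sup>*" "a \<in> {1..m}" for a i j using that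
    proof (induction rule: rtrancl_induct)
      case (step j k)
      then have "((a, j), (a, k)) \<in> amp_rel m R" unfolding amp_rel_def by blast
      with step show ?case by (meson rtrancl.rtrancl_into_rtrancl)
    qed simp
    note row = this
    have ij: "i \<in> L" "j \<in> L" "a \<in> {1..m}" "b \<in> {1..m}" using that unfolding pq by auto
    then have "j \<in> X" using R(5) that(1) by blast
    then have "((a, j), (b, j)) \<in> amp_rel m R"
      using ij(3,4) R(3) by (simp add: amp_rel_def)
    then show ?thesis
      unfolding pq by (rule rtrancl_into_rtrancl[OF row[OF R(6)[OF that(1) ij(1,2)] ij(3)]])
  qed
  show ?thesis
  proof (rule block_patternI)
    show "finite ({1..m} \<times> X)" using R(1) by simp
    show "amp_rel m R \<subseteq> ({1..m} \<times> X) \<times> ({1..m} \<times> X)"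
      using R(2) unfolding amp_rel_def by blast
    show "(p, p) \<in> amp_rel m R" if "p \<in> {1..m} \<times> X" for p
      using R(3) that unfolding amp_rel_def by blast
    show "sym (amp_rel m R)" using R(4) unfolding amp_rel_def sym_def by blast
    show "\<Union>((\<lambda>K. {1..m} \<times> K) ` Ks) = {1..m} \<times> X" using R(5) by blast
  next
    fix L p q assume L: "L \<in> (\<lambda>K. {1..m} \<times> K) ` Ks" and p: "p \<in> L"
    then obtain K where K: "K \<in> Ks" "L = {1..m} \<times> K" by blast
    show "(p, q) \<in> (amp_rel m R)\<^sup>*" if "q \<in> L"
      using connected[OF K(1)] p that unfolding K(2) by blast
    show "q \<in> L" if "(p, q) \<in> amp_rel m R"
      using R(7)[OF K(1)] p that unfolding K(2) amp_rel_def by blast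
  qed
qed

text \<open>The inverse is found column by column, solving each system inside the block of the column;
  this is why it is supported on \<open>block_rel Ls\<close>, though not in general on \<open>R\<close>.\<close>

lemma inverse_in_blocks:
  assumes "block_pattern I R Ls" "nondeg I x" "\<And>i j. (i, j) \<notin> R \<Longrightarrow> x i j = 0"
  shows "\<exists>y. (\<forall>i j. (i, j) \<notin> block_rel Ls \<longrightarrow> y i j = 0) \<and> mmul I x y = mone I \<and> mmul I y x = mone I"
proof -
  note I = block_patternD(1,5,2)[OF assms(1)] and closed = block_patternD(7)[OF assms(1)]
    and sym = block_patternD(4)[OF assms(1)]
  have "\<exists>w. (\<forall>j. (j, k) \<notin> block_rel Ls \<longrightarrow> w j = 0) \<and>
      (\<forall>i\<in>I. (\<Sum>j\<in>I. x i j * w j) = (if i = k then 1 else 0))" if k: "k \<in> I" for k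
  proof -
    obtain L where L: "L \<in> Ls" "k \<in> L" using I(2) k by blast
    have LI: "L \<subseteq> I" "finite L" using L(1) I(1,2) finite_subset[of L I] by auto
    obtain w where w: "\<And>i. i \<in> L \<Longrightarrow> (\<Sum>j\<in>L. x i j * w j) = (if i = k then 1 else 0)"
      using nondeg_solve[OF LI(2) nondeg_block[OF assms(1) L(1) assms(2,3)], of "\<lambda>i. if i = k then 1 else 0"]
      by blast
    define w' where "w' = (\<lambda>j. if j \<in> L then w j else 0)"
    have "(\<Sum>j\<in>I. x i j * w' j) = (if i = k then 1 else 0)" if "i \<in> I" for i
    proof -
      have eq: "(\<Sum>j\<in>I. x i j * w' j) = (\<Sum>j\<in>L. x i j * w j)"
        using I LI by (intro sum.mono_neutral_cong_right) (auto simp: w'_def)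
      show ?thesis
      proof (cases "i \<in> L")
        case False
        have "x i j = 0" if "j \<in> L" for j
          using False closed[OF L(1) symD[OF sym], of i j] that by (intro assms(3)) blast
        then show ?thesis using False L eq by auto
      qed (use w eq in auto)
    qed
    moreover have "w' j = 0" if "(j, k) \<notin> block_rel Ls" for j
      using that L unfolding w'_def block_rel_def by auto
    ultimately show ?thesis by blast
  qed
  then have "\<forall>k\<in>I. \<exists>w. (\<forall>j. (j, k) \<notin> block_rel Ls \<longrightarrow> w j = 0) \<and>
      (\<forall>i\<in>I. (\<Sum>j\<in>I. x i j * w j) = (if i = k then 1 else 0))" by blast
  then obtain W where W: "\<And>k j. k \<in> I \<Longrightarrow> (j, k) \<notin> block_rel Ls \<Longrightarrow> W k j = 0"
    "\<And>k i. k \<in> I \<Longrightarrow> i \<in> I \<Longrightarrow> (\<Sum>j\<in>I. x i j * W k j) = (if i = k then 1 else 0)"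
    unfolding bchoice_iff by blast
  define y where "y = (\<lambda>j k. if k \<in> I then W k j else 0)"
  have off: "x i j = 0" if "i \<notin> I \<or> j \<notin> I" for i j using that I(3) assms(3)[of i j] by blast
  have y0: "y i j = 0" if "(i, j) \<notin> block_rel Ls" for i j
    using W(1)[of j i] that by (auto simp: y_def)
  have yoff: "y i j = 0" if "i \<notin> I \<or> j \<notin> I" for i j
    using that I(2) by (intro y0) (auto simp: block_rel_def)
  have xy: "mmul I x y = mone I"
  proof (intro ext)
    fix i k
    show "mmul I x y i k = mone I i k"
    proof (cases "i \<in> I \<and> k \<in> I")
      case True
      then show ?thesis using W(2) by (simp add: mmul_def mone_def y_def)
    next
      case False
      then have "mmul I x y i k = 0" unfolding mmul_def using off yoff by (intro sum.neutral) auto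
      then show ?thesis using False by (auto simp: mone_def)
    qed
  qed
  have yx: "mmul I y x = mone I"
  proof (intro ext)
    fix i k
    show "mmul I y x i k = mone I i k"
    proof (cases "i \<in> I \<and> k \<in> I")
      case True
      define u where "u = (\<lambda>j. mmul I y x j k - mone I j k)"
      have "(\<Sum>j\<in>I. x i j * u j) = 0" if i: "i \<in> I" for i
      proof -
        have "(\<Sum>j\<in>I. x i j * mmul I y x j k) = (\<Sum>j\<in>I. \<Sum>l\<in>I. x i j * (y j l * x l k))"
          unfolding mmul_def by (simp only: sum_distrib_left)
        also have "\<dots> = (\<Sum>l\<in>I. \<Sum>j\<in>I. x i j * (y j l * x l k))" by (rule sum.swap)
        also have "\<dots> = (\<Sum>l\<in>I. mmul I x y i l * x l k)"
          unfolding mmul_def by (simp only: sum_distrib_right mult.assoc)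
        also have "\<dots> = (\<Sum>l\<in>I. if l = i then x i k else 0)"
          unfolding xy by (intro sum.cong refl) (use i in \<open>auto simp: mone_def\<close>)
        also have "\<dots> = x i k" using i I(1) by simp
        also have "x i k = (\<Sum>j\<in>I. if j = k then x i k else 0)" using True I(1) by simp
        also have "\<dots> = (\<Sum>j\<in>I. x i j * mone I j k)"
          by (intro sum.cong refl) (use True in \<open>auto simp: mone_def\<close>)
        finally show ?thesis by (simp add: u_def right_diff_distrib sum_subtractf)
      qed
      then have "u i = 0" using nondegD[OF assms(2), of u i] True by blast
      then show ?thesis by (simp add: u_def)
    next
      case False
      then have "mmul I y x i k = 0" unfolding mmul_def using off yoff by (intro sum.neutral) auto
      then show ?thesis using False by (auto simp: mone_def)
    qed
  qed
  show ?thesis using y0 xy yx by blast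
qed

lemma block_rel_amp: "block_rel ((\<lambda>K. {1..m} \<times> K) ` Ks) = amp_rel m (block_rel Ks)"
  unfolding block_rel_def amp_rel_def by auto

text \<open>Invertibility in the amplified envelope is the same as a trivial kernel, since the
  inverse automatically lies in the block algebra.\<close>

lemma Hinv_eq_herm_inv:
  assumes "block_pattern X R Ks"
  shows "Hinv X (graph_operator_system X R) (graph_operator_system X (block_rel Ks)) m =
    herm_inv ({1..m} \<times> X) (amp_rel m R)"
proof -
  let ?I = "{1..m} \<times> X"
  note pattern = block_pattern_amp[OF assms, of m]
  have RX: "R \<subseteq> X \<times> X" "block_rel Ks \<subseteq> X \<times> X" "finite X"
    using block_patternD(1,2)[OF assms] block_patternD(2)[OF block_pattern_block_rel[OF assms]] by auto
  have "nondeg ?I x" if "mmul ?I y x = mone ?I" for x y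
  proof (rule nondegI)
    fix u p assume u: "\<And>q. q \<in> ?I \<Longrightarrow> (\<Sum>r\<in>?I. x q r * u r) = 0" and p: "p \<in> ?I"
    have "u p = (\<Sum>r\<in>?I. if r = p then u r else 0)" using p RX(3) by simp
    also have "\<dots> = (\<Sum>r\<in>?I. mone ?I p r * u r)"
      by (intro sum.cong refl) (use p in \<open>auto simp: mone_def\<close>)
    also have "\<dots> = (\<Sum>r\<in>?I. \<Sum>q\<in>?I. y p q * (x q r * u r))"
      unfolding that[symmetric] mmul_def by (simp only: sum_distrib_right mult.assoc)
    also have "\<dots> = (\<Sum>q\<in>?I. \<Sum>r\<in>?I. y p q * (x q r * u r))" by (rule sum.swap)
    also have "\<dots> = (\<Sum>q\<in>?I. y p q * (\<Sum>r\<in>?I. x q r * u r))" by (simp only: sum_distrib_left)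
    also have "\<dots> = 0" using u by simp
    finally show "u p = 0" .
  qed
  moreover have "\<exists>y. (\<forall>p q. (p, q) \<notin> amp_rel m (block_rel Ks) \<longrightarrow> y p q = 0) \<and>
      mmul ?I x y = mone ?I \<and> mmul ?I y x = mone ?I"
    if "nondeg ?I x" "\<forall>p q. (p, q) \<notin> amp_rel m R \<longrightarrow> x p q = 0" for x
    using inverse_in_blocks[OF pattern that(1)] that(2) unfolding block_rel_amp by blast
  ultimately show ?thesis
    unfolding Hinv_def herm_inv_def amp_graph_operator_system_iff[OF RX(1)]
      amp_graph_operator_system_iff[OF RX(2)] mem_Collect_eq Bex_def by blast
qed

section \<open>Direct sums\<close>

lemma sum_amp_split:
  fixes g :: "nat \<times> 'i \<Rightarrow> complex"
  assumes "finite X"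
  shows "(\<Sum>p\<in>{1..m + m'} \<times> X. g p) = (\<Sum>p\<in>{1..m} \<times> X. g p) + (\<Sum>p\<in>{1..m'} \<times> X. g (m + fst p, snd p))"
proof -
  let ?s = "\<lambda>p. (m + fst p, snd p)"
  have "{1..m + m'} \<times> X = {1..m} \<times> X \<union> ?s ` ({1..m'} \<times> X)"
  proof
    show "{1..m + m'} \<times> X \<subseteq> {1..m} \<times> X \<union> ?s ` ({1..m'} \<times> X)"
    proof
      fix p assume p: "p \<in> {1..m + m'} \<times> X"
      show "p \<in> {1..m} \<times> X \<union> ?s ` ({1..m'} \<times> X)"
      proof (cases "fst p \<le> m")
        case False
        then have "p = ?s (fst p - m, snd p)" "(fst p - m, snd p) \<in> {1..m'} \<times> X" using p by auto
        then show ?thesis by blast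
      qed (use p in auto)
    qed
  qed auto
  moreover have "({1..m} \<times> X) \<inter> ?s ` ({1..m'} \<times> X) = {}" by auto
  moreover have "inj_on ?s ({1..m'} \<times> X)" by (auto simp: inj_on_def prod_eq_iff)
  ultimately show ?thesis using assms by (simp add: sum.union_disjoint sum.reindex)
qed

lemma dsum_herm_inv:
  assumes "finite X" "R \<subseteq> X \<times> X"
    and x: "x \<in> herm_inv ({1..m} \<times> X) (amp_rel m R)" and x': "x' \<in> herm_inv ({1..m'} \<times> X) (amp_rel m' R)"
  shows "dsum m x x' \<in> herm_inv ({1..m + m'} \<times> X) (amp_rel (m + m') R)"
proof -
  have h: "madj x = x" "nondeg ({1..m} \<times> X) x" "\<And>p q. (p, q) \<notin> amp_rel m R \<Longrightarrow> x p q = 0"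
    "madj x' = x'" "nondeg ({1..m'} \<times> X) x'" "\<And>p q. (p, q) \<notin> amp_rel m' R \<Longrightarrow> x' p q = 0"
    using x x' unfolding herm_inv_def by blast+
  have "madj (dsum m x x') = dsum m x x'"
    by (intro madj_eqI) (auto simp: dsum_def madj_entry[OF h(1)] madj_entry[OF h(4)] split: prod.split)
  moreover have "dsum m x x' p q = 0" if "(p, q) \<notin> amp_rel (m + m') R" for p q
  proof -
    obtain a i b j where pq: "p = (a, i)" "q = (b, j)" by fastforce
    show ?thesis
    proof (cases "a \<le> m \<and> b \<le> m")
      case True
      then have "((a, i), (b, j)) \<notin> amp_rel m R" using that unfolding pq amp_rel_def by auto
      then show ?thesis using True h(3) by (simp add: pq dsum_def)
    next
      case False
      show ?thesis
      proof (cases "m < a \<and> m < b")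
        case True
        then have "((a - m, i), (b - m, j)) \<notin> amp_rel m' R" using that unfolding pq amp_rel_def by auto
        then show ?thesis using True h(6) by (simp add: pq dsum_def)
      qed (use False in \<open>auto simp: pq dsum_def\<close>)
    qed
  qed
  moreover have "nondeg ({1..m + m'} \<times> X) (dsum m x x')"
  proof (rule nondegI)
    fix u p assume row: "\<And>q. q \<in> {1..m + m'} \<times> X \<Longrightarrow> (\<Sum>r\<in>{1..m + m'} \<times> X. dsum m x x' q r * u r) = 0"
      and p: "p \<in> {1..m + m'} \<times> X"
    define u' where "u' = (\<lambda>p. u (m + fst p, snd p))"
    have "(\<Sum>r\<in>{1..m} \<times> X. x q r * u r) = 0" if q: "q \<in> {1..m} \<times> X" for q
    proof -
      have "(\<Sum>r\<in>{1..m} \<times> X. dsum m x x' q r * u r) = (\<Sum>r\<in>{1..m} \<times> X. x q r * u r)"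
        using q by (intro sum.cong refl) (auto simp: dsum_def)
      moreover have "(\<Sum>r\<in>{1..m'} \<times> X. dsum m x x' q (m + fst r, snd r) * u (m + fst r, snd r)) = 0"
        using q by (intro sum.neutral) (auto simp: dsum_def)
      moreover have "q \<in> {1..m + m'} \<times> X" using q by auto
      ultimately show ?thesis using row[of q] sum_amp_split[OF assms(1), of "\<lambda>r. dsum m x x' q r * u r" m m'] by simp
    qed
    then have u0: "u q = 0" if "q \<in> {1..m} \<times> X" for q
      using nondegD[OF h(2), of u q] that by blast
    have "(\<Sum>r\<in>{1..m'} \<times> X. x' q r * u' r) = 0" if q: "q \<in> {1..m'} \<times> X" for q
    proof -
      let ?q = "(m + fst q, snd q)"
      have "(\<Sum>r\<in>{1..m} \<times> X. dsum m x x' ?q r * u r) = 0"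
        using q by (intro sum.neutral) (auto simp: dsum_def)
      moreover have "(\<Sum>r\<in>{1..m'} \<times> X. dsum m x x' ?q (m + fst r, snd r) * u (m + fst r, snd r)) =
          (\<Sum>r\<in>{1..m'} \<times> X. x' q r * u' r)"
        using q by (intro sum.cong refl) (auto simp: dsum_def u'_def)
      moreover have "?q \<in> {1..m + m'} \<times> X" using q by auto
      ultimately show ?thesis using row[of ?q] sum_amp_split[OF assms(1), of "\<lambda>r. dsum m x x' ?q r * u r" m m'] by simp
    qed
    then have u1: "u' q = 0" if "q \<in> {1..m'} \<times> X" for q
      using nondegD[OF h(5), of u' q] that by blast
    show "u p = 0"
    proof (cases "fst p \<le> m")
      case True
      then show ?thesis using p by (intro u0) auto
    next
      case False
      then have "u' (fst p - m, snd p) = 0" using p by (intro u1) auto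
      then show ?thesis using False by (simp add: u'_def)
    qed
  qed
  ultimately show ?thesis unfolding herm_inv_def by blast
qed

lemma dsum_path:
  assumes "finite X" "R \<subseteq> X \<times> X"
    and "path_component (herm_inv ({1..m} \<times> X) (amp_rel m R)) x y"
    and "path_component (herm_inv ({1..m'} \<times> X) (amp_rel m' R)) x' y'"
  shows "path_component (herm_inv ({1..m + m'} \<times> X) (amp_rel (m + m') R)) (dsum m x x') (dsum m y y')"
proof -
  obtain g where g: "path g" "path_image g \<subseteq> herm_inv ({1..m} \<times> X) (amp_rel m R)" "pathstart g = x" "pathfinish g = y"
    using assms(3) unfolding path_component_def by blast
  obtain g' where g': "path g'" "path_image g' \<subseteq> herm_inv ({1..m'} \<times> X) (amp_rel m' R)" "pathstart g' = x'" "pathfinish g' = y'"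
    using assms(4) unfolding path_component_def by blast
  have cont: "continuous_on {0..1} (\<lambda>t. f t p q)" if "path f" for f :: "real \<Rightarrow> (nat \<times> 'a) cmatrix" and p q
  proof -
    have "continuous_on {0..1} f" using that unfolding path_def .
    then have "continuous_on {0..1} (\<lambda>t. f t p)" by (rule continuous_on_product_then_coordinatewise)
    then show ?thesis by (rule continuous_on_product_then_coordinatewise)
  qed
  show ?thesis
  proof (rule path_component_entrywise[where g = "\<lambda>t. dsum m (g t) (g' t)"])
    show "continuous_on {0..1} (\<lambda>t. dsum m (g t) (g' t) p q)" for p q
      unfolding dsum_def
      by (cases p; cases q) (simp only: prod.case, intro continuous_on_const_if continuous_on_const cont g(1) g'(1))
  next
    fix t :: real assume "0 \<le> t" "t \<le> 1"
    then have "g t \<in> path_image g" "g' t \<in> path_image g'" unfolding path_image_def by auto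
    then show "dsum m (g t) (g' t) \<in> herm_inv ({1..m + m'} \<times> X) (amp_rel (m + m') R)"
      using g(2) g'(2) by (intro dsum_herm_inv[OF assms(1,2)]) auto
  qed (use g g' in \<open>auto simp: pathstart_def pathfinish_def\<close>)
qed

lemma dsum_sign_matrix:
  assumes "T \<subseteq> {1..m} \<times> X" "T' \<subseteq> {1..m'} \<times> X"
  shows "dsum m (sign_matrix ({1..m} \<times> X) T) (sign_matrix ({1..m'} \<times> X) T') =
    sign_matrix ({1..m + m'} \<times> X) (T \<union> (\<lambda>p. (m + fst p, snd p)) ` T')"
proof (intro ext)
  fix p q :: "nat \<times> 'a"
  obtain a i b j where pq: "p = (a, i)" "q = (b, j)" by fastforce
  have low: "(a, i) \<in> (\<lambda>p. (m + fst p, snd p)) ` T' \<longleftrightarrow> m < a \<and> (a - m, i) \<in> T'"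
  proof
    assume "(a, i) \<in> (\<lambda>p. (m + fst p, snd p)) ` T'"
    then obtain r where "r \<in> T'" "a = m + fst r" "i = snd r" by auto
    then show "m < a \<and> (a - m, i) \<in> T'" using assms(2) by auto
  next
    assume "m < a \<and> (a - m, i) \<in> T'"
    then show "(a, i) \<in> (\<lambda>p. (m + fst p, snd p)) ` T'" by (intro image_eqI[of _ _ "(a - m, i)"]) auto
  qed
  have mem: "(a, i) \<in> T \<union> (\<lambda>p. (m + fst p, snd p)) ` T' \<longleftrightarrow> (if m < a then (a - m, i) \<in> T' else (a, i) \<in> T)"
    unfolding Un_iff low using assms(1) by auto
  consider "a \<le> m" "b \<le> m" | "a \<le> m" "m < b" | "m < a" "b \<le> m" | "m < a" "m < b" by linarith
  then show "dsum m (sign_matrix ({1..m} \<times> X) T) (sign_matrix ({1..m'} \<times> X) T') p q =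
      sign_matrix ({1..m + m'} \<times> X) (T \<union> (\<lambda>p. (m + fst p, snd p)) ` T') p q"
    unfolding pq sign_matrix_def mem by cases (auto simp: dsum_def)
qed


section \<open>Quotients by an invariant, and the Grothendieck group\<close>

lemma UN_constant_on: "x \<in> S \<Longrightarrow> (\<And>y. y \<in> S \<Longrightarrow> F y = c) \<Longrightarrow> (\<Union>y\<in>S. F y) = c"
  by auto

lemma UN2_constant_on:
  "x \<in> S \<Longrightarrow> y \<in> T \<Longrightarrow> (\<And>u v. u \<in> S \<Longrightarrow> v \<in> T \<Longrightarrow> F u v = c) \<Longrightarrow> (\<Union>u\<in>S. \<Union>v\<in>T. F u v) = c"
  by auto

text \<open>The limit relation and the Grothendieck relation both turn out to identify exactly the
  elements of \<open>S\<close> with equal invariant \<open>F\<close>.  In this form their quotients are computed at once.\<close>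

definition fibre_rel :: "'a set \<Rightarrow> ('a \<Rightarrow> 'b) \<Rightarrow> 'a rel" where
  "fibre_rel S F = {(p, q). p \<in> S \<and> q \<in> S \<and> F p = F q}"

lemma fibre_class: "p \<in> S \<Longrightarrow> fibre_rel S F `` {p} = {q \<in> S. F q = F p}"
  unfolding fibre_rel_def by auto

lemma fibre_class_self: "p \<in> S \<Longrightarrow> p \<in> fibre_rel S F `` {p}"
  unfolding fibre_rel_def by auto

lemma fibre_class_eq_iff:
  assumes "p \<in> S" "q \<in> S"
  shows "fibre_rel S F `` {p} = fibre_rel S F `` {q} \<longleftrightarrow> F p = F q"
  unfolding fibre_class[OF assms(1)] fibre_class[OF assms(2)] using assms by auto

lemma quotient_fibre_rel: "S // fibre_rel S F = (\<lambda>p. fibre_rel S F `` {p}) ` S"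
  unfolding quotient_def by auto

lemma fibre_class_some:
  assumes "p \<in> S"
  shows "F (SOME q. q \<in> fibre_rel S F `` {p}) = F p"
proof -
  have "(SOME q. q \<in> fibre_rel S F `` {p}) \<in> fibre_rel S F `` {p}"
    by (rule someI[where x = p]) (rule fibre_class_self[OF assms])
  then show ?thesis unfolding fibre_class[OF assms] by simp
qed

text \<open>If \<open>\<phi>\<close> identifies \<open>M\<close> with \<open>\<nat>\<close> to the power \<open>N\<close>, then \<open>(a, b) \<mapsto> \<phi> a - \<phi> b\<close> identifies the
  Grothendieck group with \<open>\<int>\<close> to the power \<open>N\<close>.  Closure is stated
  along with it so that the isomorphism can be inverted in \<open>iso_via_common_target\<close>.\<close>

lemma grothendieck_group_of_counts:
  fixes M :: "('a, 'b) monoid_scheme" and \<phi> :: "'a \<Rightarrow> nat \<Rightarrow> nat" and N :: nat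
  assumes closed: "\<And>a b. a \<in> carrier M \<Longrightarrow> b \<in> carrier M \<Longrightarrow> a \<otimes>\<^bsub>M\<^esub> b \<in> carrier M"
    and mult: "\<And>a b k. a \<in> carrier M \<Longrightarrow> b \<in> carrier M \<Longrightarrow> k < N \<Longrightarrow> \<phi> (a \<otimes>\<^bsub>M\<^esub> b) k = \<phi> a k + \<phi> b k"
    and inj: "\<And>a b. a \<in> carrier M \<Longrightarrow> b \<in> carrier M \<Longrightarrow> (\<And>k. k < N \<Longrightarrow> \<phi> a k = \<phi> b k) \<Longrightarrow> a = b"
    and surj: "\<And>f. \<exists>a\<in>carrier M. \<forall>k<N. \<phi> a k = f k"
  shows "grothendieck_group M \<cong> product_group {..<N} (\<lambda>_. integer_group)"
    and "\<And>s t. s \<in> carrier (grothendieck_group M) \<Longrightarrow> t \<in> carrier (grothendieck_group M) \<Longrightarrow>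
      s \<otimes>\<^bsub>grothendieck_group M\<^esub> t \<in> carrier (grothendieck_group M)"
proof -
  let ?C = "carrier M \<times> carrier M" and ?G = "grothendieck_group M"
    and ?P = "product_group {..<N} (\<lambda>_. integer_group)"
  define D where "D = (\<lambda>(a, b). \<lambda>k\<in>{..<N}. int (\<phi> a k) - int (\<phi> b k))"
  have D_eq: "D (a, b) = D (a', b') \<longleftrightarrow> (\<forall>k<N. \<phi> a k + \<phi> b' k = \<phi> a' k + \<phi> b k)" for a b a' b'
  proof
    assume eq: "D (a, b) = D (a', b')"
    show "\<forall>k<N. \<phi> a k + \<phi> b' k = \<phi> a' k + \<phi> b k"
    proof (intro allI impI)
      fix k assume "k < N"
      then show "\<phi> a k + \<phi> b' k = \<phi> a' k + \<phi> b k"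
        using fun_cong[OF eq, of k] unfolding D_def by simp
    qed
  next
    assume eq: "\<forall>k<N. \<phi> a k + \<phi> b' k = \<phi> a' k + \<phi> b k"
    show "D (a, b) = D (a', b')"
      unfolding D_def prod.case
    proof (rule restrict_ext)
      fix k assume "k \<in> {..<N}"
      then show "int (\<phi> a k) - int (\<phi> b k) = int (\<phi> a' k) - int (\<phi> b' k)"
        using eq[rule_format, of k] by simp
    qed
  qed
  have rel: "grothendieck_rel M = fibre_rel ?C D"
  proof -
    have cancel: "(\<exists>k\<in>carrier M. a \<otimes>\<^bsub>M\<^esub> b' \<otimes>\<^bsub>M\<^esub> k = a' \<otimes>\<^bsub>M\<^esub> b \<otimes>\<^bsub>M\<^esub> k) \<longleftrightarrow> D (a, b) = D (a', b')"
      if ab: "a \<in> carrier M" "b \<in> carrier M" "a' \<in> carrier M" "b' \<in> carrier M" for a b a' b'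
    proof
      assume "\<exists>k\<in>carrier M. a \<otimes>\<^bsub>M\<^esub> b' \<otimes>\<^bsub>M\<^esub> k = a' \<otimes>\<^bsub>M\<^esub> b \<otimes>\<^bsub>M\<^esub> k"
      then obtain c where c: "c \<in> carrier M" and eq: "a \<otimes>\<^bsub>M\<^esub> b' \<otimes>\<^bsub>M\<^esub> c = a' \<otimes>\<^bsub>M\<^esub> b \<otimes>\<^bsub>M\<^esub> c" by blast
      have "\<phi> a k + \<phi> b' k = \<phi> a' k + \<phi> b k" if "k < N" for k
        using arg_cong[OF eq, of "\<lambda>z. \<phi> z k"] mult[OF _ _ that] closed ab c by simp
      then show "D (a, b) = D (a', b')" unfolding D_eq by blast
    next
      assume eq: "D (a, b) = D (a', b')"
      have "a \<otimes>\<^bsub>M\<^esub> b' \<otimes>\<^bsub>M\<^esub> a = a' \<otimes>\<^bsub>M\<^esub> b \<otimes>\<^bsub>M\<^esub> a"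
        using eq ab closed unfolding D_eq by (intro inj) (simp_all add: mult)
      then show "\<exists>k\<in>carrier M. a \<otimes>\<^bsub>M\<^esub> b' \<otimes>\<^bsub>M\<^esub> k = a' \<otimes>\<^bsub>M\<^esub> b \<otimes>\<^bsub>M\<^esub> k" using ab(1) by blast
    qed
    have "((a, b), (a', b')) \<in> grothendieck_rel M \<longleftrightarrow> ((a, b), (a', b')) \<in> fibre_rel ?C D" for a b a' b'
      unfolding grothendieck_rel_def fibre_rel_def mem_Collect_eq prod.case mem_Times_iff fst_conv snd_conv
      using cancel[of a b a' b'] by blast
    then show ?thesis by (simp only: set_eq_iff split_paired_All simp_thms)
  qed
  let ?c = "\<lambda>q. fibre_rel ?C D `` {q}"
  have carrier: "carrier ?G = ?c ` ?C"
    unfolding grothendieck_group_def rel by (simp add: quotient_fibre_rel)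
  have mult_class: "?c (a, b) \<otimes>\<^bsub>?G\<^esub> ?c (a', b') = ?c (a \<otimes>\<^bsub>M\<^esub> a', b \<otimes>\<^bsub>M\<^esub> b')"
    if ab: "a \<in> carrier M" "b \<in> carrier M" "a' \<in> carrier M" "b' \<in> carrier M" for a b a' b'
  proof -
    have const: "?c (a1 \<otimes>\<^bsub>M\<^esub> a2, b1 \<otimes>\<^bsub>M\<^esub> b2) = ?c (a \<otimes>\<^bsub>M\<^esub> a', b \<otimes>\<^bsub>M\<^esub> b')"
      if "(a1, b1) \<in> ?c (a, b)" "(a2, b2) \<in> ?c (a', b')" for a1 b1 a2 b2
    proof (subst fibre_class_eq_iff)
      have m: "a1 \<in> carrier M" "b1 \<in> carrier M" "a2 \<in> carrier M" "b2 \<in> carrier M"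
        and e: "D (a1, b1) = D (a, b)" "D (a2, b2) = D (a', b')"
        using that ab by (auto simp: fibre_rel_def)
      show "(a1 \<otimes>\<^bsub>M\<^esub> a2, b1 \<otimes>\<^bsub>M\<^esub> b2) \<in> ?C" "(a \<otimes>\<^bsub>M\<^esub> a', b \<otimes>\<^bsub>M\<^esub> b') \<in> ?C"
        using m ab closed by auto
      show "D (a1 \<otimes>\<^bsub>M\<^esub> a2, b1 \<otimes>\<^bsub>M\<^esub> b2) = D (a \<otimes>\<^bsub>M\<^esub> a', b \<otimes>\<^bsub>M\<^esub> b')"
        unfolding D_eq
      proof (intro allI impI)
        fix k assume k: "k < N"
        have "\<phi> a1 k + \<phi> b k = \<phi> a k + \<phi> b1 k" "\<phi> a2 k + \<phi> b' k = \<phi> a' k + \<phi> b2 k"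
          using e k unfolding D_eq by auto
        then show "\<phi> (a1 \<otimes>\<^bsub>M\<^esub> a2) k + \<phi> (b \<otimes>\<^bsub>M\<^esub> b') k = \<phi> (a \<otimes>\<^bsub>M\<^esub> a') k + \<phi> (b1 \<otimes>\<^bsub>M\<^esub> b2) k"
          using m ab k by (simp add: mult)
      qed
    qed
    have "?c (a, b) \<otimes>\<^bsub>?G\<^esub> ?c (a', b') = (\<Union>q\<in>?c (a, b). \<Union>q'\<in>?c (a', b').
        ?c (fst q \<otimes>\<^bsub>M\<^esub> fst q', snd q \<otimes>\<^bsub>M\<^esub> snd q'))"
      unfolding grothendieck_group_def rel by (simp add: split_beta)
    also have "\<dots> = ?c (a \<otimes>\<^bsub>M\<^esub> a', b \<otimes>\<^bsub>M\<^esub> b')"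
    proof (rule UN2_constant_on)
      show "(a, b) \<in> ?c (a, b)" "(a', b') \<in> ?c (a', b')"
        using ab by (simp_all add: fibre_rel_def)
      fix q q' assume "q \<in> ?c (a, b)" "q' \<in> ?c (a', b')"
      then show "?c (fst q \<otimes>\<^bsub>M\<^esub> fst q', snd q \<otimes>\<^bsub>M\<^esub> snd q') = ?c (a \<otimes>\<^bsub>M\<^esub> a', b \<otimes>\<^bsub>M\<^esub> b')"
        by (intro const) simp_all
    qed
    finally show ?thesis .
  qed
  define h where "h = (\<lambda>s. D (SOME q. q \<in> s))"
  have h: "h (?c q) = D q" if "q \<in> ?C" for q
    unfolding h_def by (rule fibre_class_some[OF that])
  have D_mem: "D q \<in> carrier ?P" for q
    unfolding D_def by (auto split: prod.split)
  have "h \<in> hom ?G ?P"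
  proof (rule homI)
    fix s assume "s \<in> carrier ?G"
    then show "h s \<in> carrier ?P" unfolding h_def by (intro D_mem)
  next
    fix s t assume "s \<in> carrier ?G" "t \<in> carrier ?G"
    then obtain a b a' b' where ab: "a \<in> carrier M" "b \<in> carrier M" "a' \<in> carrier M" "b' \<in> carrier M"
      and st: "s = ?c (a, b)" "t = ?c (a', b')" unfolding carrier by blast
    have "h (s \<otimes>\<^bsub>?G\<^esub> t) = D (a \<otimes>\<^bsub>M\<^esub> a', b \<otimes>\<^bsub>M\<^esub> b')"
      unfolding st mult_class[OF ab] using ab closed by (intro h) auto
    also have "\<dots> = D (a, b) \<otimes>\<^bsub>?P\<^esub> D (a', b')"
      unfolding D_def mult_product_group prod.case
      by (intro restrict_ext) (use ab in \<open>simp add: mult\<close>)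
    also have "\<dots> = h s \<otimes>\<^bsub>?P\<^esub> h t" unfolding st using ab h by simp
    finally show "h (s \<otimes>\<^bsub>?G\<^esub> t) = h s \<otimes>\<^bsub>?P\<^esub> h t" .
  qed
  moreover have "inj_on h (carrier ?G)"
  proof (rule inj_onI)
    fix s t assume st: "s \<in> carrier ?G" "t \<in> carrier ?G" "h s = h t"
    then obtain p q where pq: "p \<in> ?C" "q \<in> ?C" "s = ?c p" "t = ?c q" unfolding carrier by blast
    then have "D p = D q" using st(3) h by simp
    then show "s = t" unfolding pq(3,4) using fibre_class_eq_iff[OF pq(1,2)] by blast
  qed
  moreover have "h ` carrier ?G = carrier ?P"
  proof
    show "h ` carrier ?G \<subseteq> carrier ?P" unfolding h_def using D_mem by blast
    show "carrier ?P \<subseteq> h ` carrier ?G"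
    proof
      fix g assume g: "g \<in> carrier ?P"
      obtain a where a: "a \<in> carrier M" "\<forall>k<N. \<phi> a k = nat (g k)" using surj[of "\<lambda>k. nat (g k)"] ..
      obtain b where b: "b \<in> carrier M" "\<forall>k<N. \<phi> b k = nat (- g k)" using surj[of "\<lambda>k. nat (- g k)"] ..
      have "D (a, b) = g"
      proof
        fix k show "D (a, b) k = g k"
          using a(2) b(2) g by (cases "k < N") (auto simp: D_def PiE_def extensional_def)
      qed
      then have "h (?c (a, b)) = g" using a(1) b(1) h by simp
      then show "g \<in> h ` carrier ?G" unfolding carrier using a(1) b(1) by blast
    qed
  qed
  ultimately have "h \<in> iso ?G ?P" unfolding iso_iff by blast
  then show "?G \<cong> ?P" by (rule is_isoI)
  fix s t assume "s \<in> carrier ?G" "t \<in> carrier ?G"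
  then obtain a b a' b' where ab: "a \<in> carrier M" "b \<in> carrier M" "a' \<in> carrier M" "b' \<in> carrier M"
    and st: "s = ?c (a, b)" "t = ?c (a', b')" unfolding carrier by blast
  show "s \<otimes>\<^bsub>?G\<^esub> t \<in> carrier ?G"
    unfolding st mult_class[OF ab] carrier using ab closed by blast
qed

lemma iso_via_common_target:
  assumes "G \<cong> P" "G' \<cong> P"
    and closed: "\<And>s t. s \<in> carrier G' \<Longrightarrow> t \<in> carrier G' \<Longrightarrow> s \<otimes>\<^bsub>G'\<^esub> t \<in> carrier G'"
  shows "G \<cong> G'"
proof -
  obtain h where h: "h \<in> hom G' P" "bij_betw h (carrier G') (carrier P)"
    using assms(2) unfolding is_iso_def iso_def by blast
  let ?k = "inv_into (carrier G') h"
  have bij: "bij_betw ?k (carrier P) (carrier G')" by (rule bij_betw_inv_into[OF h(2)])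
  have "?k \<in> hom P G'"
  proof (rule homI)
    fix p q assume pq: "p \<in> carrier P" "q \<in> carrier P"
    have k: "?k p \<in> carrier G'" "?k q \<in> carrier G'" using bij pq bij_betwE by blast+
    have "h (?k p \<otimes>\<^bsub>G'\<^esub> ?k q) = p \<otimes>\<^bsub>P\<^esub> q"
      using hom_mult[OF h(1) k] bij_betw_inv_into_right[OF h(2)] pq by simp
    then show "?k (p \<otimes>\<^bsub>P\<^esub> q) = ?k p \<otimes>\<^bsub>G'\<^esub> ?k q"
      using bij_betw_inv_into_left[OF h(2) closed[OF k]] by simp
  qed (use bij bij_betwE in blast)
  then have "P \<cong> G'" using bij unfolding is_iso_def iso_def by blast
  with assms(1) show ?thesis by (rule iso_trans)
qed


section \<open>The semigroup of components\<close>

text \<open>The locale is used twice, for \<open>R\<close> itself and for \<open>block_rel Ks\<close>; in the second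
  case \<open>E\<close> and \<open>A\<close> agree.  Components have to be nonempty for \<open>lim_idx_surj\<close>.\<close>

locale block_system =
  fixes X :: "'i set" and R :: "'i rel" and Ks :: "'i set set"
  assumes pattern: "block_pattern X R Ks" and nonempty: "{} \<notin> Ks"
begin

abbreviation E where "E \<equiv> graph_operator_system X R"
abbreviation A where "A \<equiv> graph_operator_system X (block_rel Ks)"
abbreviation H where "H \<equiv> Hinv X E A"
abbreviation cls where "cls m x \<equiv> path_component_set (H m) x"

definition idx :: "nat \<Rightarrow> (nat \<times> 'i) cmatrix \<Rightarrow> 'i set \<Rightarrow> nat" where
  "idx m x K = neg_index ({1..m} \<times> K) x"

lemmas X = block_patternD[OF pattern]
lemmas H_eq = Hinv_eq_herm_inv[OF pattern]

lemma path_iff: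
  assumes "x \<in> H m" "y \<in> H m"
  shows "path_component (H m) x y \<longleftrightarrow> (\<forall>K\<in>Ks. idx m x K = idx m y K)"
  using path_component_herm_inv_iff[OF block_pattern_amp[OF pattern, of m], of x y] assms
  unfolding H_eq idx_def by simp

lemma cls_self: "x \<in> H m \<Longrightarrow> x \<in> cls m x"
  by (simp add: path_component_refl)

lemma cls_eq_iff:
  assumes "x \<in> H m" "y \<in> H m"
  shows "cls m x = cls m y \<longleftrightarrow> (\<forall>K\<in>Ks. idx m x K = idx m y K)"
proof
  assume eq: "cls m x = cls m y"
  have "y \<in> cls m x" unfolding eq by (rule cls_self[OF assms(2)])
  then have "path_component (H m) x y" by (simp only: mem_Collect_eq)
  then show "\<forall>K\<in>Ks. idx m x K = idx m y K" using path_iff[OF assms] by simp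
next
  assume "\<forall>K\<in>Ks. idx m x K = idx m y K"
  then have "path_component (H m) x y" using path_iff[OF assms] by simp
  then show "cls m x = cls m y" by (simp add: path_component_eq)
qed

lemma cls_mem:
  assumes "z \<in> cls m x"
  shows "z \<in> H m" "cls m z = cls m x"
  using assms path_component_mem(2)[of "H m" x z] path_component_eq[of z "H m" x]
  by (simp_all only: mem_Collect_eq)

lemma V0_iff: "c \<in> V0 X E A m \<longleftrightarrow> (\<exists>x\<in>H m. c = cls m x)"
  unfolding V0_def by blast

lemma sign_matrix_in_H: "sign_matrix ({1..m} \<times> X) T \<in> H m"
  unfolding H_eq
  using block_patternD(1,3)[OF block_pattern_amp[OF pattern, of m]] by (intro sign_matrix_mem) auto

lemma path_to_sign:
  assumes "x \<in> H m"
  shows "\<exists>T\<subseteq>{1..m} \<times> X. path_component (H m) x (sign_matrix ({1..m} \<times> X) T)"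
  using path_to_sign_matrix[OF block_patternD(1,2,3)[OF block_pattern_amp[OF pattern, of m]], of x] assms
  unfolding H_eq by simp

lemma idx_sign_matrix:
  assumes "K \<in> Ks"
  shows "idx m (sign_matrix ({1..m} \<times> X) T) K = card (T \<inter> {1..m} \<times> K)"
proof -
  have "{1..m} \<times> K \<subseteq> {1..m} \<times> X" "finite ({1..m} \<times> X)" using assms X(1,5) by auto
  then show ?thesis unfolding idx_def by (metis neg_index_sign_matrix finite_subset)
qed

lemma mone_eq_sign_matrix: "mone ({1..m} \<times> X) = sign_matrix ({1..m} \<times> X) {}"
  unfolding mone_def sign_matrix_def by auto

lemma mone_in_H: "mone ({1..m} \<times> X) \<in> H m"
  unfolding mone_eq_sign_matrix by (rule sign_matrix_in_H)

lemma idx_mone: "K \<in> Ks \<Longrightarrow> idx m (mone ({1..m} \<times> X)) K = 0"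
  unfolding mone_eq_sign_matrix by (simp add: idx_sign_matrix del: One_nat_def)

lemma dsum_in_H: "x \<in> H m \<Longrightarrow> x' \<in> H m' \<Longrightarrow> dsum m x x' \<in> H (m + m')"
  unfolding H_eq by (rule dsum_herm_inv[OF X(1,2)])

text \<open>By \<open>dsum_path\<close> both summands may be replaced by sign matrices, where the minus signs can be counted.\<close>

lemma idx_dsum:
  assumes "x \<in> H m" "x' \<in> H m'" "K \<in> Ks"
  shows "idx (m + m') (dsum m x x') K = idx m x K + idx m' x' K"
proof -
  obtain T where T: "T \<subseteq> {1..m} \<times> X" "path_component (H m) x (sign_matrix ({1..m} \<times> X) T)"
    using path_to_sign[OF assms(1)] by blast
  obtain T' where T': "T' \<subseteq> {1..m'} \<times> X" "path_component (H m') x' (sign_matrix ({1..m'} \<times> X) T')"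
    using path_to_sign[OF assms(2)] by blast
  let ?s = "\<lambda>p :: nat \<times> 'i. (m + fst p, snd p)"
  have "path_component (H (m + m')) (dsum m x x') (sign_matrix ({1..m + m'} \<times> X) (T \<union> ?s ` T'))"
    using dsum_path[OF X(1,2)] T(2) T'(2) unfolding H_eq dsum_sign_matrix[OF T(1) T'(1), symmetric] by blast
  then have "idx (m + m') (dsum m x x') K = card ((T \<union> ?s ` T') \<inter> {1..m + m'} \<times> K)"
    using path_iff[OF dsum_in_H[OF assms(1,2)] sign_matrix_in_H] idx_sign_matrix[OF assms(3)] assms(3) by simp
  also have "(T \<union> ?s ` T') \<inter> {1..m + m'} \<times> K = T \<inter> {1..m} \<times> K \<union> ?s ` (T' \<inter> {1..m'} \<times> K)"
  proof -
    have "T \<inter> {1..m + m'} \<times> K = T \<inter> {1..m} \<times> K" using T(1) by auto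
    moreover have "?s ` T' \<inter> {1..m + m'} \<times> K = ?s ` (T' \<inter> {1..m'} \<times> K)" using T'(1) by auto
    ultimately show ?thesis by (simp only: Int_Un_distrib2)
  qed
  also have "card \<dots> = card (T \<inter> {1..m} \<times> K) + card (?s ` (T' \<inter> {1..m'} \<times> K))"
  proof (rule card_Un_disjoint)
    have "finite ({1..m} \<times> X)" "finite ({1..m'} \<times> X)" using X(1) by auto
    then show "finite (T \<inter> {1..m} \<times> K)" "finite (?s ` (T' \<inter> {1..m'} \<times> K))"
      using T(1) T'(1) finite_subset by (blast, blast)
    show "T \<inter> {1..m} \<times> K \<inter> ?s ` (T' \<inter> {1..m'} \<times> K) = {}" by auto
  qed
  also have "card (?s ` (T' \<inter> {1..m'} \<times> K)) = card (T' \<inter> {1..m'} \<times> K)"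
    by (intro card_image) (auto simp: inj_on_def prod_eq_iff)
  also have "card (T \<inter> {1..m} \<times> K) = idx m x K"
    using path_iff[OF assms(1) sign_matrix_in_H] T(2) idx_sign_matrix[OF assms(3)] assms(3) by simp
  also have "card (T' \<inter> {1..m'} \<times> K) = idx m' x' K"
    using path_iff[OF assms(2) sign_matrix_in_H] T'(2) idx_sign_matrix[OF assms(3)] assms(3) by simp
  finally show ?thesis .
qed

text \<open>For \<open>m' = m\<close> the second summand is the empty matrix, which belongs to \<open>H 0\<close>; so no case distinction
  is needed.\<close>

lemma dsum_mone_in_H: "m \<le> m' \<Longrightarrow> x \<in> H m \<Longrightarrow> dsum m x (mone ({1..m' - m} \<times> X)) \<in> H m'"
  using dsum_in_H[OF _ mone_in_H, of x m "m' - m"] by simp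

lemma idx_dsum_mone:
  "m \<le> m' \<Longrightarrow> x \<in> H m \<Longrightarrow> K \<in> Ks \<Longrightarrow> idx m' (dsum m x (mone ({1..m' - m} \<times> X))) K = idx m x K"
  using idx_dsum[OF _ mone_in_H, of x m K "m' - m"] idx_mone by simp

lemma connect_cls:
  assumes "m \<le> m'" "x \<in> H m"
  shows "V0_connect X E A m m' (cls m x) = cls m' (dsum m x (mone ({1..m' - m} \<times> X)))"
  unfolding V0_connect_def
proof (rule UN_constant_on[OF cls_self[OF assms(2)]])
  fix z assume z: "z \<in> cls m x"
  then have "\<forall>K\<in>Ks. idx m z K = idx m x K"
    using cls_mem[OF z] cls_eq_iff[OF _ assms(2)] by blast
  then show "cls m' (dsum m z (mone ({1..m' - m} \<times> X))) = cls m' (dsum m x (mone ({1..m' - m} \<times> X)))"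
    using cls_mem(1)[OF z] assms
    by (subst cls_eq_iff) (simp_all add: dsum_mone_in_H idx_dsum_mone del: One_nat_def)
qed

lemma dsum_cls:
  assumes "x \<in> H m" "x' \<in> H m'"
  shows "V0_dsum X E A m m' (cls m x) (cls m' x') = cls (m + m') (dsum m x x')"
  unfolding V0_dsum_def
proof (rule UN2_constant_on[OF cls_self[OF assms(1)] cls_self[OF assms(2)]])
  fix z z' assume z: "z \<in> cls m x" "z' \<in> cls m' x'"
  then have "\<forall>K\<in>Ks. idx m z K = idx m x K" "\<forall>K\<in>Ks. idx m' z' K = idx m' x' K"
    using cls_mem[OF z(1)] cls_mem[OF z(2)] cls_eq_iff[OF _ assms(1)] cls_eq_iff[OF _ assms(2)] by blast+
  then show "cls (m + m') (dsum m z z') = cls (m + m') (dsum m x x')"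
    using cls_mem(1)[OF z(1)] cls_mem(1)[OF z(2)] assms
    by (subst cls_eq_iff) (simp_all add: dsum_in_H idx_dsum)
qed

abbreviation pairs where "pairs \<equiv> V0_pairs X E A"

lemma pairs_iff: "p \<in> pairs \<longleftrightarrow> (\<exists>m x. 1 \<le> m \<and> x \<in> H m \<and> p = (m, cls m x))"
  unfolding V0_pairs_def by (cases p) (auto simp: V0_iff simp del: One_nat_def)

definition pair_idx :: "nat \<times> (nat \<times> 'i) cmatrix set \<Rightarrow> 'i set \<Rightarrow> nat" where
  "pair_idx p = (\<lambda>K\<in>Ks. idx (fst p) (SOME x. x \<in> snd p) K)"

lemma pair_idx_cls:
  assumes "x \<in> H m"
  shows "pair_idx (m, cls m x) = restrict (idx m x) Ks"
proof -
  have "(SOME z. z \<in> cls m x) \<in> cls m x" by (rule someI[where x = x]) (rule cls_self[OF assms])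
  then have "\<forall>K\<in>Ks. idx m (SOME z. z \<in> cls m x) K = idx m x K"
    using cls_mem cls_eq_iff[OF _ assms] by blast
  then show ?thesis unfolding pair_idx_def fst_conv snd_conv by (intro restrict_ext) blast
qed

lemma restrict_eq_iff: "restrict f Ks = restrict g Ks \<longleftrightarrow> (\<forall>K\<in>Ks. f K = g K)"
  by (metis restrict_apply' restrict_ext)

text \<open>The connecting maps preserve the invariants, and at a common stage the invariants separate the
  classes.\<close>

lemma lim_rel_eq: "V0_lim_rel X E A = fibre_rel pairs pair_idx"
proof -
  have stage: "(\<exists>k\<ge>max m m'. V0_connect X E A m k (cls m x) = V0_connect X E A m' k (cls m' x')) \<longleftrightarrow>
      pair_idx (m, cls m x) = pair_idx (m', cls m' x')" if x: "x \<in> H m" "x' \<in> H m'" for m m' x x'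
  proof -
    have "V0_connect X E A m k (cls m x) = V0_connect X E A m' k (cls m' x') \<longleftrightarrow>
        pair_idx (m, cls m x) = pair_idx (m', cls m' x')" if "k \<ge> max m m'" for k
    proof -
      have k: "m \<le> k" "m' \<le> k" using that by auto
      show ?thesis
        unfolding connect_cls[OF k(1) x(1)] connect_cls[OF k(2) x(2)] pair_idx_cls[OF x(1)] pair_idx_cls[OF x(2)]
          restrict_eq_iff cls_eq_iff[OF dsum_mone_in_H[OF k(1) x(1)] dsum_mone_in_H[OF k(2) x(2)]]
        by (simp add: idx_dsum_mone k x del: One_nat_def)
    qed
    then show ?thesis by (metis order_refl)
  qed
  have "(p, q) \<in> V0_lim_rel X E A \<longleftrightarrow> (p, q) \<in> fibre_rel pairs pair_idx" for p q
  proof (cases "p \<in> pairs \<and> q \<in> pairs")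
    case True
    then obtain m x m' x' where p: "x \<in> H m" "p = (m, cls m x)" and q: "x' \<in> H m'" "q = (m', cls m' x')"
      unfolding pairs_iff by auto
    have "(p, q) \<in> V0_lim_rel X E A \<longleftrightarrow>
        (\<exists>k\<ge>max m m'. V0_connect X E A m k (cls m x) = V0_connect X E A m' k (cls m' x'))"
      using True unfolding V0_lim_rel_def p(2) q(2) by simp
    also have "\<dots> \<longleftrightarrow> (p, q) \<in> fibre_rel pairs pair_idx"
      unfolding stage[OF p(1) q(1)] using True unfolding fibre_rel_def p(2) q(2) by simp
    finally show ?thesis .
  next
    case False
    then show ?thesis unfolding V0_lim_rel_def fibre_rel_def by (cases p; cases q) auto
  qed
  then show ?thesis by (simp only: set_eq_iff split_paired_All simp_thms)
qed

abbreviation lim_cls where "lim_cls p \<equiv> fibre_rel pairs pair_idx `` {p}"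

lemma carrier_lim: "carrier (V0_lim X E A) = lim_cls ` pairs"
  unfolding V0_lim_def lim_rel_eq by (simp add: quotient_fibre_rel)

lemma cls_in_pairs: "1 \<le> m \<Longrightarrow> x \<in> H m \<Longrightarrow> (m, cls m x) \<in> pairs"
  unfolding pairs_iff by blast

lemma mult_lim:
  assumes m: "1 \<le> m" "1 \<le> m'" and x: "x \<in> H m" "x' \<in> H m'"
  shows "lim_cls (m, cls m x) \<otimes>\<^bsub>V0_lim X E A\<^esub> lim_cls (m', cls m' x') =
    lim_cls (m + m', cls (m + m') (dsum m x x'))"
proof -
  have "lim_cls (m, cls m x) \<otimes>\<^bsub>V0_lim X E A\<^esub> lim_cls (m', cls m' x') =
      (\<Union>p\<in>lim_cls (m, cls m x). \<Union>q\<in>lim_cls (m', cls m' x').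
        lim_cls (fst p + fst q, V0_dsum X E A (fst p) (fst q) (snd p) (snd q)))"
    unfolding V0_lim_def lim_rel_eq by (simp add: split_beta)
  also have "\<dots> = lim_cls (m + m', cls (m + m') (dsum m x x'))"
  proof (rule UN2_constant_on)
    show "(m, cls m x) \<in> lim_cls (m, cls m x)" "(m', cls m' x') \<in> lim_cls (m', cls m' x')"
      by (intro fibre_class_self cls_in_pairs m x)+
    fix p q assume "p \<in> lim_cls (m, cls m x)" "q \<in> lim_cls (m', cls m' x')"
    then have pq: "p \<in> pairs" "q \<in> pairs" "pair_idx p = pair_idx (m, cls m x)" "pair_idx q = pair_idx (m', cls m' x')"
      unfolding fibre_rel_def by auto
    obtain k y where y: "1 \<le> k" "y \<in> H k" "p = (k, cls k y)" using pq(1) unfolding pairs_iff by blast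
    obtain k' y' where y': "1 \<le> k'" "y' \<in> H k'" "q = (k', cls k' y')" using pq(2) unfolding pairs_iff by blast
    have e: "\<And>K. K \<in> Ks \<Longrightarrow> idx k y K = idx m x K" "\<And>K. K \<in> Ks \<Longrightarrow> idx k' y' K = idx m' x' K"
      using pq(3,4) unfolding y(3) y'(3) pair_idx_cls[OF y(2)] pair_idx_cls[OF y'(2)]
        pair_idx_cls[OF x(1)] pair_idx_cls[OF x(2)] restrict_eq_iff by auto
    have "lim_cls (k + k', cls (k + k') (dsum k y y')) = lim_cls (m + m', cls (m + m') (dsum m x x'))"
    proof (subst fibre_class_eq_iff)
      show "(k + k', cls (k + k') (dsum k y y')) \<in> pairs"
        by (intro cls_in_pairs dsum_in_H y y') (use y in simp)
      show "(m + m', cls (m + m') (dsum m x x')) \<in> pairs"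
        by (intro cls_in_pairs dsum_in_H x) (use m in simp)
      show "pair_idx (k + k', cls (k + k') (dsum k y y')) = pair_idx (m + m', cls (m + m') (dsum m x x'))"
        unfolding pair_idx_cls[OF dsum_in_H[OF y(2) y'(2)]] pair_idx_cls[OF dsum_in_H[OF x]] restrict_eq_iff
        using e by (simp add: idx_dsum y(2) y'(2) x)
    qed
    then show "lim_cls (fst p + fst q, V0_dsum X E A (fst p) (fst q) (snd p) (snd q)) =
        lim_cls (m + m', cls (m + m') (dsum m x x'))"
      unfolding y(3) y'(3) fst_conv snd_conv dsum_cls[OF y(2) y'(2)] .
  qed
  finally show ?thesis .
qed

definition lim_idx :: "(nat \<times> (nat \<times> 'i) cmatrix set) set \<Rightarrow> 'i set \<Rightarrow> nat" where
  "lim_idx s = pair_idx (SOME p. p \<in> s)"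

lemma lim_idx_cls: "1 \<le> m \<Longrightarrow> x \<in> H m \<Longrightarrow> lim_idx (lim_cls (m, cls m x)) = restrict (idx m x) Ks"
  unfolding lim_idx_def fibre_class_some[OF cls_in_pairs] by (rule pair_idx_cls)

lemma carrier_lim_cases:
  assumes "s \<in> carrier (V0_lim X E A)"
  obtains m x where "1 \<le> m" "x \<in> H m" "s = lim_cls (m, cls m x)"
  using assms unfolding carrier_lim using pairs_iff by auto

text \<open>Put all minus signs for \<open>K\<close> at a single vertex of \<open>K\<close>, in different copies of \<open>X\<close>.\<close>

lemma lim_idx_surj: "\<exists>s\<in>carrier (V0_lim X E A). \<forall>K\<in>Ks. lim_idx s K = f K"
proof -
  have fin: "finite Ks" using X(1,5) by (metis finite_UnionD)
  define pt where "pt = (\<lambda>K :: 'i set. SOME i. i \<in> K)"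
  have pt: "pt K \<in> K" if "K \<in> Ks" for K
    using that nonempty unfolding pt_def by (metis ex_in_conv someI_ex)
  \<comment> \<open>Large enough for every \<open>f K\<close>; the summand \<open>1\<close> ensures \<open>1 \<le> m\<close> when all of them vanish.\<close>
  define m where "m = 1 + (\<Sum>K\<in>Ks. f K)"
  define T where "T = {(a, i). \<exists>K\<in>Ks. i = pt K \<and> a \<in> {1..f K}}"
  have le: "f K \<le> m" if "K \<in> Ks" for K
    using member_le_sum[of K Ks f] fin that unfolding m_def by simp
  have "T \<inter> {1..m} \<times> K = {1..f K} \<times> {pt K}" if K: "K \<in> Ks" for K
  proof
    show "T \<inter> {1..m} \<times> K \<subseteq> {1..f K} \<times> {pt K}"
    proof
      fix p assume "p \<in> T \<inter> {1..m} \<times> K"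
      then obtain a K' where p: "p = (a, pt K')" "K' \<in> Ks" "a \<in> {1..f K'}" "pt K' \<in> K" unfolding T_def by auto
      then have "K' = K" using block_pattern_disjoint[OF pattern p(2) K pt[OF p(2)]] by blast
      then show "p \<in> {1..f K} \<times> {pt K}" using p by simp
    qed
    show "{1..f K} \<times> {pt K} \<subseteq> T \<inter> {1..m} \<times> K"
      using K pt[OF K] le[OF K] unfolding T_def by auto
  qed
  then have "\<forall>K\<in>Ks. lim_idx (lim_cls (m, cls m (sign_matrix ({1..m} \<times> X) T))) K = f K"
    by (subst lim_idx_cls)
      (simp_all add: sign_matrix_in_H idx_sign_matrix m_def card_cartesian_product del: One_nat_def)
  moreover have "lim_cls (m, cls m (sign_matrix ({1..m} \<times> X) T)) \<in> carrier (V0_lim X E A)"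
    unfolding carrier_lim by (intro imageI cls_in_pairs sign_matrix_in_H) (simp add: m_def)
  ultimately show ?thesis by blast
qed

theorem K0_iso_and_closed:
  shows "K0 X E A \<cong> product_group {..<card Ks} (\<lambda>_. integer_group)"
    and "\<And>s t. s \<in> carrier (K0 X E A) \<Longrightarrow> t \<in> carrier (K0 X E A) \<Longrightarrow> s \<otimes>\<^bsub>K0 X E A\<^esub> t \<in> carrier (K0 X E A)"
proof -
  let ?M = "V0_lim X E A"
  have "finite Ks" using X(1,5) by (metis finite_UnionD)
  then obtain e where e: "bij_betw e {..<card Ks} Ks"
    using ex_bij_betw_nat_finite[of Ks] by (auto simp: atLeast0LessThan)
  define \<phi> where "\<phi> = (\<lambda>s k. lim_idx s (e k))"
  have eK: "e k \<in> Ks" if "k < card Ks" for k using e that unfolding bij_betw_def by blast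
  have closed: "s \<otimes>\<^bsub>?M\<^esub> t \<in> carrier ?M" if st: "s \<in> carrier ?M" "t \<in> carrier ?M" for s t
  proof -
    obtain m x where x: "1 \<le> m" "x \<in> H m" "s = lim_cls (m, cls m x)" using carrier_lim_cases[OF st(1)] .
    obtain m' x' where x': "1 \<le> m'" "x' \<in> H m'" "t = lim_cls (m', cls m' x')" using carrier_lim_cases[OF st(2)] .
    show ?thesis
      unfolding x(3) x'(3) mult_lim[OF x(1) x'(1) x(2) x'(2)] carrier_lim
      by (intro imageI cls_in_pairs dsum_in_H x x') (use x in simp)
  qed
  have mult: "\<phi> (s \<otimes>\<^bsub>?M\<^esub> t) k = \<phi> s k + \<phi> t k"
    if st: "s \<in> carrier ?M" "t \<in> carrier ?M" and k: "k < card Ks" for s t k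
  proof -
    obtain m x where x: "1 \<le> m" "x \<in> H m" "s = lim_cls (m, cls m x)" using carrier_lim_cases[OF st(1)] .
    obtain m' x' where x': "1 \<le> m'" "x' \<in> H m'" "t = lim_cls (m', cls m' x')" using carrier_lim_cases[OF st(2)] .
    have "1 \<le> m + m'" using x by simp
    then show ?thesis
      unfolding x(3) x'(3) mult_lim[OF x(1) x'(1) x(2) x'(2)] \<phi>_def
      by (simp only: lim_idx_cls dsum_in_H x(1,2) x'(1,2) restrict_apply' eK[OF k] idx_dsum)
  qed
  have inj: "s = t" if st: "s \<in> carrier ?M" "t \<in> carrier ?M" and eq: "\<And>k. k < card Ks \<Longrightarrow> \<phi> s k = \<phi> t k" for s t
  proof -
    obtain m x where x: "1 \<le> m" "x \<in> H m" "s = lim_cls (m, cls m x)" using carrier_lim_cases[OF st(1)] .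
    obtain m' x' where x': "1 \<le> m'" "x' \<in> H m'" "t = lim_cls (m', cls m' x')" using carrier_lim_cases[OF st(2)] .
    have "idx m x K = idx m' x' K" if K: "K \<in> Ks" for K
    proof -
      obtain k where k: "k < card Ks" "K = e k" using e K unfolding bij_betw_def by blast
      show ?thesis
        using eq[OF k(1)] K unfolding \<phi>_def x(3) x'(3) k(2)[symmetric]
        by (simp only: lim_idx_cls x(1,2) x'(1,2) restrict_apply')
    qed
    then have "pair_idx (m, cls m x) = pair_idx (m', cls m' x')"
      unfolding pair_idx_cls[OF x(2)] pair_idx_cls[OF x'(2)] by (intro restrict_ext)
    then show ?thesis
      unfolding x(3) x'(3) using fibre_class_eq_iff[OF cls_in_pairs[OF x(1,2)] cls_in_pairs[OF x'(1,2)]] by blast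
  qed
  have surj: "\<exists>s\<in>carrier ?M. \<forall>k<card Ks. \<phi> s k = f k" for f
  proof -
    obtain s where s: "s \<in> carrier ?M" "\<forall>K\<in>Ks. lim_idx s K = f (inv_into {..<card Ks} e K)"
      using lim_idx_surj[of "\<lambda>K. f (inv_into {..<card Ks} e K)"] ..
    have "\<phi> s k = f k" if "k < card Ks" for k
      using s(2) eK[OF that] bij_betw_inv_into_left[OF e, of k] that unfolding \<phi>_def by simp
    then show ?thesis using s(1) by blast
  qed
  show "K0 X E A \<cong> product_group {..<card Ks} (\<lambda>_. integer_group)"
    unfolding K0_def by (rule grothendieck_group_of_counts(1)[of ?M "card Ks" \<phi>, OF closed mult inj surj])
  show "\<And>s t. s \<in> carrier (K0 X E A) \<Longrightarrow> t \<in> carrier (K0 X E A) \<Longrightarrow> s \<otimes>\<^bsub>K0 X E A\<^esub> t \<in> carrier (K0 X E A)"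
    unfolding K0_def by (rule grothendieck_group_of_counts(2)[of ?M "card Ks" \<phi>, OF closed mult inj surj])
qed

end


section \<open>Comparing the operator system with its envelope\<close>

context block_system
begin

lemma E_subset_A: "E \<subseteq> A"
  using block_pattern_subset_block_rel[OF pattern] unfolding graph_operator_system_def by blast

lemma H_subset: "H m \<subseteq> Hinv X A A m"
  using E_subset_A unfolding Hinv_def amp_def by blast

lemma full_system: "block_system X (block_rel Ks) Ks"
  using block_pattern_block_rel[OF pattern] nonempty by unfold_locales

lemma incl_cls:
  assumes "x \<in> H m"
  shows "V0_incl X A m (cls m x) = path_component_set (Hinv X A A m) x"
  unfolding V0_incl_def
proof (rule UN_constant_on[OF cls_self[OF assms]])
  fix z assume "z \<in> cls m x"
  then have "path_component (Hinv X A A m) x z"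
    using path_component_of_subset[OF H_subset] by blast
  then show "path_component_set (Hinv X A A m) z = path_component_set (Hinv X A A m) x"
    by (intro path_component_eq) (simp only: mem_Collect_eq)
qed

text \<open>Injective, because the classes on both sides are determined by the same invariants.  Surjective,
  because every class of the envelope contains a sign matrix, and this lies in \<open>E\<close>.\<close>

theorem V0_incl_bij: "bij_betw (V0_incl X A m) (V0 X E A m) (V0 X A A m)"
proof -
  interpret full: block_system X "block_rel Ks" Ks by (rule full_system)
  have "inj_on (V0_incl X A m) (V0 X E A m)"
  proof (rule inj_onI)
    fix c d assume cd: "c \<in> V0 X E A m" "d \<in> V0 X E A m" "V0_incl X A m c = V0_incl X A m d"
    obtain x where x: "x \<in> H m" "c = cls m x" using cd(1) unfolding V0_iff by blast
    obtain y where y: "y \<in> H m" "d = cls m y" using cd(2) unfolding V0_iff by blast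
    have "full.cls m x = full.cls m y" using cd(3) unfolding x(2) y(2) incl_cls[OF x(1)] incl_cls[OF y(1)] .
    then have "\<forall>K\<in>Ks. idx m x K = idx m y K"
      unfolding full.cls_eq_iff[OF subsetD[OF H_subset x(1)] subsetD[OF H_subset y(1)]] .
    then show "c = d" unfolding x(2) y(2) cls_eq_iff[OF x(1) y(1)] .
  qed
  moreover have "V0_incl X A m ` V0 X E A m = V0 X A A m"
  proof
    show "V0_incl X A m ` V0 X E A m \<subseteq> V0 X A A m"
    proof (rule image_subsetI)
      fix c assume "c \<in> V0 X E A m"
      then obtain x where x: "x \<in> H m" "c = cls m x" unfolding V0_iff by blast
      show "V0_incl X A m c \<in> V0 X A A m"
        unfolding x(2) incl_cls[OF x(1)] V0_def using x(1) H_subset by blast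
    qed
    show "V0 X A A m \<subseteq> V0_incl X A m ` V0 X E A m"
    proof
      fix c assume "c \<in> V0 X A A m"
      then obtain x where x: "x \<in> Hinv X A A m" "c = full.cls m x" unfolding V0_def by blast
      obtain T where "path_component (Hinv X A A m) x (sign_matrix ({1..m} \<times> X) T)"
        using full.path_to_sign[OF x(1)] by blast
      then have "full.cls m (sign_matrix ({1..m} \<times> X) T) = c"
        unfolding x(2) by (intro path_component_eq) (simp only: mem_Collect_eq)
      then have "c = V0_incl X A m (cls m (sign_matrix ({1..m} \<times> X) T))"
        unfolding incl_cls[OF sign_matrix_in_H] by (rule sym)
      then show "c \<in> V0_incl X A m ` V0 X E A m"
        unfolding V0_def using sign_matrix_in_H by blast
    qed
  qed
  ultimately show ?thesis unfolding bij_betw_def by blast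
qed

theorem V0_incl_connect:
  assumes "m \<le> m'" "c \<in> V0 X E A m"
  shows "V0_incl X A m' (V0_connect X E A m m' c) = V0_connect X A A m m' (V0_incl X A m c)"
proof -
  interpret full: block_system X "block_rel Ks" Ks by (rule full_system)
  obtain x where x: "x \<in> H m" "c = cls m x" using assms(2) unfolding V0_iff by blast
  have xA: "x \<in> Hinv X A A m" using x(1) H_subset by blast
  show ?thesis
    unfolding x(2) connect_cls[OF assms(1) x(1)] incl_cls[OF x(1)] incl_cls[OF dsum_mone_in_H[OF assms(1) x(1)]]
      full.connect_cls[OF assms(1) xA] ..
qed

theorem K0_envelope: "K0 X E A \<cong> K0 X A A" "K0 X A A \<cong> product_group {..<card Ks} (\<lambda>_. integer_group)"
proof -
  interpret full: block_system X "block_rel Ks" Ks by (rule full_system)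
  show "K0 X A A \<cong> product_group {..<card Ks} (\<lambda>_. integer_group)" by (rule full.K0_iso_and_closed(1))
  show "K0 X E A \<cong> K0 X A A"
    by (rule iso_via_common_target[OF K0_iso_and_closed(1) full.K0_iso_and_closed])
qed

end

section \<open>The block algebra is the C*-envelope\<close>

definition matrix_unit :: "'i \<Rightarrow> 'i \<Rightarrow> 'i cmatrix" where
  "matrix_unit i j = (\<lambda>k l. if k = i \<and> l = j then 1 else 0)"

lemma mmul_matrix_unit_right:
  assumes "finite X" "i \<in> X"
  shows "mmul X x (matrix_unit i j) = (\<lambda>k l. if l = j then x k i else 0)"
proof (intro ext)
  fix k l
  have "mmul X x (matrix_unit i j) k l = (\<Sum>r\<in>X. if r = i then if l = j then x k i else 0 else 0)"
    unfolding mmul_def matrix_unit_def by (intro sum.cong) auto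
  then show "mmul X x (matrix_unit i j) k l = (if l = j then x k i else 0)"
    using assms by simp
qed

lemma mmul_matrix_unit_left:
  assumes "finite X" "j \<in> X"
  shows "mmul X (matrix_unit i j) x = (\<lambda>k l. if k = i then x j l else 0)"
proof (intro ext)
  fix k l
  have "mmul X (matrix_unit i j) x k l = (\<Sum>r\<in>X. if r = j then if k = i then x j l else 0 else 0)"
    unfolding mmul_def matrix_unit_def by (intro sum.cong) auto
  then show "mmul X (matrix_unit i j) x k l = (if k = i then x j l else 0)"
    using assms by simp
qed

lemma cstar_subalgebra_block:
  assumes "block_pattern X R Ks"
  shows "cstar_subalgebra X (graph_operator_system X (block_rel Ks))"
proof -
  let ?Q = "block_rel Ks"
  note Q = block_patternD[OF block_pattern_block_rel[OF assms]]
  have mem: "x \<in> graph_operator_system X ?Q \<longleftrightarrow> (\<forall>i j. (i, j) \<notin> ?Q \<longrightarrow> x i j = 0)" for x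
    by (rule graph_operator_system_iff[OF Q(2)])
  have trans: "(i, j) \<in> ?Q" if ik: "(i, k) \<in> ?Q" and kj: "(k, j) \<in> ?Q" for i j k
  proof -
    obtain K where K: "K \<in> Ks" "i \<in> K" "k \<in> K" using ik unfolding block_rel_def by auto
    have "j \<in> K" by (rule Q(7)[OF K(1) kj K(3)])
    then show ?thesis using K unfolding block_rel_def by auto
  qed
  have "closed {x. (i, j) \<notin> ?Q \<longrightarrow> x i j = (0 :: complex)}" for i j
  proof (cases "(i, j) \<in> ?Q")
    case False
    have "closed {x. x i j = (0 :: complex)}"
      by (intro closed_Collect_eq continuous_on_entry continuous_on_const)
    then show ?thesis using False by simp
  qed simp
  then have "closed {x. \<forall>i j. (i, j) \<notin> ?Q \<longrightarrow> x i j = (0 :: complex)}"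
    by (intro closed_Collect_all)
  also have "{x. \<forall>i j. (i, j) \<notin> ?Q \<longrightarrow> x i j = (0 :: complex)} = graph_operator_system X ?Q"
    by (intro equalityI subsetI) (simp_all only: mem mem_Collect_eq)
  finally have "closed (graph_operator_system X ?Q)" .
  moreover have "graph_operator_system X ?Q \<subseteq> mats X" unfolding graph_operator_system_def by blast
  moreover have "mmul X x y \<in> graph_operator_system X ?Q"
    if "x \<in> graph_operator_system X ?Q" "y \<in> graph_operator_system X ?Q" for x y
    unfolding mem
  proof (intro allI impI)
    fix i j assume no: "(i, j) \<notin> ?Q"
    show "mmul X x y i j = 0"
      unfolding mmul_def
    proof (rule sum.neutral, rule ballI)
      fix k
      have "x i k = 0 \<or> y k j = 0" using that trans[of i k j] no unfolding mem by blast
      then show "x i k * y k j = 0" by simp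
    qed
  qed
  moreover have "madj x \<in> graph_operator_system X ?Q" if "x \<in> graph_operator_system X ?Q" for x
    using that Q(4) unfolding mem madj_def sym_def by (metis complex_cnj_zero)
  moreover have "mzero \<in> graph_operator_system X ?Q" unfolding mem mzero_def by simp
  moreover have "madd x y \<in> graph_operator_system X ?Q"
    if "x \<in> graph_operator_system X ?Q" "y \<in> graph_operator_system X ?Q" for x y
    using that unfolding mem madd_def by simp
  moreover have "mscale c x \<in> graph_operator_system X ?Q" if "x \<in> graph_operator_system X ?Q" for c x
    using that unfolding mem mscale_def by simp
  ultimately show ?thesis unfolding cstar_subalgebra_def by simp
qed

text \<open>The matrix unit of a pair in one component is the product of the matrix units along a path
  of edges that joins the two vertices.\<close>

lemma cstar_generated_graph_operator_system:
  assumes "block_pattern X R Ks"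
  shows "cstar_generated X (graph_operator_system X R) = graph_operator_system X (block_rel Ks)"
proof
  let ?Q = "block_rel Ks"
  note R = block_patternD[OF assms] and Q = block_patternD[OF block_pattern_block_rel[OF assms]]
  have "graph_operator_system X R \<subseteq> graph_operator_system X ?Q"
    using block_pattern_subset_block_rel[OF assms] unfolding graph_operator_system_def by blast
  then show "cstar_generated X (graph_operator_system X R) \<subseteq> graph_operator_system X ?Q"
    using cstar_subalgebra_block[OF assms] unfolding cstar_generated_def by blast
  show "graph_operator_system X ?Q \<subseteq> cstar_generated X (graph_operator_system X R)"
    unfolding cstar_generated_def
  proof (rule Inter_greatest)
    fix B assume "B \<in> {B. cstar_subalgebra X B \<and> graph_operator_system X R \<subseteq> B}"
    then have B: "graph_operator_system X R \<subseteq> B" "mzero \<in> B"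
      "\<And>x y. x \<in> B \<Longrightarrow> y \<in> B \<Longrightarrow> madd x y \<in> B" "\<And>x y. x \<in> B \<Longrightarrow> y \<in> B \<Longrightarrow> mmul X x y \<in> B"
      "\<And>c x. x \<in> B \<Longrightarrow> mscale c x \<in> B"
      unfolding cstar_subalgebra_def by auto
    have edge: "matrix_unit i j \<in> B" if "(i, j) \<in> R" for i j
    proof -
      have "matrix_unit i j \<in> graph_operator_system X R"
        unfolding graph_operator_system_iff[OF R(2)] matrix_unit_def using that by auto
      then show ?thesis using B(1) by blast
    qed
    have chain: "matrix_unit i j \<in> B" if "(i, j) \<in> R\<^sup>*" "i \<in> X" for i j
      using that
    proof (induction rule: rtrancl_induct)
      case base
      then show ?case by (intro edge R(3))
    next
      case (step k j)
      then have "k \<in> X" using R(2) by blast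
      then have "mmul X (matrix_unit i k) (matrix_unit k j) = matrix_unit i j"
        unfolding mmul_matrix_unit_left[OF R(1) \<open>k \<in> X\<close>] by (intro ext) (simp add: matrix_unit_def)
      moreover have "mmul X (matrix_unit i k) (matrix_unit k j) \<in> B"
        using step edge by (intro B(4)) auto
      ultimately show ?case by simp
    qed
    have unit: "matrix_unit i j \<in> B" if "(i, j) \<in> ?Q" for i j
    proof -
      obtain K where K: "K \<in> Ks" "i \<in> K" "j \<in> K" using \<open>(i, j) \<in> ?Q\<close> unfolding block_rel_def by auto
      then have "i \<in> X" using R(5) by blast
      then show ?thesis by (intro chain R(6)[OF K])
    qed
    show "graph_operator_system X ?Q \<subseteq> B"
    proof
      fix x assume x: "x \<in> graph_operator_system X ?Q"
      have part: "(\<lambda>i j. if (i, j) \<in> F then x i j else 0) \<in> B" if "finite F" "F \<subseteq> ?Q" for F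
        using that
      proof (induction F rule: finite_induct)
        case empty
        then show ?case using B(2) by (simp add: mzero_def)
      next
        case (insert p F)
        obtain i j where p: "p = (i, j)" by fastforce
        have "(\<lambda>k l. if (k, l) \<in> insert p F then x k l else 0) =
            madd (\<lambda>k l. if (k, l) \<in> F then x k l else 0) (mscale (x i j) (matrix_unit i j))"
          using insert(2) unfolding p by (intro ext) (auto simp: madd_def mscale_def matrix_unit_def)
        moreover have "madd (\<lambda>k l. if (k, l) \<in> F then x k l else 0) (mscale (x i j) (matrix_unit i j)) \<in> B"
          using insert unfolding p by (intro B(3) B(5) unit) auto
        ultimately show ?case by simp
      qed
      have "finite ?Q" using Q(1,2) by (meson finite_SigmaI finite_subset)
      moreover have "(\<lambda>i j. if (i, j) \<in> ?Q then x i j else 0) = x"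
        using x unfolding graph_operator_system_iff[OF Q(2)] by (intro ext) simp
      ultimately show "x \<in> B" using part[of ?Q] by simp
    qed
  qed
qed

lemma mnorm_values_bounded:
  assumes "finite I"
  shows "bdd_above {L2_set (\<lambda>i. cmod (\<Sum>j\<in>I. x i j * v j)) I | v. L2_set (\<lambda>j. cmod (v j)) I \<le> 1}"
proof (rule bdd_aboveI, clarify)
  fix v assume v: "L2_set (\<lambda>j. cmod (v j)) I \<le> 1"
  have "L2_set (\<lambda>i. cmod (\<Sum>j\<in>I. x i j * v j)) I \<le> (\<Sum>i\<in>I. cmod (\<Sum>j\<in>I. x i j * v j))"
    by (rule L2_set_le_sum) simp
  also have "\<dots> \<le> (\<Sum>i\<in>I. \<Sum>j\<in>I. cmod (x i j))"
  proof (rule sum_mono, rule order_trans[OF norm_sum], rule sum_mono)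
    fix i j assume "j \<in> I"
    then have "cmod (v j) \<le> 1"
      using member_le_L2_set[OF assms, of j "\<lambda>j. cmod (v j)"] v by simp
    then show "cmod (x i j * v j) \<le> cmod (x i j)"
      unfolding norm_mult by (rule mult_left_le) simp
  qed
  finally show "L2_set (\<lambda>i. cmod (\<Sum>j\<in>I. x i j * v j)) I \<le> (\<Sum>i\<in>I. \<Sum>j\<in>I. cmod (x i j))" .
qed

lemma mnorm_nonneg:
  assumes "finite I"
  shows "0 \<le> mnorm I x"
proof -
  define v :: "'a \<Rightarrow> complex" where "v = (\<lambda>_. 0)"
  have "L2_set (\<lambda>j. cmod (v j)) I \<le> 1" by (simp add: v_def L2_set_def)
  then have "L2_set (\<lambda>i. cmod (\<Sum>j\<in>I. x i j * v j)) I \<le> mnorm I x"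
    unfolding mnorm_def by (intro cSup_upper mnorm_values_bounded assms) blast
  then show ?thesis by (simp add: v_def L2_set_def)
qed

lemma entry_le_mnorm:
  assumes "finite I" "p \<in> I" "q \<in> I"
  shows "cmod (x p q) \<le> mnorm I x"
proof -
  define v :: "'a \<Rightarrow> complex" where "v = (\<lambda>r. if r = q then 1 else 0)"
  have "L2_set (\<lambda>j. cmod (v j)) I = sqrt (\<Sum>j\<in>I. if j = q then 1 else 0)"
    unfolding L2_set_def v_def by (intro arg_cong[of _ _ sqrt] sum.cong) auto
  then have v: "L2_set (\<lambda>j. cmod (v j)) I \<le> 1" using assms by simp
  have "(\<Sum>j\<in>I. x p j * v j) = (\<Sum>j\<in>I. if j = q then x p q else 0)"
    unfolding v_def by (intro sum.cong) auto
  then have "cmod (x p q) = cmod (\<Sum>j\<in>I. x p j * v j)" using assms by simp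
  also have "\<dots> \<le> L2_set (\<lambda>i. cmod (\<Sum>j\<in>I. x i j * v j)) I"
    by (rule member_le_L2_set[OF assms(1,2), of "\<lambda>i. cmod (\<Sum>j\<in>I. x i j * v j)"])
  also have "\<dots> \<le> mnorm I x"
    unfolding mnorm_def using v by (intro cSup_upper mnorm_values_bounded assms(1)) blast
  finally show ?thesis .
qed

lemma mnorm_mzero: "mnorm I mzero = 0"
proof -
  have "{L2_set (\<lambda>i. cmod (\<Sum>j\<in>I. mzero i j * v j)) I | v. L2_set (\<lambda>j. cmod (v j)) I \<le> 1} = {0}"
  proof -
    have "\<exists>v :: 'a \<Rightarrow> complex. L2_set (\<lambda>j. cmod (v j)) I \<le> 1"
      by (rule exI[of _ "\<lambda>_. 0"]) (simp add: L2_set_def)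
    then show ?thesis by (auto simp: mzero_def L2_set_def)
  qed
  then show ?thesis unfolding mnorm_def by simp
qed

text \<open>Multiplying a nonzero element of the ideal by matrix units yields a diagonal matrix unit in the
  ideal.  It also lies in the operator system, since \<open>R\<close> is reflexive, and has norm at least one there, whereas
  its class in the quotient is zero.\<close>

lemma boundary_ideal_trivial:
  assumes "block_pattern X R Ks"
    and J: "boundary_ideal X (graph_operator_system X R) (graph_operator_system X (block_rel Ks)) J"
  shows "J = {mzero}"
proof (rule ccontr)
  assume "J \<noteq> {mzero}"
  let ?Q = "block_rel Ks" and ?A = "graph_operator_system X (block_rel Ks)"
  note R = block_patternD[OF assms(1)] and Q = block_patternD[OF block_pattern_block_rel[OF assms(1)]]
  have ideal: "J \<subseteq> ?A" "mzero \<in> J" "\<And>x c. x \<in> J \<Longrightarrow> mscale c x \<in> J"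
    "\<And>x a. x \<in> J \<Longrightarrow> a \<in> ?A \<Longrightarrow> mmul X a x \<in> J" "\<And>x a. x \<in> J \<Longrightarrow> a \<in> ?A \<Longrightarrow> mmul X x a \<in> J"
    using J unfolding boundary_ideal_def closed_ideal_def by auto
  obtain x where x: "x \<in> J" "x \<noteq> mzero" using \<open>J \<noteq> {mzero}\<close> ideal(2) by blast
  then obtain i j where xij: "x i j \<noteq> 0" unfolding mzero_def by (auto simp: fun_eq_iff)
  then have ij: "(i, j) \<in> ?Q" using x(1) ideal(1) unfolding graph_operator_system_iff[OF Q(2), symmetric]
    using graph_operator_system_iff[OF Q(2), of x] by blast
  then have iX: "i \<in> X" "j \<in> X" using Q(2) by auto
  have unit: "matrix_unit k l \<in> ?A" if "(k, l) \<in> ?Q" for k l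
    unfolding graph_operator_system_iff[OF Q(2)] matrix_unit_def using that by auto
  have "mmul X (matrix_unit i i) (mmul X x (matrix_unit j i)) \<in> J"
    using ij iX Q(3,4) by (intro ideal(4,5) x(1) unit) (auto dest: symD)
  then have "mscale (- inverse (x i j)) (mmul X (matrix_unit i i) (mmul X x (matrix_unit j i))) \<in> J"
    by (rule ideal(3))
  also have "mscale (- inverse (x i j)) (mmul X (matrix_unit i i) (mmul X x (matrix_unit j i))) = mscale (-1) (matrix_unit i i)"
    unfolding mmul_matrix_unit_left[OF R(1) iX(1)] mmul_matrix_unit_right[OF R(1) iX(2)]
    using xij by (intro ext) (simp add: mscale_def matrix_unit_def)
  finally have neg: "mscale (-1) (matrix_unit i i) \<in> J" .
  define emb :: "'a cmatrix \<Rightarrow> (nat \<times> 'a) cmatrix" where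
    "emb = (\<lambda>z (a, k) (b, l). if a = 1 \<and> b = 1 then z k l else 0)"
  have emb: "emb z \<in> amp 1 X S" if "z \<in> S" "S \<subseteq> mats X" for z S
  proof -
    have "z \<in> mats X" using that by blast
    then have "emb z \<in> mats ({1..1} \<times> X)" unfolding mats_def emb_def by auto
    moreover have "(\<lambda>i j. emb z (a, i) (b, j)) \<in> S" if "a \<in> {1..1}" "b \<in> {1..1}" for a b
      using that \<open>z \<in> S\<close> by (simp add: emb_def)
    ultimately show ?thesis unfolding amp_def by blast
  qed
  let ?I = "{1..1::nat} \<times> X" and ?u = "emb (matrix_unit i i)"
  let ?N = "{mnorm ?I (madd ?u y) | y. y \<in> amp 1 X J}"
  have finI: "finite ?I" using R(1) by simp
  have "matrix_unit i i \<in> graph_operator_system X R"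
    unfolding graph_operator_system_iff[OF R(2)] matrix_unit_def using R(3)[OF iX(1)] by auto
  then have "?u \<in> amp 1 X (graph_operator_system X R)"
    by (rule emb) (auto simp: graph_operator_system_def)
  then have "Inf ?N = mnorm ?I ?u" using J unfolding boundary_ideal_def by blast
  moreover have "0 \<in> ?N"
  proof -
    have "emb (mscale (-1) (matrix_unit i i)) \<in> amp 1 X J"
      using ideal(1) by (intro emb neg) (auto simp: graph_operator_system_def)
    moreover have "madd ?u (emb (mscale (-1) (matrix_unit i i))) = mzero"
      by (intro ext) (auto simp: madd_def emb_def mscale_def mzero_def split: prod.split)
    ultimately show ?thesis using mnorm_mzero[of ?I] by force
  qed
  moreover have "bdd_below ?N" using mnorm_nonneg[OF finI] by (intro bdd_belowI[of _ 0]) auto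
  ultimately have "mnorm ?I ?u \<le> 0" using cInf_lower[of 0 ?N] by simp
  moreover have "cmod (?u (1, i) (1, i)) \<le> mnorm ?I ?u"
    using iX by (intro entry_le_mnorm[OF finI]) auto
  ultimately show False by (simp add: emb_def matrix_unit_def)
qed

section \<open>Tolerance relations\<close>

lemma generated_equiv_eq_trancl:
  assumes "tolerance_relation X R"
  shows "generated_equiv X R = R\<^sup>+" "equiv X (R\<^sup>+)"
proof -
  have R: "R \<subseteq> X \<times> X" "refl_on X R" "sym R" using assms unfolding tolerance_relation_def by auto
  have "refl_on X (R\<^sup>+)" using R(2) unfolding refl_on_def by auto
  then show eq: "equiv X (R\<^sup>+)"
    using trancl_subset_Sigma[OF R(1)] sym_trancl[OF R(3)] unfolding equiv_def by simp
  have "R\<^sup>+ \<subseteq> S" if S: "equiv X S" "R \<subseteq> S" for S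
  proof (rule subrelI)
    fix i j assume "(i, j) \<in> R\<^sup>+"
    then show "(i, j) \<in> S"
    proof (induction rule: trancl_induct)
      case (step k j)
      then show ?case using S unfolding equiv_def by (meson subsetD transE)
    qed (use S in blast)
  qed
  moreover have "R \<subseteq> R\<^sup>+" by auto
  ultimately show "generated_equiv X R = R\<^sup>+"
    unfolding generated_equiv_def using eq by (intro equalityI Inter_lower Inter_greatest) auto
qed

lemma block_system_tolerance:
  assumes "finite X" "tolerance_relation X R"
  shows "block_system X R (tolerance_components X R)"
proof -
  have R: "R \<subseteq> X \<times> X" "refl_on X R" "sym R" using assms(2) unfolding tolerance_relation_def by auto
  note eq = generated_equiv_eq_trancl(2)[OF assms(2)]
  have Ks: "tolerance_components X R = X // R\<^sup>+"
    unfolding tolerance_components_def generated_equiv_eq_trancl(1)[OF assms(2)] ..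
  have "block_pattern X R (X // R\<^sup>+)"
  proof (rule block_patternI)
    show "finite X" "R \<subseteq> X \<times> X" "sym R" by fact+
    show "(i, i) \<in> R" if "i \<in> X" for i using R(2) that by (simp add: refl_on_def)
    show "\<Union>(X // R\<^sup>+) = X" by (rule Union_quotient[OF eq])
  next
    fix L i j assume L: "L \<in> X // R\<^sup>+" and i: "i \<in> L"
    then obtain k where k: "L = R\<^sup>+ `` {k}" unfolding quotient_def by blast
    show "(i, j) \<in> R\<^sup>*" if "j \<in> L"
      using quotient_eq_iff[OF eq L L i that] by (simp add: trancl_into_rtrancl)
    show "j \<in> L" if "(i, j) \<in> R"
      using i that unfolding k by (auto intro: trancl_into_trancl)
  qed
  moreover have "{} \<notin> X // R\<^sup>+" using in_quotient_imp_non_empty[OF eq] by blast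
  ultimately show ?thesis unfolding Ks by unfold_locales
qed

lemma block_sum_eq:
  assumes "block_pattern X R Ks"
  shows "block_sum Ks = graph_operator_system X (block_rel Ks)"
proof -
  note Q = block_patternD[OF block_pattern_block_rel[OF assms]]
  have fin: "finite Ks" using Q(1,5) by (metis finite_UnionD)
  show ?thesis
  proof (intro equalityI subsetI)
    fix y assume "y \<in> block_sum Ks"
    then obtain x where x: "y = (\<lambda>i j. \<Sum>K\<in>Ks. x K i j)" "\<forall>K\<in>Ks. x K \<in> mats K"
      unfolding block_sum_def by blast
    show "y \<in> graph_operator_system X (block_rel Ks)"
      unfolding graph_operator_system_iff[OF Q(2)] x(1)
    proof (intro allI impI sum.neutral ballI)
      fix i j K assume "(i, j) \<notin> block_rel Ks" "K \<in> Ks"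
      then have "(i, j) \<notin> K \<times> K" unfolding block_rel_def by auto
      then show "x K i j = 0" using x(2) \<open>K \<in> Ks\<close> unfolding mats_def by blast
    qed
  next
    fix y assume y: "y \<in> graph_operator_system X (block_rel Ks)"
    define x where "x = (\<lambda>K i j. if i \<in> K \<and> j \<in> K then y i j else 0)"
    have "y i j = (\<Sum>K\<in>Ks. x K i j)" for i j
    proof (cases "(i, j) \<in> block_rel Ks")
      case True
      then obtain L where L: "L \<in> Ks" "i \<in> L" "j \<in> L" unfolding block_rel_def by auto
      have "(\<Sum>K\<in>Ks. x K i j) = (\<Sum>K\<in>Ks. if K = L then y i j else 0)"
      proof (rule sum.cong[OF refl])
        fix K assume K: "K \<in> Ks"
        show "x K i j = (if K = L then y i j else 0)"
        proof (cases "K = L")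
          case False
          then have "i \<notin> K" using block_pattern_disjoint[OF assms K L(1) _ L(2)] by blast
          then show ?thesis using False by (simp add: x_def)
        qed (use L in \<open>simp add: x_def\<close>)
      qed
      then show ?thesis using fin L(1) by simp
    next
      case False
      then have "(\<Sum>K\<in>Ks. x K i j) = 0" by (intro sum.neutral) (auto simp: x_def block_rel_def)
      then show ?thesis using y False unfolding graph_operator_system_iff[OF Q(2)] by simp
    qed
    then have "y = (\<lambda>i j. \<Sum>K\<in>Ks. x K i j)" by (intro ext)
    moreover have "\<forall>K\<in>Ks. x K \<in> mats K" by (auto simp: x_def mats_def)
    ultimately show "y \<in> block_sum Ks" unfolding block_sum_def by blast
  qed
qed

theorem mainTheorem7:
  fixes n :: nat and R :: "nat rel"
  assumes "n \<ge> 1" and "tolerance_relation {1..n} R"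
  defines "X \<equiv> {1..n}"
  defines "E \<equiv> graph_operator_system X R"
  defines "Ks \<equiv> tolerance_components X R"
  defines "A \<equiv> block_sum Ks"
  shows "is_cstar_envelope X E A
    \<and> (\<forall>m\<ge>1. bij_betw (V0_incl X A m) (V0 X E A m) (V0 X A A m))
    \<and> (\<forall>m\<ge>1. \<forall>m'\<ge>m. \<forall>c\<in>V0 X E A m.
         V0_incl X A m' (V0_connect X E A m m' c) = V0_connect X A A m m' (V0_incl X A m c))
    \<and> K0 X E A \<cong> K0 X A A
    \<and> K0 X A A \<cong> product_group {..<card Ks} (\<lambda>_. integer_group)"
proof -
  interpret sys: block_system X R Ks
    unfolding Ks_def by (rule block_system_tolerance) (use assms(2) in \<open>simp_all add: X_def\<close>)
  have A: "A = graph_operator_system X (block_rel Ks)"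
    unfolding A_def by (rule block_sum_eq[OF sys.pattern])
  have "is_cstar_envelope X E A"
    unfolding is_cstar_envelope_def A E_def cstar_generated_graph_operator_system[OF sys.pattern]
    using boundary_ideal_trivial[OF sys.pattern] by simp
  moreover have "\<forall>m\<ge>1. bij_betw (V0_incl X A m) (V0 X E A m) (V0 X A A m)"
    unfolding A E_def using sys.V0_incl_bij by simp
  moreover have "\<forall>m\<ge>1. \<forall>m'\<ge>m. \<forall>c\<in>V0 X E A m.
      V0_incl X A m' (V0_connect X E A m m' c) = V0_connect X A A m m' (V0_incl X A m c)"
    unfolding A E_def using sys.V0_incl_connect by simp
  moreover have "K0 X E A \<cong> K0 X A A" "K0 X A A \<cong> product_group {..<card Ks} (\<lambda>_. integer_group)"
    unfolding A E_def by (rule sys.K0_envelope)+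
  ultimately show ?thesis by (intro conjI)
qed

end
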